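(* Let $\chi\in\mathcal D((-\tfrac12,\tfrac12))\setminus\{0\}$. For every $1\le p<\infty$ with $p\ne2$ there exists an element $c\in(\mathcal FL^p)^0_d(\mathbb Z)$ such that the series $\sum_{\lambda\in\mathbb Z}c_\lambda T_\lambda\chi$ is not unconditionally convergent in $\mathcal FL^p(\mathbb R)$. For $p=1$ there even exists an element $c\in(\mathcal FL^1)^0_d(\mathbb Z)$ such that the sequence of symmetric partial sums $\big(\sum_{|\lambda|\le N}c_\lambda T_\lambda\chi\big)_{N\in\mathbb N}$ does not converge in $\mathcal FL^1(\mathbb R)$.
   Context: $T_\lambda f(t)=f(t-\lambda)$. $\mathcal FL^p(\mathbb R)=\{f\in\mathcal S'(\mathbb R):\mathcal F^{-1}f\in L^p(\mathbb R)\}$ with norm $\|\mathcal F^{-1}f\|_{L^p}$, where $\mathcal Ff(\xi)=\int f(x)e^{-2\pi i x\xi}dx$. The discrete space is $(\mathcal FL^p)^0_d(\mathbb Z)=\{c\in\mathbb C^{\mathbb Z}:\sum_{\lambda\in\mathbb Z}c_\lambda T_\lambda\chi\in\mathcal FL^p(\mathbb R)\}$ with norm $\|\sum_\lambda c_\lambda T_\lambda\chi\|_{\mathcal FL^p}$, where $\chi\in\mathcal D((-\frac12,\frac12))\setminus\{0\}$; different choices of $\chi$ yield the same space with equivalent norms. $\mathcal D(V)$ is the space of smooth functions with compact support in $V$. *)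

theory Defs
  imports "HOL-Analysis.Analysis"
begin

subsection \<open>Smooth functions, test functions and Schwartz functions on the real line\<close>

definition nth_vderiv :: "nat \<Rightarrow> (real \<Rightarrow> complex) \<Rightarrow> real \<Rightarrow> complex" where
  "nth_vderiv n f = ((\<lambda>g x. vector_derivative g (at x)) ^^ n) f"

definition smooth :: "(real \<Rightarrow> complex) \<Rightarrow> bool" where
  "smooth f \<longleftrightarrow> (\<forall>n x. nth_vderiv n f differentiable (at x))"

definition test_functions :: "real set \<Rightarrow> (real \<Rightarrow> complex) set" where
  "test_functions V = {f. smooth f \<and> compact (closure {x. f x \<noteq> 0}) \<and> closure {x. f x \<noteq> 0} \<subseteq> V}"

definition schwartz :: "(real \<Rightarrow> complex) set" where
  "schwartz = {f. smooth f \<and> (\<forall>j n. bounded (range (\<lambda>x. x ^ j *\<^sub>R nth_vderiv n f x)))}"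

definition schwartz_seminorm :: "nat \<Rightarrow> nat \<Rightarrow> (real \<Rightarrow> complex) \<Rightarrow> real" where
  "schwartz_seminorm j n f = (SUP x. norm (x ^ j *\<^sub>R nth_vderiv n f x))"

subsection \<open>Tempered distributions\<close>

text \<open>A tempered distribution is a continuous linear functional on the Schwartz space. Functionals
  are total functions here, so they are normalised to be \<open>0\<close> outside the Schwartz space; in this way
  equality and difference of distributions are equality and pointwise difference of functions.\<close>

definition tempered :: "((real \<Rightarrow> complex) \<Rightarrow> complex) set" where
  "tempered = {u.
     (\<forall>\<phi>. \<phi> \<notin> schwartz \<longrightarrow> u \<phi> = 0) \<and>
     (\<forall>\<phi>\<in>schwartz. \<forall>\<psi>\<in>schwartz. u (\<lambda>x. \<phi> x + \<psi> x) = u \<phi> + u \<psi>) \<and>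
     (\<forall>a. \<forall>\<phi>\<in>schwartz. u (\<lambda>x. a * \<phi> x) = a * u \<phi>) \<and>
     (\<exists>C N. \<forall>\<phi>\<in>schwartz. norm (u \<phi>) \<le> C * (\<Sum>j\<le>N. \<Sum>n\<le>N. schwartz_seminorm j n \<phi>))}"

definition distr_of :: "(real \<Rightarrow> complex) \<Rightarrow> (real \<Rightarrow> complex) \<Rightarrow> complex" where
  "distr_of g \<phi> = (if \<phi> \<in> schwartz then LINT x|lborel. g x * \<phi> x else 0)"

definition inv_fourier :: "(real \<Rightarrow> complex) \<Rightarrow> real \<Rightarrow> complex" where
  "inv_fourier f x = (LINT \<xi>|lborel. f \<xi> * exp (2 * of_real pi * \<i> * of_real x * of_real \<xi>))"

definition inv_fourier_distr ::
  "((real \<Rightarrow> complex) \<Rightarrow> complex) \<Rightarrow> (real \<Rightarrow> complex) \<Rightarrow> complex" where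
  "inv_fourier_distr u \<phi> = (if \<phi> \<in> schwartz then u (inv_fourier \<phi>) else 0)"

subsection \<open>The spaces \<open>L\<^sup>p\<close> and \<open>FL\<^sup>p\<close> for finite \<open>p\<close>\<close>

definition Lp_space :: "real \<Rightarrow> (real \<Rightarrow> complex) set" where
  "Lp_space p = {g \<in> borel_measurable lborel. integrable lborel (\<lambda>x. norm (g x) powr p)}"

definition Lp_norm :: "real \<Rightarrow> (real \<Rightarrow> complex) \<Rightarrow> real" where
  "Lp_norm p g = (LINT x|lborel. norm (g x) powr p) powr (1 / p)"

definition FL :: "real \<Rightarrow> ((real \<Rightarrow> complex) \<Rightarrow> complex) set" where
  "FL p = {u \<in> tempered. \<exists>g\<in>Lp_space p. inv_fourier_distr u = distr_of g}"

text \<open>The representative \<open>g\<close> is unique up to null sets, so the norm does not depend on the choice.\<close>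

definition FL_norm :: "real \<Rightarrow> ((real \<Rightarrow> complex) \<Rightarrow> complex) \<Rightarrow> real" where
  "FL_norm p u = Lp_norm p (SOME g. g \<in> Lp_space p \<and> inv_fourier_distr u = distr_of g)"

definition FL_tendsto :: "real \<Rightarrow> ('i \<Rightarrow> (real \<Rightarrow> complex) \<Rightarrow> complex) \<Rightarrow>
    ((real \<Rightarrow> complex) \<Rightarrow> complex) \<Rightarrow> 'i filter \<Rightarrow> bool" where
  "FL_tendsto p s u F \<longleftrightarrow> u \<in> FL p \<and> (\<forall>\<^sub>F i in F. s i \<in> FL p) \<and>
     ((\<lambda>i. FL_norm p (\<lambda>\<phi>. s i \<phi> - u \<phi>)) \<longlongrightarrow> 0) F"

subsection \<open>Series of integer translates and the discrete space\<close>

definition translate :: "real \<Rightarrow> (real \<Rightarrow> complex) \<Rightarrow> real \<Rightarrow> complex" where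
  "translate a f t = f (t - a)"

definition partial_series ::
  "(real \<Rightarrow> complex) \<Rightarrow> (int \<Rightarrow> complex) \<Rightarrow> int set \<Rightarrow> real \<Rightarrow> complex" where
  "partial_series chi c A t = (\<Sum>k\<in>A. c k * translate (of_int k) chi t)"

text \<open>For \<open>chi\<close> supported in the open interval from \<open>-1/2\<close> to \<open>1/2\<close>, at most one term of the following
  sum is nonzero for each \<open>t\<close>, whatever \<open>c\<close> is.\<close>

definition full_series ::
  "(real \<Rightarrow> complex) \<Rightarrow> (int \<Rightarrow> complex) \<Rightarrow> real \<Rightarrow> complex" where
  "full_series chi c t = (\<Sum>\<^sub>\<infinity>k\<in>UNIV. c k * translate (of_int k) chi t)"

text \<open>For arbitrary \<open>c\<close> the full series is a priori only a distribution given by a smooth function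
  without growth restriction. It belongs to \<open>FL p\<close> if it coincides, as a distribution, i.e. on
  compactly supported test functions, with a member of \<open>FL p\<close>, which is then unique by density.\<close>

definition discrete_FL :: "real \<Rightarrow> (real \<Rightarrow> complex) \<Rightarrow> (int \<Rightarrow> complex) set" where
  "discrete_FL p chi = {c. \<exists>u\<in>FL p. \<forall>\<phi>\<in>test_functions UNIV.
     u \<phi> = (LINT t|lborel. full_series chi c t * \<phi> t)}"

text \<open>Unconditional convergence is convergence of the net of all finite partial sums. These are
  Schwartz functions, regarded as elements of \<open>FL p\<close> through \<open>distr_of\<close>.\<close>

definition unconditionally_convergent_FL ::
  "real \<Rightarrow> (real \<Rightarrow> complex) \<Rightarrow> (int \<Rightarrow> complex) \<Rightarrow> bool" where
  "unconditionally_convergent_FL p chi c \<longleftrightarrow>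
     (\<exists>u. FL_tendsto p (\<lambda>A. distr_of (partial_series chi c A)) u (finite_subsets_at_top UNIV))"

definition symmetrically_convergent_FL ::
  "real \<Rightarrow> (real \<Rightarrow> complex) \<Rightarrow> (int \<Rightarrow> complex) \<Rightarrow> bool" where
  "symmetrically_convergent_FL p chi c \<longleftrightarrow>
     (\<exists>u. FL_tendsto p (\<lambda>N. distr_of (partial_series chi c {- int N..int N})) u sequentially)"

end

theory Submission
  imports Defs "HOL-Probability.Sinc_Integral"
begin

text \<open>With \<open>h\<close> the inverse Fourier transform of \<open>chi\<close>, a finite sum of translates \<open>\<Sum> c\<^sub>k T\<^sub>k chi\<close> has
  \<open>FL p\<close> norm \<open>\<parallel>P h\<parallel>\<^sub>p\<close>, where \<open>P x = \<Sum> c\<^sub>k exp (2 \<pi> i k x)\<close>. A gliding hump therefore reduces both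
  claims to finding trigonometric polynomials \<open>P\<close> that have a subsum \<open>Q\<close> with \<open>\<parallel>Q h\<parallel>\<^sub>p\<close> much larger than
  \<open>\<parallel>P h\<parallel>\<^sub>p\<close>. If \<open>R\<close> is a Rudin--Shapiro polynomial and \<open>D\<close> the Dirichlet kernel of length \<open>N\<close>, each of
  \<open>R\<close>, \<open>D\<close> is the difference of two subsums of the other. As \<open>\<bar>R\<bar> \<le> sqrt (2 N)\<close>, while \<open>D\<close> has a peak
  of height \<open>N\<close> and width \<open>1/N\<close>, subsums of \<open>P = R\<close> work for \<open>p > 2\<close>. For \<open>p < 2\<close> take for \<open>P\<close> a de la
  Vallee-Poussin kernel, which contains \<open>D\<close> and has norm at most of order \<open>N\<^bsup>1 - 1/p\<^esup>\<close>: the identity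
  \<open>\<bar>R\<bar>\<^sup>2 + \<bar>R'\<bar>\<^sup>2 = 2 N\<close> for the Rudin--Shapiro partner \<open>R'\<close> makes the norm of \<open>R\<close> or \<open>R'\<close> at least of
  order \<open>sqrt N\<close>. For \<open>p = 1\<close> and symmetric partial sums, \<open>P\<close> is a Fejer kernel and \<open>Q\<close> its part of
  nonpositive frequency, whose norm grows like \<open>ln N\<close>.\<close>

section \<open>Smooth functions and Schwartz functions\<close>

text \<open>Humps \<open>P\<close> are shifted to high frequencies and scaled so that the large
  subsums have norm 1 while the norms of the \<open>P\<close> themselves are summable. Placed side
  by side they give a series whose sum lies in the space, although arbitrarily far out there are
  subsums of norm 1, against the Cauchy condition. For length N the p-th powers of the norms of
  \<open>P\<close> and \<open>Q\<close> have orders N^(p/2) and N^(p-1) if p > 2, and the reverse if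
  p < 2; the exponents meet exactly at p = 2. Three obstacles shape the rest. The weight
  \<open>h\<close> is not periodic, so integrals over a period must be transferred to the line
  against 1 / (1 + x^2). It may vanish at 0, where the kernels peak, so they are modulated to a
  point where it does not. And a norm in \<open>FL p\<close> refers to a chosen representative, so
  uniqueness up to null sets is needed; the cutoffs for it are made from \<open>chi\<close> itself,
  through a nonvanishing moment. For symmetric sums all humps sit at positive frequencies, so that a
  symmetric partial sum cuts a hump at one point only.\<close>

lemma nth_vderiv_0 [simp]: "nth_vderiv 0 f = f"
  by (simp add: nth_vderiv_def)

lemma nth_vderiv_Suc: "nth_vderiv (Suc n) f = (\<lambda>x. vector_derivative (nth_vderiv n f) (at x))"
  by (simp add: nth_vderiv_def)

lemma nth_vderiv_Suc_left: "nth_vderiv (Suc n) f = nth_vderiv n (\<lambda>x. vector_derivative f (at x))"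
  by (simp add: nth_vderiv_def funpow_Suc_right del: funpow.simps)

lemma has_vector_derivative_nth_vderiv:
  assumes "smooth f"
  shows "(nth_vderiv n f has_vector_derivative nth_vderiv (Suc n) f x) (at x)"
  using assms by (simp add: smooth_def nth_vderiv_Suc vector_derivative_works)

lemma continuous_on_nth_vderiv: "smooth f \<Longrightarrow> continuous_on S (nth_vderiv n f)"
  by (meson continuous_at_imp_continuous_on has_vector_derivative_continuous
      has_vector_derivative_nth_vderiv)

lemma smooth_continuous: "smooth f \<Longrightarrow> continuous_on S f"
  using continuous_on_nth_vderiv[of f S 0] by simp

lemma smooth_vderiv: "smooth f \<Longrightarrow> smooth (\<lambda>x. vector_derivative f (at x))"
  by (simp add: smooth_def flip: nth_vderiv_Suc_left)

lemma smooth_antiderivative: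
  assumes "smooth f" "\<And>x. (F has_vector_derivative f x) (at x)"
  shows "smooth F"
  unfolding smooth_def
proof (intro allI)
  fix n x
  have "(\<lambda>x. vector_derivative F (at x)) = f"
    by (intro ext vector_derivative_at assms(2))
  with assms(1) show "nth_vderiv n F differentiable (at x)"
    by (cases n) (simp_all add: nth_vderiv_Suc_left smooth_def differentiableI_vector[OF assms(2)])
qed

lemma nth_vderiv_add:
  assumes "smooth f" "smooth g"
  shows "nth_vderiv n (\<lambda>x. f x + g x) = (\<lambda>x. nth_vderiv n f x + nth_vderiv n g x)"
proof (induction n)
  case (Suc n)
  show ?case
    unfolding nth_vderiv_Suc Suc
    by (intro ext vector_derivative_at has_vector_derivative_add)
       (use assms in \<open>simp_all add: vector_derivative_works[symmetric] smooth_def\<close>)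
qed simp

lemma nth_vderiv_cmult:
  assumes "smooth f"
  shows "nth_vderiv n (\<lambda>x. a * f x) = (\<lambda>x. a * nth_vderiv n f x)"
proof (induction n)
  case (Suc n)
  show ?case
    unfolding nth_vderiv_Suc Suc
    by (intro ext vector_derivative_at has_vector_derivative_mult_right)
       (use assms in \<open>simp_all add: vector_derivative_works[symmetric] smooth_def\<close>)
qed simp

text \<open>Leibniz rule with a linear factor. At \<open>n = 0\<close> the truncated
  \<open>n - 1\<close> is harmless because it is multiplied by 0.\<close>

lemma nth_vderiv_times_x:
  assumes "smooth f"
  shows "nth_vderiv n (\<lambda>x. x *\<^sub>R f x) =
    (\<lambda>x. x *\<^sub>R nth_vderiv n f x + of_nat n * nth_vderiv (n - 1) f x)"
proof (induction n)
  case (Suc n)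
  note D = has_vector_derivative_nth_vderiv[OF assms]
  have D': "((\<lambda>x. of_nat n * nth_vderiv (n - 1) f x) has_vector_derivative
      of_nat n * nth_vderiv n f x) (at x)" for x
    using D[of "n - 1" x] by (cases n) (auto intro!: has_vector_derivative_mult_right)
  have "((\<lambda>x. x *\<^sub>R nth_vderiv n f x + of_nat n * nth_vderiv (n - 1) f x) has_vector_derivative
      (x *\<^sub>R nth_vderiv (Suc n) f x + of_nat (Suc n) * nth_vderiv n f x)) (at x)" for x
    by (rule has_vector_derivative_eq_rhs[OF has_vector_derivative_add[OF
          has_vector_derivative_scaleR[OF DERIV_ident D] D']]) (simp add: algebra_simps)
  then show ?case
    unfolding nth_vderiv_Suc[of n "\<lambda>x. x *\<^sub>R f x"] Suc by (intro ext) (simp add: vector_derivative_at)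
qed simp

lemma nth_vderiv_affine:
  assumes "smooth f"
  shows "nth_vderiv n (\<lambda>x. f (a * x + b)) = (\<lambda>x. of_real a ^ n * nth_vderiv n f (a * x + b))"
proof (induction n)
  case (Suc n)
  have "((\<lambda>x. nth_vderiv n f (a * x + b)) has_vector_derivative
      a *\<^sub>R nth_vderiv (Suc n) f (a * x + b)) (at x)" for x
    by (rule vector_diff_chain_at[of "\<lambda>x. a * x + b" a x "nth_vderiv n f", OF _
          has_vector_derivative_nth_vderiv[OF assms], unfolded o_def])
       (auto intro!: derivative_eq_intros simp flip: has_real_derivative_iff_has_vector_derivative)
  from has_vector_derivative_mult_right[OF this, of "of_real a ^ n"]
  show ?case
    unfolding nth_vderiv_Suc[of n "\<lambda>x. f (a * x + b)"] Suc
    by (intro ext) (simp add: vector_derivative_at scaleR_conv_of_real mult_ac)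
qed simp

lemma smooth_add: "smooth f \<Longrightarrow> smooth g \<Longrightarrow> smooth (\<lambda>x. f x + g x)"
  by (simp add: smooth_def[of "\<lambda>x. f x + g x"] nth_vderiv_add) (simp add: smooth_def)

lemma smooth_cmult: "smooth f \<Longrightarrow> smooth (\<lambda>x. a * f x)"
  by (simp add: smooth_def[of "\<lambda>x. a * f x"] nth_vderiv_cmult)
     (auto simp: smooth_def intro!: differentiable_mult)

lemma smooth_times_x: "smooth f \<Longrightarrow> smooth (\<lambda>x. x *\<^sub>R f x)"
  by (simp add: smooth_def[of "\<lambda>x. x *\<^sub>R f x"] nth_vderiv_times_x)
     (auto simp: smooth_def intro!: differentiable_add differentiable_mult differentiable_scaleR)

lemma smooth_affine:
  assumes "smooth f"
  shows "smooth (\<lambda>x. f (a * x + b))"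
proof -
  have "(\<lambda>x. nth_vderiv n f (a * x + b)) differentiable at x" for n x
    using differentiable_chain_at[of "\<lambda>x. a * x + b" x "nth_vderiv n f"] assms
    by (simp add: o_def smooth_def)
  then show ?thesis
    by (simp add: smooth_def[of "\<lambda>x. f (a * x + b)"] nth_vderiv_affine assms differentiable_mult)
qed

lemma smooth_schwartz: "f \<in> schwartz \<Longrightarrow> smooth f"
  by (simp add: schwartz_def)

lemma schwartz_vderiv: "f \<in> schwartz \<Longrightarrow> (\<lambda>x. vector_derivative f (at x)) \<in> schwartz"
  by (simp add: schwartz_def smooth_vderiv flip: nth_vderiv_Suc_left)

lemma schwartz_add:
  assumes "f \<in> schwartz" "g \<in> schwartz"
  shows "(\<lambda>x. f x + g x) \<in> schwartz"
proof -
  have "bounded (range (\<lambda>x. x ^ j *\<^sub>R nth_vderiv n f x + x ^ j *\<^sub>R nth_vderiv n g x))" for j n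
    using assms by (intro bounded_plus_comp) (auto simp: schwartz_def)
  with assms show ?thesis
    by (auto simp: schwartz_def smooth_add nth_vderiv_add scaleR_add_right)
qed

lemma schwartz_cmult:
  assumes "f \<in> schwartz"
  shows "(\<lambda>x. a * f x) \<in> schwartz"
proof -
  have "bounded (range (\<lambda>x. a * (x ^ j *\<^sub>R nth_vderiv n f x)))" for j n
    using assms bounded_linear_image[OF _ bounded_linear_mult_right, of "range (\<lambda>x. x ^ j *\<^sub>R nth_vderiv n f x)" a]
    by (simp add: schwartz_def image_image)
  with assms show ?thesis
    by (auto simp: schwartz_def smooth_cmult nth_vderiv_cmult)
qed

lemma schwartz_times_x:
  assumes "f \<in> schwartz"
  shows "(\<lambda>x. x *\<^sub>R f x) \<in> schwartz"
proof -
  have "bounded (range (\<lambda>x. x ^ Suc j *\<^sub>R nth_vderiv n f x + of_nat n * (x ^ j *\<^sub>R nth_vderiv (n - 1) f x)))"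
    for j n
    using assms bounded_linear_image[OF _ bounded_linear_mult_right,
        of "range (\<lambda>x. x ^ j *\<^sub>R nth_vderiv (n - 1) f x)" "of_nat n"]
    by (intro bounded_plus_comp) (auto simp: schwartz_def image_image simp del: power_Suc)
  then have "bounded (range (\<lambda>x. x ^ j *\<^sub>R nth_vderiv n (\<lambda>x. x *\<^sub>R f x) x))" for j n
    using assms by (simp add: nth_vderiv_times_x schwartz_def scaleR_add_right mult_ac)
  with assms show ?thesis
    by (auto simp: schwartz_def smooth_times_x)
qed

text \<open>Taking \<open>n\<close> derivatives and then multiplying \<open>j\<close> times by the
  variable never leaves \<open>S\<close>, so every function in the definition of
  \<open>schwartz\<close> is bounded. This spares explicit formulas for higher derivatives of a
  transform.\<close>

lemma schwartz_coinduct: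
  assumes "f \<in> S"
    and bdd: "\<And>g. g \<in> S \<Longrightarrow> bounded (range g)"
    and der: "\<And>g. g \<in> S \<Longrightarrow> \<exists>g'\<in>S. \<forall>x. (g has_vector_derivative g' x) (at x)"
    and times: "\<And>g. g \<in> S \<Longrightarrow> (\<lambda>x. x *\<^sub>R g x) \<in> S"
  shows "f \<in> schwartz"
proof -
  have D: "nth_vderiv n f \<in> S" for n
  proof (induction n)
    case (Suc n)
    then obtain g' where "g' \<in> S" "\<forall>x. (nth_vderiv n f has_vector_derivative g' x) (at x)"
      using der by blast
    then have "nth_vderiv (Suc n) f = g'"
      unfolding nth_vderiv_Suc by (intro ext vector_derivative_at) simp
    with \<open>g' \<in> S\<close> show ?case
      by simp
  qed (use assms in simp)
  have "(\<lambda>x. x ^ j *\<^sub>R nth_vderiv n f x) \<in> S" for j n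
  proof (induction j)
    case (Suc j)
    from times[OF this] show ?case
      by simp
  qed (use D in simp)
  moreover have "smooth f"
    using der[OF D] by (auto simp: smooth_def intro: differentiableI_vector)
  ultimately show ?thesis
    using bdd by (auto simp: schwartz_def)
qed

lemma smooth_bounded_support_schwartz:
  assumes "smooth f" and zero: "\<And>x. \<bar>x\<bar> > M \<Longrightarrow> f x = 0"
  shows "f \<in> schwartz"
proof -
  have zero': "nth_vderiv n f x = 0" if "\<bar>x\<bar> > M" for n x
    using that
  proof (induction n arbitrary: x)
    case (Suc n)
    have "open {x::real. \<bar>x\<bar> > M}"
      by (intro open_Collect_less continuous_intros)
    with Suc have "(nth_vderiv n f has_vector_derivative 0) (at x)"
      by (intro has_vector_derivative_transform_within_open[OF has_vector_derivative_const, where S = "{x. \<bar>x\<bar> > M}"]) auto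
    then show ?case
      by (simp add: nth_vderiv_Suc vector_derivative_at)
  qed (use zero in simp)
  have "bounded (range (\<lambda>x. x ^ j *\<^sub>R nth_vderiv n f x))" for j n
  proof -
    have "bounded ((\<lambda>x. x ^ j *\<^sub>R nth_vderiv n f x) ` {-M..M})"
      by (intro compact_imp_bounded compact_continuous_image continuous_intros
          continuous_on_nth_vderiv assms) auto
    moreover have "range (\<lambda>x. x ^ j *\<^sub>R nth_vderiv n f x) \<subseteq>
        insert 0 ((\<lambda>x. x ^ j *\<^sub>R nth_vderiv n f x) ` {-M..M})"
      using zero'[of _ n] by (force simp: abs_le_iff not_less[symmetric] image_iff)
    ultimately show ?thesis
      by (meson bounded_insert bounded_subset)
  qed
  with assms show ?thesis
    by (auto simp: schwartz_def)
qed

lemma test_functions_bounded_support: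
  assumes "f \<in> test_functions V"
  obtains M where "\<And>x. \<bar>x\<bar> > M \<Longrightarrow> f x = 0"
proof -
  have "bounded {x. f x \<noteq> 0}"
    using assms by (auto simp: test_functions_def intro: bounded_subset compact_imp_bounded closure_subset)
  then obtain M where "\<And>x. f x \<noteq> 0 \<Longrightarrow> norm x \<le> M"
    by (auto simp: bounded_iff)
  then show ?thesis
    using that[of M] by (metis not_le real_norm_def)
qed

lemma test_functions_schwartz:
  assumes "f \<in> test_functions V"
  shows "f \<in> schwartz"
  using test_functions_bounded_support[OF assms] smooth_bounded_support_schwartz[of f] assms
  unfolding test_functions_def by blast

section \<open>Decay and integrability of Schwartz functions\<close>

lemma schwartz_seminorm_upper:
  assumes "f \<in> schwartz"
  shows "norm (x ^ j *\<^sub>R nth_vderiv n f x) \<le> schwartz_seminorm j n f"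
proof -
  have "bdd_above (range (\<lambda>x. norm (x ^ j *\<^sub>R nth_vderiv n f x)))"
    using assms by (auto simp: schwartz_def bounded_iff bdd_above_def)
  then show ?thesis
    unfolding schwartz_seminorm_def by (intro cSUP_upper) auto
qed

lemma schwartz_seminorm_nonneg: "f \<in> schwartz \<Longrightarrow> 0 \<le> schwartz_seminorm j n f"
  using schwartz_seminorm_upper[of f 0 j n] norm_ge_zero order_trans by blast

text \<open>The majorant 1 / (1 + x^2) is the only decay used in the whole proof: it is integrable
  and behaves well under translation.\<close>

lemma schwartz_decay:
  assumes "f \<in> schwartz"
  shows "norm (f x) \<le> (schwartz_seminorm 0 0 f + schwartz_seminorm 2 0 f) * inverse (1 + x\<^sup>2)"
proof -
  have "norm (f x) * (1 + x\<^sup>2) \<le> schwartz_seminorm 0 0 f + schwartz_seminorm 2 0 f"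
    using schwartz_seminorm_upper[OF assms, of x 0 0] schwartz_seminorm_upper[OF assms, of x 2 0]
    by (simp add: algebra_simps)
  then show ?thesis
    by (simp add: field_simps add_pos_nonneg)
qed

lemma integrable_inverse_1_plus_square_lborel: "integrable lborel (\<lambda>x::real. inverse (1 + x\<^sup>2))"
  using integrable_inverse_1_plus_square by (simp add: set_integrable_def)

lemma integrable_decay:
  fixes f :: "real \<Rightarrow> 'b::{banach, second_countable_topology}"
  assumes "f \<in> borel_measurable borel" "\<And>x. norm (f x) \<le> C * inverse (1 + x\<^sup>2)"
  shows "integrable lborel f"
proof (rule Bochner_Integration.integrable_bound)
  show "integrable lborel (\<lambda>x. C * inverse (1 + x\<^sup>2))"
    using integrable_inverse_1_plus_square_lborel by simp
  show "AE x in lborel. norm (f x) \<le> norm (C * inverse (1 + x\<^sup>2))"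
    using assms(2) order_trans[OF _ abs_ge_self] by (auto intro!: AE_I2)
qed (use assms in simp)

lemma borel_measurable_schwartz: "f \<in> schwartz \<Longrightarrow> f \<in> borel_measurable borel"
  by (simp add: borel_measurable_continuous_onI smooth_continuous smooth_schwartz)

lemma integrable_schwartz: "f \<in> schwartz \<Longrightarrow> integrable lborel f"
  by (rule integrable_decay[OF borel_measurable_schwartz schwartz_decay])

lemma bounded_schwartz: "f \<in> schwartz \<Longrightarrow> \<exists>B. \<forall>x. norm (f x) \<le> B"
  using schwartz_seminorm_upper[of f _ 0 0] by auto

text \<open>A general filter along which the modulus tends to infinity covers both ends of the line
  at once.\<close>

lemma tendsto_schwartz:
  assumes "f \<in> schwartz" "filterlim (\<lambda>x. \<bar>x\<bar>) at_top F"
  shows "(f \<longlongrightarrow> 0) F"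
proof -
  let ?C = "schwartz_seminorm 0 0 f + schwartz_seminorm 2 0 f"
  have "filterlim (\<lambda>x. 1 + \<bar>x\<bar>\<^sup>2) at_top F"
    by (intro filterlim_tendsto_add_at_top[OF tendsto_const] filterlim_pow_at_top assms(2)) simp
  then have "((\<lambda>x. ?C * inverse (1 + x\<^sup>2)) \<longlongrightarrow> 0) F"
    by (intro tendsto_mult_right_zero tendsto_inverse_0_at_top) simp
  then show ?thesis
    by (rule Lim_null_comparison[OF always_eventually, rotated]) (use schwartz_decay[OF assms(1)] in auto)
qed

section \<open>The Fourier transform of Schwartz functions\<close>

lemma inv_fourier_cis: "inv_fourier f x = (LINT \<xi>|lborel. f \<xi> * cis (2 * pi * x * \<xi>))"
  by (simp add: inv_fourier_def cis_conv_exp mult_ac)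

lemma norm_cis_diff_le: "norm (cis a - cis b) \<le> \<bar>a - b\<bar>"
proof -
  have "norm (cis a - cis b) \<le> 1 * norm (a - b)"
  proof (rule differentiable_bound[of UNIV cis])
    fix x :: real
    show "(cis has_derivative (\<lambda>h. h *\<^sub>R (\<i> * cis x))) (at x within UNIV)"
      using has_derivative_cis[OF has_derivative_ident] by simp
    show "onorm (\<lambda>h. h *\<^sub>R (\<i> * cis x)) \<le> 1"
      by (rule onorm_le) (simp add: norm_mult)
  qed auto
  then show ?thesis
    by simp
qed

lemma norm_inv_fourier_le: "norm (inv_fourier f x) \<le> (LINT \<xi>|lborel. norm (f \<xi>))"
  unfolding inv_fourier_cis by (rule order_trans[OF integral_norm_bound]) (simp add: norm_mult)

lemma integrable_mult_cis:
  assumes "integrable lborel f"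
  shows "integrable lborel (\<lambda>\<xi>. f \<xi> * cis (c * \<xi>))"
proof (rule Bochner_Integration.integrable_bound[OF assms])
  have "(\<lambda>\<xi>. cis (c * \<xi>)) \<in> borel_measurable borel"
    by (intro borel_measurable_continuous_onI continuous_intros)
  then show "(\<lambda>\<xi>. f \<xi> * cis (c * \<xi>)) \<in> borel_measurable lborel"
    using assms by measurable
qed (simp add: norm_mult)

text \<open>Difference quotients as a limit at a point can be tested along sequences, which is the
  form that dominated convergence needs.\<close>

lemma has_vector_derivative_at_iff_tendsto:
  fixes f :: "real \<Rightarrow> 'a::real_normed_vector"
  shows "(f has_vector_derivative D) (at x) \<longleftrightarrow> ((\<lambda>y. (f y - f x) /\<^sub>R (y - x)) \<longlongrightarrow> D) (at x)"
proof -
  have eq: "norm ((f y - f x) /\<^sub>R (y - x) - D) = norm (f y - f x - (y - x) *\<^sub>R D) / norm (y - x)"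
    if "y \<noteq> x" for y
  proof -
    have "(f y - f x) /\<^sub>R (y - x) - D = (f y - f x - (y - x) *\<^sub>R D) /\<^sub>R (y - x)"
      using that by (simp add: scaleR_diff_right)
    then show ?thesis
      by (simp add: divide_inverse mult.commute)
  qed
  have "((\<lambda>y. (f y - f x) /\<^sub>R (y - x)) \<longlongrightarrow> D) (at x) \<longleftrightarrow>
      ((\<lambda>y. norm ((f y - f x) /\<^sub>R (y - x) - D)) \<longlongrightarrow> 0) (at x)"
    by (simp add: LIM_zero_iff tendsto_norm_zero_iff)
  also have "\<dots> \<longleftrightarrow> ((\<lambda>y. norm (f y - f x - (y - x) *\<^sub>R D) / norm (y - x)) \<longlongrightarrow> 0) (at x)"
    by (rule tendsto_cong) (simp add: eventually_at_filter eq)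
  finally show ?thesis
    by (simp add: has_vector_derivative_def has_derivative_iff_norm bounded_linear_scaleR_left)
qed

text \<open>Differentiation under the integral sign. Since \<open>cis\<close> is 1-Lipschitz, the
  difference quotients of the integrand are dominated by 2 pi times the modulus of
  \<open>\<xi> *\<^sub>R f \<xi>\<close>.\<close>

lemma inv_fourier_has_vector_derivative:
  assumes f: "integrable lborel f" and xf: "integrable lborel (\<lambda>\<xi>. \<xi> *\<^sub>R f \<xi>)"
  shows "(inv_fourier f has_vector_derivative
           inv_fourier (\<lambda>\<xi>. 2 * of_real pi * \<i> * (\<xi> *\<^sub>R f \<xi>)) x) (at x)"
  unfolding has_vector_derivative_at_iff_tendsto tendsto_at_iff_sequentially o_def
proof safe
  fix X :: "nat \<Rightarrow> real" assume "\<forall>i. X i \<in> UNIV - {x}" and X': "X \<longlonglongrightarrow> x"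
  then have X: "X i \<noteq> x" for i
    by auto
  let ?s = "\<lambda>i \<xi>. (f \<xi> * cis (2 * pi * X i * \<xi>) - f \<xi> * cis (2 * pi * x * \<xi>)) /\<^sub>R (X i - x)"
  have eq: "(inv_fourier f (X i) - inv_fourier f x) /\<^sub>R (X i - x) = (LINT \<xi>|lborel. ?s i \<xi>)" for i
    unfolding inv_fourier_cis using integrable_mult_cis[OF f]
    by (simp add: Bochner_Integration.integral_diff)
  have "(\<lambda>i. LINT \<xi>|lborel. ?s i \<xi>) \<longlonglongrightarrow>
      (LINT \<xi>|lborel. 2 * of_real pi * \<i> * (\<xi> *\<^sub>R f \<xi>) * cis (2 * pi * x * \<xi>))"
  proof (rule integral_dominated_convergence)
    show "integrable lborel (\<lambda>\<xi>. 2 * pi * norm (\<xi> *\<^sub>R f \<xi>))"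
      using xf by (intro integrable_mult_right integrable_norm)
    show "(\<lambda>\<xi>. 2 * of_real pi * \<i> * (\<xi> *\<^sub>R f \<xi>) * cis (2 * pi * x * \<xi>)) \<in> borel_measurable lborel"
      by (intro borel_measurable_integrable integrable_mult_cis integrable_mult_right xf)
    show "?s i \<in> borel_measurable lborel" for i
      using integrable_mult_cis[OF f] by (intro borel_measurable_integrable) auto
    show "AE \<xi> in lborel. norm (?s i \<xi>) \<le> 2 * pi * norm (\<xi> *\<^sub>R f \<xi>)" for i
    proof (rule AE_I2)
      fix \<xi>
      have "norm (?s i \<xi>) = norm (f \<xi>) * norm (cis (2 * pi * X i * \<xi>) - cis (2 * pi * x * \<xi>)) / \<bar>X i - x\<bar>"
        by (simp add: norm_mult[symmetric] right_diff_distrib divide_inverse mult_ac)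
      also have "\<dots> \<le> norm (f \<xi>) * \<bar>2 * pi * X i * \<xi> - 2 * pi * x * \<xi>\<bar> / \<bar>X i - x\<bar>"
        by (intro divide_right_mono mult_left_mono norm_cis_diff_le) auto
      also have "\<bar>2 * pi * X i * \<xi> - 2 * pi * x * \<xi>\<bar> = \<bar>X i - x\<bar> * \<bar>2 * pi * \<xi>\<bar>"
        unfolding abs_mult[symmetric] by (simp add: algebra_simps)
      also have "norm (f \<xi>) * (\<bar>X i - x\<bar> * \<bar>2 * pi * \<xi>\<bar>) / \<bar>X i - x\<bar> = 2 * pi * norm (\<xi> *\<^sub>R f \<xi>)"
        using X[of i] by (simp add: abs_mult)
      finally show "norm (?s i \<xi>) \<le> 2 * pi * norm (\<xi> *\<^sub>R f \<xi>)" .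
    qed
    show "AE \<xi> in lborel. (\<lambda>i. ?s i \<xi>) \<longlonglongrightarrow> 2 * of_real pi * \<i> * (\<xi> *\<^sub>R f \<xi>) * cis (2 * pi * x * \<xi>)"
    proof (rule AE_I2)
      fix \<xi>
      have "((\<lambda>y. f \<xi> * cis (2 * pi * y * \<xi>)) has_vector_derivative
          2 * of_real pi * \<i> * (\<xi> *\<^sub>R f \<xi>) * cis (2 * pi * x * \<xi>)) (at x)"
        unfolding has_vector_derivative_def
        by (auto intro!: derivative_eq_intros simp: scaleR_conv_of_real mult_ac)
      then have "((\<lambda>y. (f \<xi> * cis (2 * pi * y * \<xi>) - f \<xi> * cis (2 * pi * x * \<xi>)) /\<^sub>R (y - x)) \<longlongrightarrow>
          2 * of_real pi * \<i> * (\<xi> *\<^sub>R f \<xi>) * cis (2 * pi * x * \<xi>)) (at x)"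
        by (simp add: has_vector_derivative_at_iff_tendsto)
      then show "(\<lambda>i. ?s i \<xi>) \<longlonglongrightarrow> 2 * of_real pi * \<i> * (\<xi> *\<^sub>R f \<xi>) * cis (2 * pi * x * \<xi>)"
        unfolding tendsto_at_iff_sequentially using X X' by (auto simp: o_def)
    qed
  qed
  then show "(\<lambda>i. (inv_fourier f (X i) - inv_fourier f x) /\<^sub>R (X i - x)) \<longlonglongrightarrow>
      inv_fourier (\<lambda>\<xi>. 2 * of_real pi * \<i> * (\<xi> *\<^sub>R f \<xi>)) x"
    unfolding eq by (simp only: inv_fourier_cis)
qed

text \<open>Integration by parts: the derivative of \<open>f\<close> times the exponential
  integrates to 0 over the line, as the boundary values vanish by decay.\<close>

lemma inv_fourier_vderiv:
  assumes "f \<in> schwartz"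
  shows "inv_fourier (\<lambda>\<xi>. vector_derivative f (at \<xi>)) x = - (2 * of_real pi * \<i>) * (x *\<^sub>R inv_fourier f x)"
proof -
  let ?f' = "\<lambda>\<xi>. vector_derivative f (at \<xi>)"
  let ?e = "\<lambda>\<xi>. cis (2 * pi * x * \<xi>)"
  let ?c = "2 * of_real pi * \<i> * of_real x :: complex"
  have f': "?f' \<in> schwartz"
    using assms by (rule schwartz_vderiv)
  have D: "(f has_vector_derivative ?f' \<xi>) (at \<xi>)" for \<xi>
    using has_vector_derivative_nth_vderiv[of f 0 \<xi>] assms by (simp add: smooth_schwartz nth_vderiv_Suc)
  have De: "(?e has_vector_derivative ?c * ?e \<xi>) (at \<xi>)" for \<xi>
    unfolding has_vector_derivative_def
    by (auto intro!: derivative_eq_intros simp: scaleR_conv_of_real mult_ac)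
  have int: "integrable lborel (\<lambda>\<xi>. f \<xi> * ?e \<xi>)" "integrable lborel (\<lambda>\<xi>. ?f' \<xi> * ?e \<xi>)"
    by (intro integrable_mult_cis integrable_schwartz assms f')+
  have lim: "((\<lambda>\<xi>. f \<xi> * ?e \<xi>) \<longlongrightarrow> 0) F" if "filterlim (\<lambda>x::real. \<bar>x\<bar>) at_top F" for F
    using tendsto_norm_zero[OF tendsto_schwartz[OF assms that]]
    by (rule Lim_null_comparison[OF always_eventually, rotated]) (simp add: norm_mult)
  have "(LBINT \<xi>=-\<infinity>..\<infinity>. ?c * (f \<xi> * ?e \<xi>) + ?f' \<xi> * ?e \<xi>) = 0 - 0"
  proof (rule interval_integral_FTC_integrable)
    show "((\<lambda>\<xi>. f \<xi> * ?e \<xi>) has_vector_derivative ?c * (f \<xi> * ?e \<xi>) + ?f' \<xi> * ?e \<xi>) (at \<xi>)" for \<xi>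
      by (rule has_vector_derivative_eq_rhs[OF has_vector_derivative_mult[OF D De]]) (simp add: algebra_simps)
    show "isCont (\<lambda>\<xi>. ?c * (f \<xi> * ?e \<xi>) + ?f' \<xi> * ?e \<xi>) \<xi>" for \<xi>
      using smooth_continuous[OF smooth_schwartz[OF assms], of UNIV]
        smooth_continuous[OF smooth_schwartz[OF f'], of UNIV]
      by (intro continuous_intros continuous_on_eq_continuous_at[THEN iffD1, rule_format, of UNIV ?e])
         (auto simp: continuous_on_eq_continuous_at intro!: continuous_intros)
    show "set_integrable lborel (einterval (-\<infinity>) \<infinity>) (\<lambda>\<xi>. ?c * (f \<xi> * ?e \<xi>) + ?f' \<xi> * ?e \<xi>)"
      using int by (simp add: set_integrable_def)
    show "(((\<lambda>\<xi>. f \<xi> * ?e \<xi>) \<circ> real_of_ereal) \<longlongrightarrow> 0) (at_right (-\<infinity>))"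
      unfolding ereal_tendsto_simps by (rule lim[OF filterlim_at_top_mono[OF filterlim_uminus_at_top_at_bot]]) (auto intro!: always_eventually abs_ge_minus_self)
    show "(((\<lambda>\<xi>. f \<xi> * ?e \<xi>) \<circ> real_of_ereal) \<longlongrightarrow> 0) (at_left \<infinity>)"
      unfolding ereal_tendsto_simps by (rule lim) (simp add: filterlim_abs_real)
  qed simp
  then have "(LINT \<xi>|lborel. ?c * (f \<xi> * ?e \<xi>) + ?f' \<xi> * ?e \<xi>) = 0"
    by (simp add: interval_lebesgue_integral_def set_lebesgue_integral_def)
  moreover have "(LINT \<xi>|lborel. ?c * (f \<xi> * ?e \<xi>) + ?f' \<xi> * ?e \<xi>) =
      ?c * inv_fourier f x + inv_fourier ?f' x"
    unfolding inv_fourier_cis integral_mult_right_zero[symmetric]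
    by (intro Bochner_Integration.integral_add integrable_mult_right int)
  ultimately show ?thesis
    by (simp add: add_eq_0_iff scaleR_conv_of_real mult_ac)
qed

lemma inv_fourier_cmult: "inv_fourier (\<lambda>\<xi>. a * f \<xi>) x = a * inv_fourier f x"
  by (simp add: inv_fourier_def mult.assoc)

lemma inv_fourier_schwartz:
  assumes "f \<in> schwartz"
  shows "inv_fourier f \<in> schwartz"
\<comment> \<open>The invariant set is the image of \<open>schwartz\<close> under
  \<open>inv_fourier\<close>: differentiation and multiplication by the variable are exchanged by
  the transform, and each preserves \<open>schwartz\<close>.\<close>
proof (rule schwartz_coinduct)
  show "inv_fourier f \<in> inv_fourier ` schwartz"
    using assms by simp
next
  fix g assume "g \<in> inv_fourier ` schwartz"
  then obtain f where f: "f \<in> schwartz" "g = inv_fourier f"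
    by auto
  show "bounded (range g)"
    using norm_inv_fourier_le f(2) by (auto simp: bounded_iff)
  show "\<exists>g'\<in>inv_fourier ` schwartz. \<forall>x. (g has_vector_derivative g' x) (at x)"
    using f inv_fourier_has_vector_derivative[of f]
    by (auto intro!: bexI imageI schwartz_cmult schwartz_times_x integrable_schwartz)
  have "(\<lambda>x. x *\<^sub>R g x) = inv_fourier (\<lambda>\<xi>. (- 1 / (2 * of_real pi * \<i>)) * vector_derivative f (at \<xi>))"
    unfolding inv_fourier_cmult inv_fourier_vderiv[OF f(1)] f(2) by (simp add: fun_eq_iff)
  then show "(\<lambda>x. x *\<^sub>R g x) \<in> inv_fourier ` schwartz"
    using schwartz_cmult[OF schwartz_vderiv[OF f(1)]] by blast
qed

text \<open>Fubini, the kernel being symmetric in its two variables. This identity is what links the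
  distributional transform to the pointwise one.\<close>

lemma inv_fourier_duality:
  assumes "integrable lborel f" "integrable lborel g"
  shows "(LINT t|lborel. f t * inv_fourier g t) = (LINT x|lborel. inv_fourier f x * g x)"
proof -
  have [measurable]: "f \<in> borel_measurable borel" "g \<in> borel_measurable borel"
    using assms by auto
  have [measurable]: "(\<lambda>p. cis (2 * pi * fst p * snd p)) \<in> borel_measurable (borel :: (real \<times> real) measure)"
    by (intro borel_measurable_continuous_onI continuous_intros)
  have [measurable]: "(\<lambda>p. cis (2 * pi * fst p * snd p)) \<in> borel_measurable (lborel \<Otimes>\<^sub>M lborel)"
    by (simp add: lborel_prod)
  have "integrable (lborel \<Otimes>\<^sub>M lborel) (\<lambda>(t, x). f t * g x * cis (2 * pi * t * x))"
  proof (rule lborel_pair.Fubini_integrable)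
    show "(\<lambda>(t, x). f t * g x * cis (2 * pi * t * x)) \<in> borel_measurable (lborel \<Otimes>\<^sub>M lborel)"
      unfolding split_beta' by measurable
    show "integrable lborel (\<lambda>t. LINT x|lborel. norm (case (t, x) of (t, x) \<Rightarrow> f t * g x * cis (2 * pi * t * x)))"
      using assms by (simp add: norm_mult integrable_norm)
    show "AE t in lborel. integrable lborel (\<lambda>x. case (t, x) of (t, x) \<Rightarrow> f t * g x * cis (2 * pi * t * x))"
      using integrable_mult_cis[OF integrable_mult_right[OF assms(2)]] by simp
  qed
  from lborel_pair.Fubini_integral[OF this]
  show ?thesis
    unfolding inv_fourier_cis integral_mult_right_zero[symmetric] integral_mult_left_zero[symmetric]
    by (simp add: mult_ac)
qed

section \<open>Uniqueness of representatives\<close>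

text \<open>By Weierstrass there is a polynomial \<open>g\<close> within \<open>e\<close> of
  \<open>f\<close> on the support. As \<open>f\<close> is orthogonal to \<open>g\<close>, the
  integral of the square of \<open>f\<close> equals that of \<open>(f - g) * f\<close>, hence is at
  most \<open>e\<close> times the L^1 norm; let \<open>e\<close> tend to 0.\<close>

lemma moments_zero_imp_zero:
  fixes f :: "real \<Rightarrow> real"
  assumes cont: "continuous_on UNIV f" and zero: "\<And>x. \<bar>x\<bar> > M \<Longrightarrow> f x = 0"
    and moments: "\<And>n. (LINT x|lborel. x ^ n * f x) = 0"
  shows "f x = 0"
proof -
  \<comment> \<open>\<open>M\<close> may be negative; a nondegenerate interval is required to pass
    from a zero integral to zero values.\<close>
  define K where "K = max M 1"
  have K: "K > 0" "\<And>x. \<bar>x\<bar> > K \<Longrightarrow> f x = 0"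
    using zero by (auto simp: K_def)
  have int: "integrable lborel (\<lambda>x. g x * f x)" if g: "continuous_on UNIV g" for g :: "real \<Rightarrow> real"
  proof -
    have "set_integrable lborel {-K..K} (\<lambda>x. g x * f x)"
      by (intro borel_integrable_atLeastAtMost' continuous_intros continuous_on_subset[OF g]
          continuous_on_subset[OF cont]) auto
    then show ?thesis
      unfolding set_integrable_def
      by (rule Bochner_Integration.integrable_cong[THEN iffD1, rotated 2])
         (use K(2) in \<open>force simp: indicator_def\<close>)+
  qed
  have le: "(LINT x|lborel. f x * f x) \<le> e * (LINT x|lborel. \<bar>f x\<bar>)" if e: "e > 0" for e
  proof -
    have "continuous_on {-K..K} f"
      using cont continuous_on_subset by blast
    then obtain g where g: "real_polynomial_function g" "\<And>x. x \<in> {-K..K} \<Longrightarrow> \<bar>f x - g x\<bar> < e"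
      using Stone_Weierstrass_real_polynomial_function[OF compact_Icc _ e] by metis
    then obtain a n where a: "g = (\<lambda>x. \<Sum>i\<le>n. a i * x ^ i)"
      by (auto simp: real_polynomial_function_iff_sum)
    have intx: "integrable lborel (\<lambda>x. x ^ i * f x)" for i
      by (intro int continuous_intros)
    have "(LINT x|lborel. g x * f x) = (LINT x|lborel. (\<Sum>i\<le>n. a i * (x ^ i * f x)))"
      unfolding a by (simp add: sum_distrib_right mult.assoc)
    also have "\<dots> = (\<Sum>i\<le>n. a i * (LINT x|lborel. x ^ i * f x))"
      using intx by (subst Bochner_Integration.integral_sum) auto
    finally have gf: "(LINT x|lborel. g x * f x) = 0"
      by (simp add: moments)
    have intg: "integrable lborel (\<lambda>x. g x * f x)"
      unfolding a by (intro int continuous_intros)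
    have intf: "integrable lborel (\<lambda>x. f x * f x)" "integrable lborel (\<lambda>x. \<bar>f x\<bar>)"
      using int[OF cont] int[of "\<lambda>_. 1"] by (auto intro: integrable_abs)
    have "(LINT x|lborel. f x * f x) = (LINT x|lborel. f x * f x - g x * f x)"
      using intg intf gf by (subst Bochner_Integration.integral_diff) auto
    also have "\<dots> \<le> (LINT x|lborel. e * \<bar>f x\<bar>)"
    proof (rule integral_mono)
      fix x
      show "f x * f x - g x * f x \<le> e * \<bar>f x\<bar>"
      proof (cases "\<bar>x\<bar> > K")
        case False
        have "(f x - g x) * f x \<le> \<bar>f x - g x\<bar> * \<bar>f x\<bar>"
          by (metis abs_ge_self abs_mult)
        also have "\<dots> \<le> e * \<bar>f x\<bar>"
          using False by (intro mult_right_mono less_imp_le[OF g(2)]) (auto simp: abs_le_iff)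
        finally show ?thesis
          by (simp add: algebra_simps)
      qed (use K in simp)
    qed (use intg intf in auto)
    finally show ?thesis
      by simp
  qed
  have sq: "integrable lborel (\<lambda>x. f x * f x)"
    by (rule int[OF cont])
  have "(LINT x|lborel. f x * f x) \<le> 0"
  proof (rule field_le_epsilon)
    fix e :: real assume "e > 0"
    define I where "I = (LINT x|lborel. \<bar>f x\<bar>)"
    have "I \<ge> 0"
      by (simp add: I_def)
    have "0 < e / (I + 1)"
      using \<open>e > 0\<close> \<open>I \<ge> 0\<close> by simp
    from le[OF this] have "(LINT x|lborel. f x * f x) \<le> e / (I + 1) * I"
      by (simp add: I_def)
    also have "\<dots> \<le> e"
      using \<open>e > 0\<close> \<open>I \<ge> 0\<close> by (simp add: field_simps)
    finally show "(LINT x|lborel. f x * f x) \<le> 0 + e"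
      by simp
  qed
  moreover have "(LINT x|lborel. f x * f x) \<ge> 0"
    by (intro integral_nonneg_AE AE_I2) auto
  moreover have "(LINT x|lborel. f x * f x) = integral {-K..K} (\<lambda>x. f x * f x)"
  proof -
    have "set_integrable lborel {-K..K} (\<lambda>x. f x * f x)"
      unfolding set_integrable_def by (rule integrable_mult_indicator[OF _ sq]) simp
    then have "(LINT x:{-K..K}|lborel. f x * f x) = integral {-K..K} (\<lambda>x. f x * f x)"
      by (rule set_borel_integral_eq_integral)
    moreover have "(LINT x:{-K..K}|lborel. f x * f x) = (LINT x|lborel. f x * f x)"
      unfolding set_lebesgue_integral_def
      by (rule Bochner_Integration.integral_cong) (use K(2) in \<open>force simp: indicator_def\<close>)+
    ultimately show ?thesis
      by simp
  qed
  ultimately have "integral {-K..K} (\<lambda>x. f x * f x) = 0"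
    by simp
  then have "\<forall>x\<in>{-K..K}. f x * f x = 0"
    using K(1) by (subst (asm) integral_eq_0_iff)
      (auto intro!: continuous_intros continuous_on_subset[OF cont])
  then show ?thesis
    using K(2)[of x] by (cases "\<bar>x\<bar> > K") (auto simp: abs_le_iff not_less)
qed

lemma schwartz_times_power:
  assumes "f \<in> schwartz"
  shows "(\<lambda>x. x ^ n *\<^sub>R f x) \<in> schwartz"
proof (induction n)
  case (Suc n)
  from schwartz_times_x[OF this] show ?case
    by simp
qed (use assms in simp)

lemma nonzero_moment:
  assumes f: "f \<in> test_functions V" "f \<noteq> (\<lambda>_. 0)"
  obtains n where "(LINT x|lborel. x ^ n *\<^sub>R f x) \<noteq> 0"
proof -
  obtain M where M: "\<And>x. \<bar>x\<bar> > M \<Longrightarrow> f x = 0"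
    using test_functions_bounded_support[OF f(1)] by auto
  have S: "f \<in> schwartz"
    using f(1) by (rule test_functions_schwartz)
  have cont: "continuous_on UNIV f"
    using S by (intro smooth_continuous smooth_schwartz)
  have False if zero: "\<And>n. (LINT x|lborel. x ^ n *\<^sub>R f x) = 0"
  proof -
    have int: "integrable lborel (\<lambda>x. x ^ n *\<^sub>R f x)" for n
      by (intro integrable_schwartz schwartz_times_power S)
    have Re: "(LINT x|lborel. x ^ n * Re (f x)) = 0" and Im: "(LINT x|lborel. x ^ n * Im (f x)) = 0" for n
      using zero[of n] integral_Re[OF int[of n]] integral_Im[OF int[of n]] by auto
    have "Re (f x) = 0" for x
      by (rule moments_zero_imp_zero[where M = M, OF continuous_on_Re[OF cont] _ Re]) (simp add: M)
    moreover have "Im (f x) = 0" for x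
      by (rule moments_zero_imp_zero[where M = M, OF continuous_on_Im[OF cont] _ Im]) (simp add: M)
    ultimately have "f = (\<lambda>_. 0)"
      by (simp add: fun_eq_iff complex_eq_iff)
    with f(2) show False
      by simp
  qed
  then show ?thesis
    using that by blast
qed

text \<open>An antiderivative of a compactly supported function is constant near both ends, and the
  constants differ if the integral is nonzero. The integral of \<open>f\<close> may be 0, so a power
  with nonvanishing moment is multiplied in first; rescaling then gives the values 0 and 1 and the
  transition interval from -1 to 1.\<close>

lemma smooth_step:
  assumes f: "f \<in> test_functions V" "f \<noteq> (\<lambda>_. 0)"
  obtains X where "smooth X" "\<And>x. x \<le> -1 \<Longrightarrow> X x = 0" "\<And>x. x \<ge> 1 \<Longrightarrow> X x = 1"
proof -
  obtain n where n: "(LINT x|lborel. x ^ n *\<^sub>R f x) \<noteq> 0"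
    using nonzero_moment[OF f] .
  define g where "g = (\<lambda>x. x ^ n *\<^sub>R f x)"
  obtain M0 where "\<And>x. \<bar>x\<bar> > M0 \<Longrightarrow> f x = 0"
    using test_functions_bounded_support[OF f(1)] by auto
  \<comment> \<open>The extra 1 makes \<open>g\<close> vanish at the points \<open>M\<close> and
    \<open>-M\<close> themselves, so the derivative of \<open>F\<close> is 0 on closed
    half-lines.\<close>
  define M where "M = max M0 0 + 1"
  have M: "M > 0" "\<And>x. \<bar>x\<bar> \<ge> M \<Longrightarrow> g x = 0"
    using \<open>\<And>x. \<bar>x\<bar> > M0 \<Longrightarrow> f x = 0\<close> by (auto simp: M_def g_def)
  have g: "g \<in> schwartz"
    unfolding g_def by (intro schwartz_times_power test_functions_schwartz[OF f(1)])
  have cont: "continuous_on S g" for S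
    by (intro smooth_continuous smooth_schwartz g)
  have "isCont g x" for x
    using cont[of UNIV] by (simp add: continuous_on_eq_continuous_at)
  then obtain F where F: "\<And>x. (F has_vector_derivative g x) (at x)"
    using einterval_antiderivative[of "-\<infinity>" \<infinity> g] by auto
  have left: "F x = F (-M)" if "x \<le> -M" for x
  proof -
    have der: "(F has_vector_derivative 0) (at x within {..-M})" if "x \<in> {..-M}" for x
      using has_vector_derivative_at_within[OF F, of x "{..-M}"] M that by simp
    obtain c where c: "\<And>x. x \<in> {..-M} \<Longrightarrow> F x = c"
      by (rule has_vector_derivative_zero_constant[OF _ der]) (auto intro: convex_real_interval)
    show ?thesis
      using c[of x] c[of "-M"] that by simp
  qed
  have right: "F x = F M" if "x \<ge> M" for x
  proof -
    have der: "(F has_vector_derivative 0) (at x within {M..})" if "x \<in> {M..}" for x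
      using has_vector_derivative_at_within[OF F, of x "{M..}"] M that by simp
    obtain c where c: "\<And>x. x \<in> {M..} \<Longrightarrow> F x = c"
      by (rule has_vector_derivative_zero_constant[OF _ der]) (auto intro: convex_real_interval)
    show ?thesis
      using c[of x] c[of "M"] that by simp
  qed
  have "(g has_integral (F M - F (-M))) {-M..M}"
    using M by (intro fundamental_theorem_of_calculus has_vector_derivative_at_within[OF F]) simp
  then have "F M - F (-M) = integral {-M..M} g"
    by (simp add: integral_unique)
  also have "\<dots> = (LINT x:{-M..M}|lborel. g x)"
    by (intro set_borel_integral_eq_integral(2)[symmetric] borel_integrable_atLeastAtMost' cont)
  also have "\<dots> = (LINT x|lborel. g x)"
    unfolding set_lebesgue_integral_def
  proof (rule Bochner_Integration.integral_cong)
    show "indicat_real {-M..M} x *\<^sub>R g x = g x" for x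
      using M(2)[of x] by (cases "x \<in> {-M..M}") auto
  qed simp
  finally have D: "F M - F (-M) \<noteq> 0"
    using n by (simp add: g_def)
  define X where "X = (\<lambda>x. (1 / (F M - F (-M))) * (F (M * x + 0) + - F (-M) * 1))"
  have "smooth F"
    by (rule smooth_antiderivative[OF smooth_schwartz[OF g] F])
  moreover have "smooth (\<lambda>_. c)" for c
  proof -
    have "nth_vderiv n (\<lambda>_. c) = (if n = 0 then (\<lambda>_. c) else (\<lambda>_. 0))" for n
      by (induction n) (auto simp: nth_vderiv_Suc)
    then show ?thesis
      by (simp add: smooth_def)
  qed
  ultimately have "smooth X"
    unfolding X_def by (intro smooth_cmult[where a = "1 / (F M - F (-M))"] smooth_add
        smooth_affine[where f = F]) auto
  moreover have "X x = 0" if "x \<le> -1" for x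
    using left[of "M * x"] mult_left_mono[OF that, of M] M(1) by (simp add: X_def)
  moreover have "X x = 1" if "x \<ge> 1" for x
    using right[of "M * x"] mult_left_mono[OF that, of M] M(1) D by (simp add: X_def)
  ultimately show ?thesis
    using that by blast
qed

text \<open>On each window from \<open>-K\<close> to \<open>K\<close> the integral over a Borel set
  is a complex measure that vanishes on intervals, hence on all Borel sets, so its density is 0
  almost everywhere. Countably many windows exhaust the line.\<close>

lemma AE_zero_if_interval_integrals_zero:
  fixes G :: "real \<Rightarrow> complex"
  assumes int: "\<And>K. integrable lborel (\<lambda>x. indicator {-K..K} x *\<^sub>R G x)"
    and zero: "\<And>a b. a \<le> b \<Longrightarrow> (LINT x|lborel. indicator {a..b} x *\<^sub>R G x) = 0"
  shows "AE x in lborel. G x = 0"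
proof -
  have "AE x in lborel. indicator {-real K..real K} x *\<^sub>R G x = 0" for K :: nat
  proof (rule sigma_finite_measure.density_zero[OF sigma_finite_lborel])
    let ?f = "\<lambda>x. indicator {-real K..real K} x *\<^sub>R G x"
    \<comment> \<open>The case \<open>b < a\<close> is included because intersecting an interval
      with the window may leave nothing.\<close>
    have zero': "(LINT x|lborel. indicator {a..b} x *\<^sub>R G x) = 0" for a b
      using zero[of a b] by (cases "a \<le> b") auto
    have total: "(LINT x|lborel. ?f x) = 0"
      by (rule zero') 
    have set_int: "set_integrable lborel A ?f" if "A \<in> sets borel" for A
      unfolding set_integrable_def by (rule integrable_mult_indicator[OF _ int]) (use that in simp)
    fix A :: "real set" assume "A \<in> sets lborel"
    then have "A \<in> sets borel"
      by simp
    then show "set_lebesgue_integral lborel A ?f = 0"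
    proof (induction rule: borel_set_induct)
      case empty
      show ?case by (simp add: set_lebesgue_integral_def)
    next
      case (interval a b)
      have "indicator {a..b} x *\<^sub>R ?f x = indicator {max a (-real K)..min b (real K)} x *\<^sub>R G x" for x
        by (auto simp: indicator_def)
      then show ?case
        unfolding set_lebesgue_integral_def by (simp only: zero')
    next
      case (compl A)
      have "(LINT x|lborel. ?f x) = (LINT x:A|lborel. ?f x) + (LINT x:-A|lborel. ?f x)"
        using set_integral_Un[of A "-A" lborel ?f] set_int compl
        by (simp add: set_lebesgue_integral_def)
      with compl total show ?case
        by simp
    next
      case (union A)
      have "(LINT x:(\<Union>i. A i)|lborel. ?f x) = (\<Sum>i. LINT x:A i|lborel. ?f x)"
        using union by (intro lebesgue_integral_countable_add set_int) (auto simp: disjoint_family_on_def)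
      with union show ?case
        by simp
    qed
  qed (rule int)
  then have "AE x in lborel. \<forall>K::nat. indicator {-real K..real K} x *\<^sub>R G x = 0"
    unfolding AE_all_countable by blast
  then show ?thesis
  proof eventually_elim
    case (elim x)
    obtain K :: nat where "\<bar>x\<bar> \<le> real K"
      using real_arch_simple by blast
    with elim[rule_format, of K] show ?case
      by (auto simp: indicator_def split: if_splits)
  qed
qed

text \<open>The difference of two ever steeper smooth steps, at \<open>a\<close> and at
  \<open>b\<close>, converges to the indicator of the interval, so interval integrals of
  \<open>G\<close> are limits of pairings with Schwartz functions. The test function
  \<open>f\<close> only serves to produce the step.\<close>

lemma AE_zero_if_orthogonal_to_schwartz:
  fixes G :: "real \<Rightarrow> complex"
  assumes f: "f \<in> test_functions V" "f \<noteq> (\<lambda>_. 0)"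
    and G[measurable]: "G \<in> borel_measurable borel"
    and int: "\<And>K. integrable lborel (\<lambda>x. indicator {-K..K} x *\<^sub>R G x)"
    and zero: "\<And>\<phi>. \<phi> \<in> schwartz \<Longrightarrow> (LINT x|lborel. G x * \<phi> x) = 0"
  shows "AE x in lborel. G x = 0"
proof (rule AE_zero_if_interval_integrals_zero[OF int])
  fix a b :: real assume ab: "a \<le> b"
  obtain X where X: "smooth X" "\<And>x. x \<le> -1 \<Longrightarrow> X x = 0" "\<And>x. x \<ge> 1 \<Longrightarrow> X x = 1"
    using smooth_step[OF f] by metis
  have "compact (X ` {-1..1})"
    by (intro compact_continuous_image smooth_continuous X) simp
  then have "bounded (X ` {-1..1})"
    by (rule compact_imp_bounded)
  then obtain B0 where "\<forall>y\<in>X ` {-1..1}. norm y \<le> B0"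
    unfolding bounded_iff by blast
  then have B0: "norm (X x) \<le> B0" if "x \<in> {-1..1}" for x
    using that by blast
  define B where "B = max B0 1"
  have B: "norm (X x) \<le> B" for x
    using B0[of x] X(2,3)[of x] by (cases "x \<le> -1"; cases "x \<ge> 1") (auto simp: B_def)
  define \<Phi> where "\<Phi> n x = X (real (Suc n) * x + (- real (Suc n) * a)) +
      (-1) * X (real (Suc n) * x + (- real (Suc n) * b))" for n x
  \<comment> \<open>The steepness is at least 1, so each transition stays within distance 1 of
    \<open>a\<close> or \<open>b\<close>; this window contains all the supports.\<close>
  define K where "K = \<bar>a\<bar> + \<bar>b\<bar> + 1"
  have \<Phi>_eq: "\<Phi> n x = X (real (Suc n) * (x - a)) - X (real (Suc n) * (x - b))" for n x
    by (simp add: \<Phi>_def algebra_simps)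
  have \<Phi>_zero: "\<Phi> n x = 0" if "\<bar>x\<bar> > K" for n x
  proof (cases "x > 0")
    case True
    then have "1 \<le> x - a" "1 \<le> x - b"
      using that by (auto simp: K_def)
    then have "1 \<le> real (Suc n) * (x - a)" "1 \<le> real (Suc n) * (x - b)"
      using mult_mono[of 1 "real (Suc n)" 1] by fastforce+
    then show ?thesis
      by (simp add: \<Phi>_eq X)
  next
    case False
    then have "1 \<le> a - x" "1 \<le> b - x"
      using that by (auto simp: K_def)
    then have "1 \<le> real (Suc n) * (a - x)" "1 \<le> real (Suc n) * (b - x)"
      using mult_mono[of 1 "real (Suc n)" 1] by fastforce+
    then have "real (Suc n) * (x - a) \<le> -1" "real (Suc n) * (x - b) \<le> -1"
      by (simp_all add: algebra_simps)
    then show ?thesis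
      by (simp add: \<Phi>_eq X)
  qed
  have smooth: "smooth (\<Phi> n)" for n
    unfolding \<Phi>_def by (intro smooth_add smooth_cmult smooth_affine X)
  then have \<Phi>: "\<Phi> n \<in> schwartz" for n
    using \<Phi>_zero by (rule smooth_bounded_support_schwartz)
  have "(\<lambda>n. LINT x|lborel. G x * \<Phi> n x) \<longlonglongrightarrow> (LINT x|lborel. indicator {a..b} x *\<^sub>R G x)"
  proof (rule integral_dominated_convergence)
    show "integrable lborel (\<lambda>x. 2 * B * norm (indicator {-K..K} x *\<^sub>R G x))"
      by (intro integrable_mult_right integrable_norm int)
    show "(\<lambda>x. indicator {a..b} x *\<^sub>R G x) \<in> borel_measurable lborel"
      by measurable
    show "(\<lambda>x. G x * \<Phi> n x) \<in> borel_measurable lborel" for n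
      using borel_measurable_schwartz[OF \<Phi>] by measurable
    show "AE x in lborel. norm (G x * \<Phi> n x) \<le> 2 * B * norm (indicator {-K..K} x *\<^sub>R G x)" for n
    proof (rule AE_I2)
      fix x
      have "norm (\<Phi> n x) \<le> 2 * B"
        unfolding \<Phi>_eq by (rule order_trans[OF norm_triangle_ineq4]) (use B in \<open>smt (verit)\<close>)
      then show "norm (G x * \<Phi> n x) \<le> 2 * B * norm (indicator {-K..K} x *\<^sub>R G x)"
        using \<Phi>_zero[of x n] mult_right_mono[of "norm (\<Phi> n x)" "2 * B" "norm (G x)"]
        by (cases "\<bar>x\<bar> > K") (auto simp: norm_mult indicator_def mult_ac)
    qed
    have large: "\<forall>\<^sub>F n in sequentially. 1 \<le> real (Suc n) * d" if "d > 0" for d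
    proof -
      obtain N where N: "1 / d < real N"
        using reals_Archimedean2 by blast
      have "1 \<le> real (Suc n) * d" if "n \<ge> N" for n
      proof -
        have "1 / d \<le> real (Suc n)"
          using N that by simp
        with \<open>d > 0\<close> show ?thesis
          by (simp only: pos_divide_le_eq)
      qed
      then show ?thesis
        using eventually_sequentially by blast
    qed
    show "AE x in lborel. (\<lambda>n. G x * \<Phi> n x) \<longlonglongrightarrow> indicator {a..b} x *\<^sub>R G x"
      \<comment> \<open>At \<open>a\<close> and \<open>b\<close> themselves a step is evaluated at
        0, where its value is unknown.\<close>
      using AE_lborel_singleton[of a] AE_lborel_singleton[of b]
    proof eventually_elim
      case (elim x)
      have lim: "\<forall>\<^sub>F n in sequentially. X (real (Suc n) * (x - c)) = indicator {c..} x" if "x \<noteq> c" for c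
      proof (cases "x > c")
        case True
        then show ?thesis
          using large[of "x - c"] by (auto elim!: eventually_mono simp: X(3))
      next
        case False
        then have "\<forall>\<^sub>F n in sequentially. 1 \<le> real (Suc n) * (c - x)"
          using large[of "c - x"] that by auto
        then show ?thesis
        proof eventually_elim
          case (elim n)
          then have "real (Suc n) * (x - c) \<le> -1"
            by (simp add: algebra_simps)
          with False that show ?case
            by (simp add: X(2))
        qed
      qed
      have "\<forall>\<^sub>F n in sequentially. G x * \<Phi> n x = indicator {a..b} x *\<^sub>R G x"
        using lim[OF elim(1)] lim[OF elim(2)]
        by eventually_elim (use elim ab in \<open>auto simp: \<Phi>_eq indicator_def\<close>)
      then show ?case
        by (rule tendsto_eventually)
    qed
  qed
  then show "(LINT x|lborel. indicator {a..b} x *\<^sub>R G x) = 0"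
    using zero[OF \<Phi>] by (simp add: LIMSEQ_const_iff)
qed

section \<open>Representatives of distributions in \<open>FL p\<close>\<close>

text \<open>Stands in for Hoelder's inequality: a function in L^p is dominated by 1 plus an
  integrable function, enough to pair it with bounded integrable functions.\<close>

lemma powr_le_one_plus: "y \<le> 1 + y powr p" if "y \<ge> 0" "p \<ge> 1" for y p :: real
proof (cases "y \<le> 1")
  case False
  then have "y powr 1 \<le> y powr p"
    using that by (intro powr_mono) auto
  with False show ?thesis
    by simp
qed (use that in \<open>simp add: add_increasing2\<close>)

text \<open>Stands in for Minkowski's inequality. The lost factor is harmless, since only orders of
  growth are compared later.\<close>

lemma powr_add_le:
  fixes x y p :: real
  assumes "x \<ge> 0" "y \<ge> 0" "p \<ge> 0"
  shows "(x + y) powr p \<le> 2 powr p * (x powr p + y powr p)"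
proof -
  have "(x + y) powr p \<le> (2 * max x y) powr p"
    using assms by (intro powr_mono2) auto
  also have "\<dots> = 2 powr p * max x y powr p"
    using assms by (intro powr_mult) 
  also have "\<dots> \<le> 2 powr p * (x powr p + y powr p)"
    by (intro mult_left_mono) (auto simp: max_def)
  finally show ?thesis .
qed

lemma Lp_space_measurable: "g \<in> Lp_space p \<Longrightarrow> g \<in> borel_measurable borel"
  by (simp add: Lp_space_def)

lemma Lp_space_integrable: "g \<in> Lp_space p \<Longrightarrow> integrable lborel (\<lambda>x. norm (g x) powr p)"
  by (simp add: Lp_space_def)

lemma Lp_space_diff:
  assumes "f \<in> Lp_space p" "g \<in> Lp_space p" "p \<ge> 0"
  shows "(\<lambda>x. f x - g x) \<in> Lp_space p"
proof -
  have [measurable]: "f \<in> borel_measurable borel" "g \<in> borel_measurable borel"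
    using assms by (auto dest: Lp_space_measurable)
  have "integrable lborel (\<lambda>x. norm (f x - g x) powr p)"
  proof (rule Bochner_Integration.integrable_bound)
    show "integrable lborel (\<lambda>x. 2 powr p * (norm (f x) powr p + norm (g x) powr p))"
      using assms by (intro integrable_mult_right Bochner_Integration.integrable_add Lp_space_integrable)
    have "norm (f x - g x) powr p \<le> (norm (f x) + norm (g x)) powr p" for x
      using assms by (intro powr_mono2 norm_triangle_ineq4) auto
    also have "(norm (f x) + norm (g x)) powr p \<le> 2 powr p * (norm (f x) powr p + norm (g x) powr p)" for x
      using assms by (intro powr_add_le) auto
    finally show "AE x in lborel. norm (norm (f x - g x) powr p) \<le>
        norm (2 powr p * (norm (f x) powr p + norm (g x) powr p))"
      by (simp add: abs_mult)
  qed simp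
  then show ?thesis
    by (simp add: Lp_space_def)
qed

lemma integral_powr_diff_le:
  assumes "f \<in> Lp_space p" "g \<in> Lp_space p" "p \<ge> 0"
  shows "(LINT x|lborel. norm (f x - g x) powr p) \<le>
    2 powr p * ((LINT x|lborel. norm (f x) powr p) + (LINT x|lborel. norm (g x) powr p))"
proof -
  have "(LINT x|lborel. norm (f x - g x) powr p) \<le>
      (LINT x|lborel. 2 powr p * (norm (f x) powr p + norm (g x) powr p))"
  proof (rule integral_mono)
    show "integrable lborel (\<lambda>x. norm (f x - g x) powr p)"
      using Lp_space_diff[OF assms] by (rule Lp_space_integrable)
    show "integrable lborel (\<lambda>x. 2 powr p * (norm (f x) powr p + norm (g x) powr p))"
      using assms by (intro integrable_mult_right Bochner_Integration.integrable_add Lp_space_integrable)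
    fix x
    have "norm (f x - g x) powr p \<le> (norm (f x) + norm (g x)) powr p"
      using assms by (intro powr_mono2 norm_triangle_ineq4) auto
    also have "\<dots> \<le> 2 powr p * (norm (f x) powr p + norm (g x) powr p)"
      using assms by (intro powr_add_le) auto
    finally show "norm (f x - g x) powr p \<le> 2 powr p * (norm (f x) powr p + norm (g x) powr p)" .
  qed
  also have "\<dots> = 2 powr p * ((LINT x|lborel. norm (f x) powr p) + (LINT x|lborel. norm (g x) powr p))"
    using assms by (simp add: Lp_space_integrable)
  finally show ?thesis .
qed

lemma integrable_Lp_mult_bounded:
  assumes g: "g \<in> Lp_space p" and p: "p \<ge> 1"
    and \<phi>: "integrable lborel \<phi>" "\<And>x. norm (\<phi> x) \<le> B"
  shows "integrable lborel (\<lambda>x. g x * \<phi> x :: complex)"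
proof (rule Bochner_Integration.integrable_bound)
  show "integrable lborel (\<lambda>x. norm (\<phi> x) + B * norm (g x) powr p)"
    using g \<phi> by (intro Bochner_Integration.integrable_add integrable_mult_right integrable_norm
        Lp_space_integrable)
  show "(\<lambda>x. g x * \<phi> x) \<in> borel_measurable lborel"
    using Lp_space_measurable[OF g] \<phi>(1) by simp
  have "norm (g x * \<phi> x) \<le> norm (norm (\<phi> x) + B * norm (g x) powr p)" for x
  proof -
    have "norm (g x * \<phi> x) \<le> (1 + norm (g x) powr p) * norm (\<phi> x)"
      unfolding norm_mult using p by (intro mult_right_mono powr_le_one_plus) auto
    also have "\<dots> \<le> norm (\<phi> x) + B * norm (g x) powr p"
      using mult_right_mono[OF \<phi>(2)[of x], of "norm (g x) powr p"] by (simp add: algebra_simps)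
    also have "\<dots> \<le> norm (norm (\<phi> x) + B * norm (g x) powr p)"
      by simp
    finally show ?thesis .
  qed
  then show "AE x in lborel. norm (g x * \<phi> x) \<le> norm (norm (\<phi> x) + B * norm (g x) powr p)"
    by simp
qed

lemma integrable_Lp_mult_schwartz:
  assumes "g \<in> Lp_space p" "p \<ge> 1" "\<phi> \<in> schwartz"
  shows "integrable lborel (\<lambda>x. g x * \<phi> x)"
  using bounded_schwartz[OF assms(3)] integrable_Lp_mult_bounded[OF assms(1,2) integrable_schwartz[OF assms(3)]]
  by blast

lemma Lp_norm_cong_AE:
  assumes "f \<in> Lp_space p" "g \<in> Lp_space p" "AE x in lborel. f x = g x"
  shows "Lp_norm p f = Lp_norm p g"
proof -
  have [measurable]: "f \<in> borel_measurable borel" "g \<in> borel_measurable borel"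
    using assms by (auto dest: Lp_space_measurable)
  have "(LINT x|lborel. norm (f x) powr p) = (LINT x|lborel. norm (g x) powr p)"
    using assms(3) by (intro integral_cong_AE) auto
  then show ?thesis
    by (simp add: Lp_norm_def)
qed

text \<open>Intended for the full series: its coefficients will be bounded and its terms have
  disjoint supports, so it is a bounded function.\<close>

lemma distr_of_tempered:
  assumes G[measurable]: "G \<in> borel_measurable borel" and B: "\<And>x. norm (G x) \<le> B"
  shows "distr_of G \<in> tempered"
proof -
  have int: "integrable lborel (\<lambda>x. G x * \<phi> x)" if \<phi>: "\<phi> \<in> schwartz" for \<phi>
  proof (rule Bochner_Integration.integrable_bound)
    show "integrable lborel (\<lambda>x. B * norm (\<phi> x))"
      using \<phi> by (intro integrable_mult_right integrable_norm integrable_schwartz)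
    show "AE x in lborel. norm (G x * \<phi> x) \<le> norm (B * norm (\<phi> x))"
      using B order_trans[OF norm_ge_zero B] by (simp add: norm_mult mult_right_mono)
  qed (use borel_measurable_schwartz[OF \<phi>] in measurable)
  have "B \<ge> 0"
    using order_trans[OF norm_ge_zero B] .
  define J where "J = (LINT x::real|lborel. inverse (1 + x\<^sup>2))"
  have "J \<ge> 0"
    by (simp add: J_def add_nonneg_nonneg)
  have bound: "norm (distr_of G \<phi>) \<le> B * J * (\<Sum>j\<le>2. \<Sum>n\<le>2. schwartz_seminorm j n \<phi>)"
    if \<phi>: "\<phi> \<in> schwartz" for \<phi>
  proof -
    let ?s = "schwartz_seminorm 0 0 \<phi> + schwartz_seminorm 2 0 \<phi>"
    have "norm (LINT x|lborel. G x * \<phi> x) \<le> (LINT x|lborel. norm (G x * \<phi> x))"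
      by (rule integral_norm_bound)
    also have "\<dots> \<le> (LINT x|lborel. B * (?s * inverse (1 + x\<^sup>2)))"
    proof (rule integral_mono)
      show "norm (G x * \<phi> x) \<le> B * (?s * inverse (1 + x\<^sup>2))" for x
        unfolding norm_mult by (intro mult_mono B schwartz_decay \<phi> norm_ge_zero \<open>B \<ge> 0\<close>)
    qed (use int[OF \<phi>] integrable_inverse_1_plus_square_lborel in auto)
    also have "\<dots> = B * J * ?s"
      by (simp add: J_def mult_ac)
    also have "?s \<le> (\<Sum>j\<le>2. \<Sum>n\<le>2. schwartz_seminorm j n \<phi>)"
      using schwartz_seminorm_nonneg[OF \<phi>] by (simp add: numeral_2_eq_2 add_increasing2)
    finally show ?thesis
      using \<phi> \<open>B \<ge> 0\<close> \<open>J \<ge> 0\<close> by (simp add: distr_of_def mult_left_mono)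
  qed
  show ?thesis
    unfolding tempered_def
  proof (intro CollectI conjI allI ballI impI)
    show "distr_of G \<phi> = 0" if "\<phi> \<notin> schwartz" for \<phi>
      using that by (simp add: distr_of_def)
    show "distr_of G (\<lambda>x. \<phi> x + \<psi> x) = distr_of G \<phi> + distr_of G \<psi>"
      if "\<phi> \<in> schwartz" "\<psi> \<in> schwartz" for \<phi> \<psi>
      using that schwartz_add[OF that] int by (simp add: distr_of_def distrib_left)
    show "distr_of G (\<lambda>x. a * \<phi> x) = a * distr_of G \<phi>" if "\<phi> \<in> schwartz" for a \<phi>
      using that schwartz_cmult[OF that, of a] by (simp add: distr_of_def mult.left_commute)
    show "\<exists>C N. \<forall>\<phi>\<in>schwartz. norm (distr_of G \<phi>) \<le> C * (\<Sum>j\<le>N. \<Sum>n\<le>N. schwartz_seminorm j n \<phi>)"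
      using bound by blast
  qed
qed

lemma inv_fourier_distr_distr_of:
  assumes "integrable lborel G"
  shows "inv_fourier_distr (distr_of G) = distr_of (inv_fourier G)"
  using inv_fourier_duality[OF assms integrable_schwartz]
  by (auto simp: fun_eq_iff inv_fourier_distr_def distr_of_def inv_fourier_schwartz)

lemma distr_of_diff:
  assumes "f \<in> Lp_space p" "g \<in> Lp_space p" "p \<ge> 1"
  shows "distr_of (\<lambda>x. f x - g x) = (\<lambda>\<phi>. distr_of f \<phi> - distr_of g \<phi>)"
  using integrable_Lp_mult_schwartz[OF assms(1,3)] integrable_Lp_mult_schwartz[OF assms(2,3)]
  by (auto simp: fun_eq_iff distr_of_def left_diff_distrib)

section \<open>Trigonometric polynomials against a decaying weight\<close>

definition trig_poly :: "(int \<Rightarrow> complex) \<Rightarrow> int set \<Rightarrow> real \<Rightarrow> complex" where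
  "trig_poly c A x = (\<Sum>k\<in>A. c k * cis (2 * pi * of_int k * x))"

lemma continuous_on_trig_poly [continuous_intros]: "continuous_on S (trig_poly c A)"
  unfolding trig_poly_def by (intro continuous_intros)

lemma borel_measurable_trig_poly [measurable]: "trig_poly c A \<in> borel_measurable borel"
  by (intro borel_measurable_continuous_onI continuous_intros)

lemma norm_trig_poly_le: "norm (trig_poly c A x) \<le> (\<Sum>k\<in>A. norm (c k))"
  unfolding trig_poly_def by (rule order_trans[OF norm_sum]) (simp add: norm_mult)

lemma trig_poly_Un:
  "finite A \<Longrightarrow> finite B \<Longrightarrow> A \<inter> B = {} \<Longrightarrow> trig_poly c (A \<union> B) x = trig_poly c A x + trig_poly c B x"
  by (simp add: trig_poly_def sum.union_disjoint)

lemma trig_poly_times_Lp: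
  assumes p: "p \<ge> 1" and [measurable]: "w \<in> borel_measurable borel"
    and w: "\<And>x. norm (w x) \<le> C * inverse (1 + x\<^sup>2)"
  shows "(\<lambda>x. trig_poly c A x * w x) \<in> Lp_space p"
proof -
  have "C \<ge> 0"
    using order_trans[OF norm_ge_zero w[of 0]] by simp
  define D where "D = (\<Sum>k\<in>A. norm (c k)) * C"
  have bound: "norm (trig_poly c A x * w x) \<le> D * inverse (1 + x\<^sup>2)" for x
    unfolding norm_mult D_def mult.assoc
    by (intro mult_mono norm_trig_poly_le w sum_nonneg) auto
  have "D \<ge> 0"
    unfolding D_def using \<open>C \<ge> 0\<close> by (intro mult_nonneg_nonneg sum_nonneg) auto
  have "integrable lborel (\<lambda>x. norm (trig_poly c A x * w x) powr p)"
  proof (rule integrable_decay)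
    show "norm (norm (trig_poly c A x * w x) powr p) \<le> D powr p * inverse (1 + x\<^sup>2)" for x
    proof -
      have "norm (trig_poly c A x * w x) powr p \<le> (D * inverse (1 + x\<^sup>2)) powr p"
        using p by (intro powr_mono2 bound) auto
      also have "\<dots> = D powr p * inverse (1 + x\<^sup>2) powr p"
        using \<open>D \<ge> 0\<close> by (intro powr_mult)
      also have "inverse (1 + x\<^sup>2) powr p \<le> inverse (1 + x\<^sup>2) powr 1"
        using p by (intro powr_mono') (auto simp: inverse_le_1_iff)
      finally show ?thesis
        by (simp add: mult_left_mono)
    qed
  qed measurable
  then show ?thesis
    by (simp add: Lp_space_def)
qed

text \<open>The p-th power of a weighted L^p norm; without the root, bounds are plain integral
  inequalities. The weight is a parameter because both \<open>h\<close> and a translate of it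
  occur.\<close>

definition weighted_pow :: "real \<Rightarrow> (real \<Rightarrow> complex) \<Rightarrow> (int \<Rightarrow> complex) \<Rightarrow> int set \<Rightarrow> real" where
  "weighted_pow p w c A = (LINT x|lborel. norm (trig_poly c A x * w x) powr p)"

lemma trig_poly_scale: "trig_poly (\<lambda>k. a * c k) A x = a * trig_poly c A x"
  by (simp add: trig_poly_def sum_distrib_left mult.assoc)

lemma weighted_pow_scale: "weighted_pow p w (\<lambda>k. of_real a * c k) A = \<bar>a\<bar> powr p * weighted_pow p w c A"
  by (simp add: weighted_pow_def trig_poly_scale norm_mult powr_mult mult.assoc)

lemma weighted_pow_cong: "(\<And>k. k \<in> A \<Longrightarrow> c k = d k) \<Longrightarrow> weighted_pow p w c A = weighted_pow p w d A"
  by (simp add: weighted_pow_def trig_poly_def)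

lemma weighted_pow_restrict: "finite A \<Longrightarrow> weighted_pow p w (\<lambda>k. if k \<in> S then c k else 0) A = weighted_pow p w c (A \<inter> S)"
  by (simp add: weighted_pow_def trig_poly_def if_distrib[of "\<lambda>z. z * _"] sum.inter_restrict cong: if_cong)

lemma weighted_pow_nonneg: "weighted_pow p w c A \<ge> 0"
  by (simp add: weighted_pow_def)

locale nonzero_test_function =
  fixes chi :: "real \<Rightarrow> complex" and V :: "real set"
  assumes test: "chi \<in> test_functions V" and nonzero: "chi \<noteq> (\<lambda>_. 0)"
begin

definition h :: "real \<Rightarrow> complex" where "h = inv_fourier chi"

lemma chi_schwartz: "chi \<in> schwartz"
  using test by (rule test_functions_schwartz)

lemma h_schwartz: "h \<in> schwartz"
  unfolding h_def by (rule inv_fourier_schwartz[OF chi_schwartz])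

lemma continuous_on_h: "continuous_on S h"
  by (intro smooth_continuous smooth_schwartz h_schwartz)

lemma borel_measurable_h [measurable]: "h \<in> borel_measurable borel"
  by (rule borel_measurable_schwartz[OF h_schwartz])

text \<open>If \<open>h\<close> vanished identically, so would all its derivatives at 0. Up to
  constant factors these are the moments of \<open>chi\<close>, one of which is nonzero.\<close>

lemma h_nonzero: "\<exists>x. h x \<noteq> 0"
proof (rule ccontr)
  assume "\<nexists>x. h x \<noteq> 0"
  then have h0: "h x = 0" for x
    by auto
  have S: "(\<lambda>\<xi>. (2 * of_real pi * \<i>) ^ n * \<xi> ^ n *\<^sub>R chi \<xi>) \<in> schwartz" for n
    by (intro schwartz_cmult schwartz_times_power chi_schwartz)
  have *: "inv_fourier (\<lambda>\<xi>. (2 * of_real pi * \<i>) ^ n * \<xi> ^ n *\<^sub>R chi \<xi>) x = 0" for n x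
  proof (induction n arbitrary: x)
    case 0
    show ?case
      using h0 by (simp add: h_def)
  next
    case (Suc n)
    let ?f = "\<lambda>\<xi>. (2 * of_real pi * \<i>) ^ n * \<xi> ^ n *\<^sub>R chi \<xi>"
    have "(inv_fourier ?f has_vector_derivative
        inv_fourier (\<lambda>\<xi>. 2 * of_real pi * \<i> * (\<xi> *\<^sub>R ?f \<xi>)) x) (at x)"
      by (intro inv_fourier_has_vector_derivative integrable_schwartz schwartz_times_x S)
    moreover have "inv_fourier ?f = (\<lambda>_. 0)"
      using Suc by auto
    ultimately have "inv_fourier (\<lambda>\<xi>. 2 * of_real pi * \<i> * (\<xi> *\<^sub>R ?f \<xi>)) x = 0"
      by (metis has_vector_derivative_const vector_derivative_at)
    moreover have "(\<lambda>\<xi>. 2 * of_real pi * \<i> * (\<xi> *\<^sub>R ?f \<xi>)) =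
        (\<lambda>\<xi>. (2 * of_real pi * \<i>) ^ Suc n * \<xi> ^ Suc n *\<^sub>R chi \<xi>)"
      by (simp add: fun_eq_iff scaleR_conv_of_real mult_ac)
    ultimately show ?case
      by simp
  qed
  have "(LINT \<xi>|lborel. \<xi> ^ n *\<^sub>R chi \<xi>) = 0" for n
    using *[of n 0] unfolding inv_fourier_cmult by (simp add: inv_fourier_cis)
  then show False
    using nonzero_moment[OF test nonzero] by metis
qed

lemma AE_eq_if_distr_of_eq:
  assumes f: "f \<in> Lp_space p" and g: "g \<in> Lp_space p" and p: "p \<ge> 1" and eq: "distr_of f = distr_of g"
  shows "AE x in lborel. f x = g x"
proof -
  have fg: "(\<lambda>x. f x - g x) \<in> Lp_space p"
    using f g p by (intro Lp_space_diff) auto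
  have "AE x in lborel. f x - g x = 0"
  proof (rule AE_zero_if_orthogonal_to_schwartz[OF test nonzero])
    show "(\<lambda>x. f x - g x) \<in> borel_measurable borel"
      using fg by (rule Lp_space_measurable)
    show "integrable lborel (\<lambda>x. indicat_real {-K..K} x *\<^sub>R (f x - g x))" for K
    proof -
      have "integrable lborel (\<lambda>x. (f x - g x) * of_real (indicat_real {-K..K} x))"
      proof (rule integrable_Lp_mult_bounded[OF fg p])
        show "integrable lborel (\<lambda>x. complex_of_real (indicat_real {-K..K} x))"
          by (intro integrable_of_real integrable_real_indicator) (auto simp: emeasure_lborel_Icc_eq)
        show "norm (complex_of_real (indicat_real {-K..K} x)) \<le> 1" for x
          by (simp add: indicator_def)
      qed
      then show ?thesis
        by (simp add: scaleR_conv_of_real mult.commute)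
    qed
    show "(LINT x|lborel. (f x - g x) * \<phi> x) = 0" if "\<phi> \<in> schwartz" for \<phi>
      using fun_cong[OF distr_of_diff[OF f g p], of \<phi>] that eq by (simp add: distr_of_def)
  qed
  then show ?thesis
    by simp
qed

text \<open>The norm is defined through an arbitrary choice of representative; uniqueness almost
  everywhere makes every representative usable.\<close>

lemma FL_norm_eq:
  assumes f: "f \<in> Lp_space p" and d: "inv_fourier_distr d = distr_of f" and p: "p \<ge> 1"
  shows "FL_norm p d = Lp_norm p f"
proof -
  let ?g = "SOME g. g \<in> Lp_space p \<and> inv_fourier_distr d = distr_of g"
  have g: "?g \<in> Lp_space p \<and> inv_fourier_distr d = distr_of ?g"
    by (rule someI_ex[of "\<lambda>g. g \<in> Lp_space p \<and> inv_fourier_distr d = distr_of g"]) (use f d in blast)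
  then have "AE x in lborel. ?g x = f x"
    using f d p by (intro AE_eq_if_distr_of_eq[of _ p]) auto
  then show ?thesis
    unfolding FL_norm_def using g f by (intro Lp_norm_cong_AE) auto
qed

lemma integrable_translate: "integrable lborel (translate a chi)"
  using lborel_integrable_real_affine[OF integrable_schwartz[OF chi_schwartz], of 1 "-a"]
  by (simp add: translate_def[abs_def])

lemma integrable_partial_series: "integrable lborel (partial_series chi c A)"
  unfolding partial_series_def[abs_def]
  by (intro Bochner_Integration.integrable_sum integrable_mult_right integrable_translate)

lemma inv_fourier_partial_series: "inv_fourier (partial_series chi c A) x = trig_poly c A x * h x"
proof -
  have "(LINT t|lborel. translate a chi t * cis (2 * pi * x * t)) = cis (2 * pi * a * x) * h x" for a
  proof -
    have "(LINT t|lborel. translate a chi t * cis (2 * pi * x * t)) =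
        (LINT t|lborel. chi t * cis (2 * pi * x * (a + t)))"
      using lborel_integral_real_affine[of 1 "\<lambda>t. translate a chi t * cis (2 * pi * x * t)" a]
      by (simp add: translate_def)
    also have "\<dots> = (LINT t|lborel. cis (2 * pi * a * x) * (chi t * cis (2 * pi * x * t)))"
      by (simp add: distrib_left cis_mult[symmetric] mult_ac)
    finally show ?thesis
      by (simp add: h_def inv_fourier_cis)
  qed
  moreover have "inv_fourier (partial_series chi c A) x =
      (LINT t|lborel. (\<Sum>k\<in>A. c k * (translate (of_int k) chi t * cis (2 * pi * x * t))))"
    by (simp add: inv_fourier_cis partial_series_def sum_distrib_right mult.assoc)
  moreover have "\<dots> = (\<Sum>k\<in>A. c k * (LINT t|lborel. translate (of_int k) chi t * cis (2 * pi * x * t)))"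
    using integrable_mult_cis[OF integrable_translate] by (subst Bochner_Integration.integral_sum) auto
  ultimately show ?thesis
    by (simp add: trig_poly_def sum_distrib_right mult.assoc)
qed

lemma inv_fourier_distr_partial_series:
  "inv_fourier_distr (distr_of (partial_series chi c A)) = distr_of (\<lambda>x. trig_poly c A x * h x)"
  unfolding inv_fourier_distr_distr_of[OF integrable_partial_series]
  by (rule arg_cong[where f = distr_of], rule ext, rule inv_fourier_partial_series)

section \<open>Cauchy conditions implied by convergence in \<open>FL p\<close>\<close>

abbreviation wnorm :: "real \<Rightarrow> (int \<Rightarrow> complex) \<Rightarrow> int set \<Rightarrow> real" where
  "wnorm p c A \<equiv> weighted_pow p h c A"

lemma trig_poly_h_Lp: "p \<ge> 1 \<Longrightarrow> (\<lambda>x. trig_poly c A x * h x) \<in> Lp_space p"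
  by (rule trig_poly_times_Lp[OF _ borel_measurable_h schwartz_decay[OF h_schwartz]])

lemma FL_tendsto_partial_series:
  assumes p: "p \<ge> 1"
    and lim: "FL_tendsto p (\<lambda>i. distr_of (partial_series chi c (S i))) u F"
  obtains g where "g \<in> Lp_space p"
    and "((\<lambda>i. LINT x|lborel. norm (trig_poly c (S i) x * h x - g x) powr p) \<longlongrightarrow> 0) F"
proof -
  obtain g where g: "g \<in> Lp_space p" "inv_fourier_distr u = distr_of g"
    using lim by (auto simp: FL_tendsto_def FL_def)
  let ?d = "\<lambda>i \<phi>. distr_of (partial_series chi c (S i)) \<phi> - u \<phi>"
  let ?f = "\<lambda>i x. trig_poly c (S i) x * h x - g x"
  have f: "?f i \<in> Lp_space p" for i
    using p g by (intro Lp_space_diff trig_poly_h_Lp) auto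
  have "inv_fourier_distr (?d i) = distr_of (?f i)" for i
  proof -
    have "inv_fourier_distr (?d i) = (\<lambda>\<phi>. inv_fourier_distr (distr_of (partial_series chi c (S i))) \<phi> -
        inv_fourier_distr u \<phi>)"
      by (auto simp: inv_fourier_distr_def)
    also have "\<dots> = distr_of (?f i)"
      unfolding inv_fourier_distr_partial_series g(2)
        distr_of_diff[OF trig_poly_h_Lp[OF p] g(1) p] ..
    finally show ?thesis .
  qed
  then have "FL_norm p (?d i) = Lp_norm p (?f i)" for i
    using f p by (intro FL_norm_eq) auto
  then have "((\<lambda>i. Lp_norm p (?f i)) \<longlongrightarrow> 0) F"
    using lim by (simp add: FL_tendsto_def)
  then have "((\<lambda>i. Lp_norm p (?f i) powr p) \<longlongrightarrow> 0) F"
    using p by (intro tendsto_zero_powrI[where b = p] tendsto_const) (auto simp: Lp_norm_def)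
  moreover have "Lp_norm p (?f i) powr p = (LINT x|lborel. norm (?f i x) powr p)" for i
    using p by (simp add: Lp_norm_def powr_powr)
  ultimately show ?thesis
    using that g(1) by simp
qed

text \<open>The polynomial over \<open>B\<close> is the difference of those over
  \<open>A \<union> B\<close> and \<open>A\<close>, both of which are close to the limit
  \<open>g\<close>.\<close>

lemma wnorm_le_of_close:
  assumes p: "p \<ge> 1" and g: "g \<in> Lp_space p" and fin: "finite A" "finite B" "A \<inter> B = {}"
    and A: "(LINT x|lborel. norm (trig_poly c A x * h x - g x) powr p) \<le> e"
    and AB: "(LINT x|lborel. norm (trig_poly c (A \<union> B) x * h x - g x) powr p) \<le> e"
  shows "wnorm p c B \<le> 2 powr p * (2 * e)"
proof -
  let ?f = "\<lambda>A x. trig_poly c A x * h x - g x"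
  have f: "?f A \<in> Lp_space p" for A
    using p g by (intro Lp_space_diff trig_poly_h_Lp) auto
  have "wnorm p c B = (LINT x|lborel. norm (?f (A \<union> B) x - ?f A x) powr p)"
    unfolding weighted_pow_def using fin by (simp add: trig_poly_Un algebra_simps)
  also have "\<dots> \<le> 2 powr p * ((LINT x|lborel. norm (?f (A \<union> B) x) powr p) +
      (LINT x|lborel. norm (?f A x) powr p))"
    using p by (intro integral_powr_diff_le f) auto
  also have "\<dots> \<le> 2 powr p * (2 * e)"
    using A AB by (intro mult_left_mono) auto
  finally show ?thesis .
qed

lemma unconditionally_convergent_imp_small:
  assumes p: "p \<ge> 1" and conv: "unconditionally_convergent_FL p chi c" and "e > 0"
  obtains A0 where "finite A0" "\<And>B. finite B \<Longrightarrow> A0 \<inter> B = {} \<Longrightarrow> wnorm p c B < e"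
proof -
  obtain u where "FL_tendsto p (\<lambda>A. distr_of (partial_series chi c A)) u (finite_subsets_at_top UNIV)"
    using conv by (auto simp: unconditionally_convergent_FL_def)
  then obtain g where g: "g \<in> Lp_space p"
    "((\<lambda>A. LINT x|lborel. norm (trig_poly c A x * h x - g x) powr p) \<longlongrightarrow> 0) (finite_subsets_at_top UNIV)"
    by (rule FL_tendsto_partial_series[OF p])
  \<comment> \<open>Chosen so that the bound \<open>2 powr p * (2 * e')\<close> equals
    \<open>e / 2\<close>, strictly below \<open>e\<close>.\<close>
  define e' where "e' = e / (2 powr p * 4)"
  have "e' > 0"
    using \<open>e > 0\<close> by (simp add: e'_def)
  then have "\<forall>\<^sub>F A in finite_subsets_at_top UNIV. (LINT x|lborel. norm (trig_poly c A x * h x - g x) powr p) < e'"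
    using g(2) by (simp add: order_tendsto_iff)
  then obtain A0 where A0: "finite A0"
    "\<And>A. finite A \<Longrightarrow> A0 \<subseteq> A \<Longrightarrow> (LINT x|lborel. norm (trig_poly c A x * h x - g x) powr p) < e'"
    by (auto simp: eventually_finite_subsets_at_top)
  show ?thesis
  proof (rule that[OF A0(1)])
    fix B :: "int set" assume B: "finite B" "A0 \<inter> B = {}"
    have "wnorm p c B \<le> 2 powr p * (2 * e')"
      using A0 B by (intro wnorm_le_of_close[OF p g(1), of A0] less_imp_le[OF A0(2)]) auto
    also have "\<dots> < e"
      using \<open>e > 0\<close> by (simp add: e'_def)
    finally show "wnorm p c B < e" .
  qed
qed

lemma symmetrically_convergent_imp_small:
  assumes p: "p \<ge> 1" and conv: "symmetrically_convergent_FL p chi c" and "e > 0"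
  obtains N where "\<And>m n. N \<le> m \<Longrightarrow> m \<le> n \<Longrightarrow> wnorm p c ({- int n..int n} - {- int m..int m}) < e"
proof -
  obtain u where "FL_tendsto p (\<lambda>N. distr_of (partial_series chi c {- int N..int N})) u sequentially"
    using conv by (auto simp: symmetrically_convergent_FL_def)
  then obtain g where g: "g \<in> Lp_space p"
    "(\<lambda>N. LINT x|lborel. norm (trig_poly c {- int N..int N} x * h x - g x) powr p) \<longlonglongrightarrow> 0"
    by (rule FL_tendsto_partial_series[OF p])
  define e' where "e' = e / (2 powr p * 4)"
  have "e' > 0"
    using \<open>e > 0\<close> by (simp add: e'_def)
  then have "\<forall>\<^sub>F N in sequentially.
      (LINT x|lborel. norm (trig_poly c {- int N..int N} x * h x - g x) powr p) < e'"
    using g(2) by (simp add: order_tendsto_iff)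
  then obtain N where N: "\<And>n. n \<ge> N \<Longrightarrow>
      (LINT x|lborel. norm (trig_poly c {- int n..int n} x * h x - g x) powr p) < e'"
    by (auto simp: eventually_sequentially)
  show ?thesis
  proof (rule that)
    fix m n assume mn: "N \<le> m" "m \<le> n"
    then have "{- int m..int m} \<union> ({- int n..int n} - {- int m..int m}) = {- int n..int n}"
      by auto
    then have "wnorm p c ({- int n..int n} - {- int m..int m}) \<le> 2 powr p * (2 * e')"
      using mn by (intro wnorm_le_of_close[OF p g(1), of "{- int m..int m}"] less_imp_le) (auto intro: N)
    also have "\<dots> < e"
      using \<open>e > 0\<close> by (simp add: e'_def)
    finally show "wnorm p c ({- int n..int n} - {- int m..int m}) < e" .
  qed
qed

end

section \<open>A gliding hump\<close>

text \<open>Monotone convergence: the sum has a finite integral, so it is finite almost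
  everywhere.\<close>

lemma AE_summable_if_summable_integrals:
  fixes f :: "nat \<Rightarrow> 'a \<Rightarrow> real"
  assumes int: "\<And>i. integrable M (f i)" and nonneg: "\<And>i x. f i x \<ge> 0"
    and sum: "summable (\<lambda>i. integral\<^sup>L M (f i))"
  shows "AE x in M. summable (\<lambda>i. f i x)"
proof -
  have [measurable]: "f i \<in> borel_measurable M" for i
    using int by auto
  have "(\<integral>\<^sup>+x. (\<Sum>i. ennreal (f i x)) \<partial>M) = (\<Sum>i. ennreal (integral\<^sup>L M (f i)))"
    by (simp add: nn_integral_suminf nn_integral_eq_integral int nonneg)
  also have "\<dots> = ennreal (\<Sum>i. integral\<^sup>L M (f i))"
    using sum nonneg by (intro suminf_ennreal2) auto
  finally have "(\<integral>\<^sup>+x. (\<Sum>i. ennreal (f i x)) \<partial>M) \<noteq> \<infinity>"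
    by simp
  then have "AE x in M. (\<Sum>i. ennreal (f i x)) \<noteq> \<infinity>"
    by (intro nn_integral_noteq_infinite) auto
  then show ?thesis
    by eventually_elim (auto intro: summable_suminf_not_top nonneg)
qed

locale unit_test_function = nonzero_test_function chi "{-1/2<..<1/2}" for chi
begin

text \<open>Here the support condition enters: the unit interval is open, so ties in rounding cannot
  occur and at most one translate is nonzero at \<open>t\<close>.\<close>

lemma translate_nonzero_imp_round: "translate (of_int k) chi t \<noteq> 0 \<Longrightarrow> k = round t"
proof -
  assume "translate (of_int k) chi t \<noteq> 0"
  moreover have "{x. chi x \<noteq> 0} \<subseteq> {-1/2<..<1/2}"
    using test closure_subset[of "{x. chi x \<noteq> 0}"] by (auto simp: test_functions_def)
  ultimately have "t - of_int k \<in> {-1/2<..<1/2}"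
    unfolding translate_def by blast
  then show ?thesis
    by (intro round_unique[symmetric]) auto
qed

lemma partial_series_eq:
  assumes "finite A"
  shows "partial_series chi c A t =
    (if round t \<in> A then c (round t) * translate (of_int (round t)) chi t else 0)"
proof -
  have "partial_series chi c A t = (\<Sum>k\<in>A. if k = round t then c k * translate (of_int k) chi t else 0)"
    unfolding partial_series_def using translate_nonzero_imp_round by (intro sum.cong) auto
  then show ?thesis
    using assms by simp
qed

lemma full_series_eq: "full_series chi c t = c (round t) * translate (of_int (round t)) chi t"
proof -
  have "full_series chi c t = (\<Sum>\<^sub>\<infinity>k\<in>{round t}. c k * translate (of_int k) chi t)"
    unfolding full_series_def using translate_nonzero_imp_round by (intro infsum_cong_neutral) auto
  then show ?thesis
    by simp
qed

text \<open>Both sides of the duality identity for partial sums pass to the limit by dominated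
  convergence: on the \<open>t\<close> side by bounded coefficients and disjoint supports, on the
  \<open>x\<close> side by the integrable \<open>T\<close>. Almost everywhere convergence thus
  replaces completeness of L^p. Only frequencies with nonzero coefficient must be reached, so the
  sets \<open>A n\<close> may be one-sided.\<close>

lemma discrete_FL_I:
  assumes p: "p \<ge> 1" and c: "\<And>k. norm (c k) \<le> 1"
    and A: "\<And>n. finite (A n)" "\<And>k. \<forall>\<^sub>F n in sequentially. c k \<noteq> 0 \<longrightarrow> k \<in> A n"
    and g: "g \<in> Lp_space p" and T: "integrable lborel T"
    and lim: "AE x in lborel. (\<lambda>n. trig_poly c (A n) x * h x) \<longlonglongrightarrow> g x"
    and bound: "\<And>n. AE x in lborel. norm (trig_poly c (A n) x * h x) \<le> 1 + T x"
  shows "c \<in> discrete_FL p chi"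
proof -
  let ?G = "full_series chi c"
  obtain B where B: "\<And>t. norm (chi t) \<le> B"
    using bounded_schwartz[OF chi_schwartz] by auto
  have cB: "norm (c k * translate (of_int a) chi t) \<le> B" for k a t
    using mult_mono[OF c[of k] B[of "t - of_int a"]] by (simp add: norm_mult translate_def)
  have GB: "norm (?G t) \<le> B" for t
    unfolding full_series_eq by (rule cB)
  have PB: "norm (partial_series chi c (A n) t) \<le> B" for n t
    using cB order_trans[OF norm_ge_zero B] by (simp add: partial_series_eq A(1))
  have Plim: "(\<lambda>n. partial_series chi c (A n) t) \<longlonglongrightarrow> ?G t" for t
  proof -
    have "\<forall>\<^sub>F n in sequentially. partial_series chi c (A n) t = ?G t"
      using A(2)[of "round t"] by eventually_elim (auto simp: partial_series_eq A(1) full_series_eq)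
    then show ?thesis
      by (rule tendsto_eventually)
  qed
  have Pmeas [measurable]: "partial_series chi c (A n) \<in> borel_measurable borel" for n
    using integrable_partial_series borel_measurable_integrable by fastforce
  have Gmeas [measurable]: "?G \<in> borel_measurable borel"
    using Plim by (rule borel_measurable_LIMSEQ_metric[OF Pmeas])
  have gmeas [measurable]: "g \<in> borel_measurable borel"
    using g by (rule Lp_space_measurable)
  have "(LINT t|lborel. ?G t * inv_fourier \<phi> t) = (LINT x|lborel. g x * \<phi> x)" if \<phi>: "\<phi> \<in> schwartz" for \<phi>
  proof -
    have \<phi>': "inv_fourier \<phi> \<in> schwartz"
      using \<phi> by (rule inv_fourier_schwartz)
    note [measurable] = borel_measurable_schwartz[OF \<phi>] borel_measurable_schwartz[OF \<phi>']
    obtain C where C: "\<And>x. norm (\<phi> x) \<le> C"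
      using bounded_schwartz[OF \<phi>] by auto
    have "(\<lambda>n. LINT t|lborel. partial_series chi c (A n) t * inv_fourier \<phi> t) \<longlonglongrightarrow>
        (LINT t|lborel. ?G t * inv_fourier \<phi> t)"
    proof (rule integral_dominated_convergence)
      show "integrable lborel (\<lambda>t. B * norm (inv_fourier \<phi> t))"
        by (intro integrable_mult_right integrable_norm integrable_schwartz \<phi>')
      show "AE t in lborel. norm (partial_series chi c (A n) t * inv_fourier \<phi> t) \<le> B * norm (inv_fourier \<phi> t)" for n
        unfolding norm_mult by (intro AE_I2 mult_right_mono PB) simp
      show "AE t in lborel. (\<lambda>n. partial_series chi c (A n) t * inv_fourier \<phi> t) \<longlonglongrightarrow> ?G t * inv_fourier \<phi> t"
        by (intro AE_I2 tendsto_mult_right Plim)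
    qed measurable
    moreover have "(\<lambda>n. LINT x|lborel. (trig_poly c (A n) x * h x) * \<phi> x) \<longlonglongrightarrow> (LINT x|lborel. g x * \<phi> x)"
    proof (rule integral_dominated_convergence)
      show "integrable lborel (\<lambda>x. norm (\<phi> x) + C * \<bar>T x\<bar>)"
        using T \<phi> by (intro Bochner_Integration.integrable_add integrable_norm integrable_schwartz
            integrable_mult_right integrable_abs)
      show "AE x in lborel. norm ((trig_poly c (A n) x * h x) * \<phi> x) \<le> norm (\<phi> x) + C * \<bar>T x\<bar>" for n
        using bound[of n]
      proof eventually_elim
        case (elim x)
        have "norm ((trig_poly c (A n) x * h x) * \<phi> x) \<le> (1 + \<bar>T x\<bar>) * norm (\<phi> x)"
          unfolding norm_mult[of _ "\<phi> x"] using elim by (intro mult_right_mono) auto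
        also have "\<dots> \<le> norm (\<phi> x) + C * \<bar>T x\<bar>"
          using mult_right_mono[OF C[of x], of "\<bar>T x\<bar>"] by (simp add: algebra_simps)
        finally show ?case .
      qed
      show "AE x in lborel. (\<lambda>n. trig_poly c (A n) x * h x * \<phi> x) \<longlonglongrightarrow> g x * \<phi> x"
        using lim by eventually_elim (rule tendsto_mult_right)
    qed measurable
    moreover have "(LINT t|lborel. partial_series chi c (A n) t * inv_fourier \<phi> t) =
        (LINT x|lborel. (trig_poly c (A n) x * h x) * \<phi> x)" for n
      using inv_fourier_duality[OF integrable_partial_series integrable_schwartz[OF \<phi>]]
      by (simp add: inv_fourier_partial_series)
    ultimately show ?thesis
      using LIMSEQ_unique by auto
  qed
  then have "inv_fourier_distr (distr_of ?G) = distr_of g"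
    by (auto simp: fun_eq_iff inv_fourier_distr_def distr_of_def inv_fourier_schwartz)
  then have "distr_of ?G \<in> FL p"
    using distr_of_tempered[OF Gmeas GB] g by (auto simp: FL_def)
  then show ?thesis
    by (auto simp: discrete_FL_def distr_of_def test_functions_schwartz intro!: bexI[of _ "distr_of ?G"])
qed

text \<open>The hump for the ratio \<open>1 / e\<close> is divided by the norm of its large subsum.
  That norm is at least 1, so scaling keeps the coefficients bounded by 1. The family
  \<open>\<A>\<close> fixes which cuts are allowed: arbitrary sets for unconditional convergence,
  half-lines for symmetric partial sums.\<close>

lemma gliding_hump_block:
  fixes m :: int
  assumes p: "p \<ge> 1" and e: "e > 0"
    and hump: "\<And>K. \<exists>b S A. finite S \<and> S \<subseteq> {m<..} \<and> A \<in> \<A> \<and> (\<forall>k. norm (b k) \<le> 1) \<and>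
      1 \<le> wnorm p b (S \<inter> A) \<and> K * wnorm p b S \<le> wnorm p b (S \<inter> A)"
  shows "\<exists>b M A. m < M \<and> (\<forall>k. b k \<noteq> 0 \<longrightarrow> k \<in> {m<..M}) \<and> (\<forall>k. norm (b k) \<le> 1) \<and> A \<in> \<A> \<and>
    wnorm p b ({m<..M} \<inter> A) = 1 \<and> wnorm p b {m<..M} \<le> e"
proof -
  obtain b S A where S: "finite S" "S \<subseteq> {m<..}" and A: "A \<in> \<A>" and b: "\<And>k. norm (b k) \<le> 1"
    and big: "1 \<le> wnorm p b (S \<inter> A)" "(1 / e) * wnorm p b S \<le> wnorm p b (S \<inter> A)"
    using hump[of "1 / e"] by blast
  define t where "t = wnorm p b (S \<inter> A) powr (- 1 / p)"
  have "t powr p = wnorm p b (S \<inter> A) powr (- 1)"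
    using p by (simp add: t_def powr_powr)
  with big have t: "t > 0" "t powr p = 1 / wnorm p b (S \<inter> A)"
    by (auto simp: t_def powr_minus_divide)
  have "wnorm p b (S \<inter> A) powr (1 / p) \<ge> 1"
    using big p by (intro ge_one_powr_ge_zero) auto
  then have "t \<le> 1"
    using big by (simp add: t_def powr_minus_divide)
  define b' where "b' = (\<lambda>k. if k \<in> S then of_real t * b k else 0)"
  \<comment> \<open>Inserting \<open>m + 1\<close> keeps the set nonempty and forces
    \<open>m < M\<close>.\<close>
  define M where "M = Max (insert (m + 1) S)"
  have M: "m < M" "S \<subseteq> {m<..M}"
  proof -
    have "m + 1 \<le> M" "\<And>k. k \<in> S \<Longrightarrow> k \<le> M"
      using S(1) by (auto simp: M_def)
    then show "m < M" "S \<subseteq> {m<..M}"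
      using S(2) by auto
  qed
  have w: "wnorm p b' B = t powr p * wnorm p b (B \<inter> S)" if "finite B" for B
    unfolding b'_def using that t(1) by (simp add: weighted_pow_restrict weighted_pow_scale)
  have "{m<..M} \<inter> A \<inter> S = S \<inter> A"
    using M(2) by auto
  then have "wnorm p b' ({m<..M} \<inter> A) = 1"
    using w[of "{m<..M} \<inter> A"] big t(2) by simp
  moreover have "wnorm p b' {m<..M} \<le> e"
  proof -
    have "wnorm p b S \<le> e * wnorm p b (S \<inter> A)"
      using big(2) e by (simp add: field_simps)
    moreover have "wnorm p b' {m<..M} = wnorm p b S / wnorm p b (S \<inter> A)"
      using w[of "{m<..M}"] M(2) t(2) by (simp add: Int_absorb1)
    ultimately show ?thesis
      using big(1) by (simp add: divide_le_eq)
  qed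
  moreover have "norm (b' k) \<le> 1" for k
    using mult_mono[of t 1 "norm (b k)" 1] b[of k] t(1) \<open>t \<le> 1\<close> by (simp add: b'_def norm_mult)
  moreover have "b' k \<noteq> 0 \<longrightarrow> k \<in> {m<..M}" for k
    using M(2) by (auto simp: b'_def)
  ultimately show ?thesis
    using A M(1) by blast
qed

lemma gliding_hump:
  assumes p: "p \<ge> 1"
    and hump: "\<And>(m::int) K. \<exists>b S A. finite S \<and> S \<subseteq> {m<..} \<and> A \<in> \<A> \<and> (\<forall>k. norm (b k) \<le> 1) \<and>
      1 \<le> wnorm p b (S \<inter> A) \<and> K * wnorm p b S \<le> wnorm p b (S \<inter> A)"
  obtains c where "c \<in> discrete_FL p chi" "\<And>k. k \<le> 0 \<Longrightarrow> c k = 0"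
    "\<And>n. \<exists>m M. \<exists>A\<in>\<A>. n \<le> m \<and> m \<le> M \<and> 1 \<le> wnorm p c ({m<..M} \<inter> A)"
proof -
  \<comment> \<open>With \<open>g\<^sub>j\<close> the \<open>j\<close>-th block and \<open>f\<^sub>j = \<bar>2\<^bsup>j+1\<^esup> g\<^sub>j\<bar>\<^bsup>p\<^esup>\<close>, the integrals of the \<open>f\<^sub>j\<close> are summable, so
    \<open>T = \<Sum> f\<^sub>j\<close> is integrable, and \<open>\<bar>g\<^sub>j\<bar> \<le> 2\<^bsup>-j-1\<^esup> T\<^bsup>1/p\<^esup>\<close> bounds all partial sums by \<open>T\<^bsup>1/p\<^esup>\<close>.\<close>
  define e where "e j = (1/2) ^ j * (2 ^ Suc j) powr (- p)" for j :: nat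
  have "e j > 0" for j
    by (simp add: e_def)
  then have "\<forall>j m. \<exists>b M A. m < M \<and> (\<forall>k. b k \<noteq> 0 \<longrightarrow> k \<in> {m<..M}) \<and> (\<forall>k. norm (b k) \<le> 1) \<and> A \<in> \<A> \<and>
      wnorm p b ({m<..M} \<inter> A) = 1 \<and> wnorm p b {m<..M} \<le> e j"
    using gliding_hump_block[OF p _ hump] by blast
  then obtain B M A where blocks: "\<And>j m. m < M j m \<and> (\<forall>k. B j m k \<noteq> 0 \<longrightarrow> k \<in> {m<..M j m}) \<and>
      (\<forall>k. norm (B j m k) \<le> 1) \<and> A j m \<in> \<A> \<and> wnorm p (B j m) ({m<..M j m} \<inter> A j m) = 1 \<and>
      wnorm p (B j m) {m<..M j m} \<le> e j"
    by metis
  \<comment> \<open>Block \<open>j\<close> occupies the frequencies from \<open>m j\<close>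
    (excluded) to \<open>m (Suc j)\<close>; starting at 0 keeps all frequencies positive.\<close>
  define m where "m = rec_nat 0 M"
  define b where "b j = B j (m j)" for j
  define S where "S j = {m j<..m (Suc j)}" for j
  have m0: "m 0 = 0" and m_Suc: "m (Suc j) = M j (m j)" for j
    by (simp_all add: m_def)
  have m_less: "m j < m (Suc j)" and b_supp: "\<And>k. b j k \<noteq> 0 \<Longrightarrow> k \<in> S j"
    and b_le: "\<And>k. norm (b j k) \<le> 1" and A_in: "A j (m j) \<in> \<A>"
    and b_big: "wnorm p (b j) (S j \<inter> A j (m j)) = 1" and b_small: "wnorm p (b j) (S j) \<le> e j" for j
    using blocks[of "m j" j] by (auto simp: b_def S_def m_Suc)
  have m_mono: "i \<le> j \<Longrightarrow> m i \<le> m j" for i j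
    using lift_Suc_mono_le[of m] m_less by (meson less_imp_le)
  have m_ge: "int j \<le> m j" for j
  proof (induction j)
    case (Suc j)
    with m_less[of j] show ?case
      by simp
  qed (simp add: m0)
  have S_disj: "i = j" if "k \<in> S i" "k \<in> S j" for i j k
    using that m_mono[of "Suc i" j] m_mono[of "Suc j" i]
    by (cases i j rule: linorder_cases) (auto simp: S_def)
  \<comment> \<open>Since \<open>m j\<close> is at least \<open>j\<close>, a block containing
    \<open>k\<close> has index below \<open>k\<close>, so a finite sum suffices; for
    \<open>k \<le> 0\<close> it is empty.\<close>
  define c where "c k = (\<Sum>j<nat k. b j k)" for k
  have c_eq: "c k = b j k" if "k \<in> S j" for j k
  proof -
    have "j < nat k"
      using that m_ge[of j] by (auto simp: S_def)
    moreover have "b i k = 0" if "i \<noteq> j" for i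
      using b_supp[of i k] S_disj[OF \<open>k \<in> S j\<close>, of i] that by auto
    ultimately have "c k = (\<Sum>i\<in>{j}. b i k)"
      unfolding c_def by (intro sum.mono_neutral_right) auto
    then show ?thesis
      by simp
  qed
  have c_supp: "\<exists>j. k \<in> S j" if "c k \<noteq> 0" for k
    using that b_supp by (metis (no_types, lifting) c_def sum.neutral)
  have c_le: "norm (c k) \<le> 1" for k
    using c_supp[of k] c_eq[of k] b_le[of _ k] by (cases "c k = 0") auto
  have c_zero: "c k = 0" if "k \<le> 0" for k
    using that by (simp add: c_def)
  have c_supp': "\<forall>\<^sub>F n in sequentially. c k \<noteq> 0 \<longrightarrow> k \<in> {0<..m n}" for k
    unfolding eventually_sequentially
  proof (intro exI[of _ "nat k"] allI impI)
    fix n assume "nat k \<le> n" "c k \<noteq> 0"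
    with c_zero[of k] m_ge[of n] show "k \<in> {0<..m n}"
      by (cases "k \<le> 0") auto
  qed
  define g where "g j x = trig_poly (b j) (S j) x * h x" for j x
  have partial: "trig_poly c {0<..m n} x * h x = (\<Sum>j<n. g j x)" for n x
  proof (induction n)
    case (Suc n)
    have "{0<..m (Suc n)} = {0<..m n} \<union> S n" "{0<..m n} \<inter> S n = {}"
      using m_less[of n] m_ge[of n] by (auto simp: S_def)
    then have "trig_poly c {0<..m (Suc n)} x = trig_poly c {0<..m n} x + trig_poly c (S n) x"
      by (simp add: trig_poly_Un S_def)
    also have "trig_poly c (S n) x = trig_poly (b n) (S n) x"
      unfolding trig_poly_def by (intro sum.cong) (auto simp: c_eq)
    finally show ?case
      using Suc by (simp add: g_def distrib_right)
  qed (simp add: m0 trig_poly_def)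
  define f where "f j x = (2 ^ Suc j * norm (g j x)) powr p" for j x
  have f_eq: "f j x = (2 ^ Suc j) powr p * norm (g j x) powr p" for j x
    unfolding f_def by (simp add: powr_mult del: power_Suc)
  have f_int: "integrable lborel (f j)" for j
    unfolding f_eq g_def by (intro integrable_mult_right Lp_space_integrable trig_poly_h_Lp p)
  have f_nonneg: "f j x \<ge> 0" for j x
    by (simp add: f_def)
  have "(LINT x|lborel. f j x) \<le> (1/2) ^ j" for j
  proof -
    have "(LINT x|lborel. f j x) = (2 ^ Suc j) powr p * wnorm p (b j) (S j)"
      by (simp add: f_eq g_def weighted_pow_def del: power_Suc)
    also have "\<dots> \<le> (2 ^ Suc j) powr p * e j"
      by (intro mult_left_mono b_small) auto
    also have "\<dots> = (1/2) ^ j"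
      by (simp add: e_def powr_minus del: power_Suc)
    finally show ?thesis .
  qed
  then have f_sum: "summable (\<lambda>j. LINT x|lborel. f j x)"
    by (intro summable_comparison_test[OF _ summable_geometric[of "1/2::real"]])
      (auto intro!: exI[of _ 0] simp: f_nonneg integral_nonneg_AE)
  have f_AE: "AE x in lborel. summable (\<lambda>j. f j x)"
    by (intro AE_summable_if_summable_integrals f_int f_nonneg f_sum)
  define T where "T x = (\<Sum>j. f j x)" for x
  have T_int: "integrable lborel T"
    unfolding T_def using f_int f_AE f_sum f_nonneg by (intro integrable_suminf) auto
  have g_le: "norm (g j x) \<le> T x powr (1 / p) * (1/2) ^ Suc j" if "summable (\<lambda>j. f j x)" for j x
  proof -
    have "f j x \<le> T x"
      unfolding T_def using sum_le_suminf[OF that, of "{j}"] f_nonneg by simp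
    then have "f j x powr (1 / p) \<le> T x powr (1 / p)"
      using p f_nonneg by (intro powr_mono2) auto
    moreover have "f j x powr (1 / p) = 2 ^ Suc j * norm (g j x)"
      using p by (simp add: f_def powr_powr del: power_Suc)
    ultimately show ?thesis
      by (simp add: field_simps power_divide)
  qed
  have half: "(\<lambda>j. (1/2) ^ Suc j :: real) sums 1"
    using power_half_series .
  have g_sum: "summable (\<lambda>j. norm (g j x))" if "summable (\<lambda>j. f j x)" for x
    by (rule summable_comparison_test[OF _ summable_mult[OF sums_summable[OF half]]])
      (use g_le[OF that] in auto)
  have T_nonneg: "T x \<ge> 0" if "summable (\<lambda>j. f j x)" for x
    unfolding T_def using that f_nonneg by (intro suminf_nonneg)
  have sum_le: "(\<Sum>j. norm (g j x)) \<le> T x powr (1 / p)" if "summable (\<lambda>j. f j x)" for x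
    using suminf_le[OF g_le[OF that] g_sum[OF that] summable_mult[OF sums_summable[OF half]]]
      suminf_mult[OF sums_summable[OF half], of "T x powr (1 / p)"] sums_unique[OF half] by simp
  have partial_le: "norm (\<Sum>j<n. g j x) \<le> T x powr (1 / p)" if "summable (\<lambda>j. f j x)" for n x
    using norm_sum[of "\<lambda>j. g j x" "{..<n}"] sum_le_suminf[OF g_sum[OF that], of "{..<n}"] sum_le[OF that]
    by simp
  define G where "G x = (\<Sum>j. g j x)" for x
  have [measurable]: "g j \<in> borel_measurable borel" for j
    unfolding g_def by measurable
  have [measurable]: "G \<in> borel_measurable borel"
    unfolding G_def by measurable
  have lim: "(\<lambda>n. \<Sum>j<n. g j x) \<longlonglongrightarrow> G x" if "summable (\<lambda>j. f j x)" for x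
    unfolding G_def by (rule summable_LIMSEQ[OF summable_norm_cancel[OF g_sum[OF that]]])
  have "integrable lborel (\<lambda>x. norm (G x) powr p)"
  proof (rule Bochner_Integration.integrable_bound[OF T_int])
    show "AE x in lborel. norm (norm (G x) powr p) \<le> norm (T x)"
      using f_AE
    proof eventually_elim
      case (elim x)
      have "norm (G x) \<le> T x powr (1 / p)"
        by (rule LIMSEQ_le_const2[OF tendsto_norm[OF lim[OF elim]]]) (use partial_le[OF elim] in blast)
      then have "norm (G x) powr p \<le> (T x powr (1 / p)) powr p"
        using p by (intro powr_mono2) auto
      then show ?case
        using p T_nonneg[OF elim] by (simp add: powr_powr)
    qed
  qed measurable
  then have G: "G \<in> Lp_space p"
    by (simp add: Lp_space_def)
  have "c \<in> discrete_FL p chi"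
  proof (rule discrete_FL_I[OF p c_le _ c_supp' G T_int])
    show "AE x in lborel. (\<lambda>n. trig_poly c {0<..m n} x * h x) \<longlonglongrightarrow> G x"
      unfolding partial using f_AE by eventually_elim (rule lim)
    show "AE x in lborel. norm (trig_poly c {0<..m n} x * h x) \<le> 1 + T x" for n
      unfolding partial using f_AE
    proof eventually_elim
      case (elim x)
      show ?case
        \<comment> \<open>The bound by the p-th root of \<open>T\<close> need not be integrable; it
          is traded for \<open>1 + T x\<close>.\<close>
        using partial_le[OF elim, of n] powr_le_one_plus[of "T x powr (1 / p)" p] T_nonneg[OF elim] p
        by (simp add: powr_powr)
    qed
  qed simp
  moreover have "\<exists>m M. \<exists>A\<in>\<A>. n \<le> m \<and> m \<le> M \<and> 1 \<le> wnorm p c ({m<..M} \<inter> A)" for n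
  proof -
    let ?j = "nat n"
    have "wnorm p c (S ?j \<inter> A ?j (m ?j)) = wnorm p (b ?j) (S ?j \<inter> A ?j (m ?j))"
      by (intro weighted_pow_cong) (simp add: c_eq)
    then have "1 \<le> wnorm p c ({m ?j<..m (Suc ?j)} \<inter> A ?j (m ?j))"
      using b_big[of ?j] by (simp add: S_def)
    moreover have "n \<le> m ?j" "m ?j \<le> m (Suc ?j)"
      using m_ge[of ?j] m_less[of ?j] nat_le_iff[of n "?j"] by linarith+
    ultimately show ?thesis
      using A_in[of ?j] by blast
  qed
  ultimately show ?thesis
    using that c_zero by blast
qed

end

section \<open>Dirichlet and Fejer kernels\<close>

text \<open>The one-sided kernel, with frequencies 0 to M - 1: its squared modulus is M times the
  Fejer kernel.\<close>

definition dirichlet :: "nat \<Rightarrow> real \<Rightarrow> complex" where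
  "dirichlet M x = (\<Sum>j<M. cis (2 * pi * x) ^ j)"

lemma cis_of_nat_mult: "cis (2 * pi * of_int (int j) * x) = cis (2 * pi * x) ^ j"
  unfolding Complex.DeMoivre by (rule arg_cong[where f = cis]) simp

lemma cis_of_nat_mult_neg: "cis (2 * pi * of_int (- int j) * x) = cnj (cis (2 * pi * x) ^ j)"
  unfolding Complex.DeMoivre cis_cnj by (rule arg_cong[where f = cis]) simp

lemma norm_dirichlet_le: "norm (dirichlet M x) \<le> real M"
  unfolding dirichlet_def by (rule order_trans[OF norm_sum]) (simp add: norm_power)

lemma continuous_on_dirichlet [continuous_intros]: "continuous_on S (dirichlet M)"
  unfolding dirichlet_def by (intro continuous_intros)

lemma borel_measurable_dirichlet [measurable]: "dirichlet M \<in> borel_measurable borel"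
  by (intro borel_measurable_continuous_onI continuous_intros)

text \<open>Dividing by \<open>z ^ M\<close> moves the one-sided kernel to the frequencies -M to -1,
  and conjugation gives 1 to M. In this form the symmetric kernel is the increment of the squared
  modulus from \<open>dirichlet M\<close> to \<open>dirichlet (Suc M)\<close>.\<close>

lemma dirichlet_symmetric:
  fixes x :: real
  defines "z \<equiv> cis (2 * pi * x)"
  shows "trig_poly (\<lambda>_. 1) {- int M..int M} x =
    1 + dirichlet M x * cnj (z ^ M) + cnj (dirichlet M x) * z ^ M"
proof (induction M)
  case 0
  show ?case
    by (simp add: trig_poly_def dirichlet_def)
next
  case (Suc M)
  have set: "{- int (Suc M)..int (Suc M)} = insert (- int (Suc M)) (insert (int (Suc M)) {- int M..int M})"
    by auto
  have insert: "sum f {- int (Suc M)..int (Suc M)} = f (- int (Suc M)) + (f (int (Suc M)) + sum f {- int M..int M})"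
    for f :: "int \<Rightarrow> complex"
    unfolding set by simp
  have "trig_poly (\<lambda>_. 1) {- int (Suc M)..int (Suc M)} x =
      cnj (z ^ Suc M) + (z ^ Suc M + trig_poly (\<lambda>_. 1) {- int M..int M} x)"
    unfolding trig_poly_def insert z_def cis_of_nat_mult_neg cis_of_nat_mult mult_1 ..
  moreover have D: "dirichlet (Suc M) x * cnj (z ^ Suc M) = cnj (z ^ Suc M) + dirichlet M x * cnj (z ^ M)"
  proof -
    have "z * cnj z = 1"
      by (simp add: z_def cis_cnj cis_mult)
    moreover have "dirichlet (Suc M) x = 1 + z * dirichlet M x"
      unfolding dirichlet_def z_def[symmetric]
      by (subst sum.lessThan_Suc_shift) (simp add: sum_distrib_left)
    moreover have "(1 + z * dirichlet M x) * cnj (z ^ Suc M) =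
        cnj (z ^ Suc M) + (z * cnj z) * (dirichlet M x * cnj (z ^ M))"
      by (simp add: algebra_simps)
    ultimately show ?thesis
      by (simp only: mult_1)
  qed
  moreover have "cnj (dirichlet (Suc M) x) * z ^ Suc M = z ^ Suc M + cnj (dirichlet M x) * z ^ M"
    using arg_cong[OF D, of cnj] by simp
  ultimately show ?case
    using Suc by (simp del: power_Suc)
qed

text \<open>Induction on \<open>M\<close>: passing to \<open>Suc M\<close> raises the triangular
  coefficients by 1 on all frequencies of modulus at most \<open>M\<close>, which adds a symmetric
  Dirichlet kernel. The range \<open>L\<close> is kept free so that kernels of different order can
  be subtracted.\<close>

lemma trig_poly_fejer:
  assumes "M \<le> L"
  shows "trig_poly (\<lambda>k. of_real (max 0 (real M - real_of_int \<bar>k\<bar>))) {- int L..int L} x =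
    of_real ((norm (dirichlet M x))\<^sup>2)"
  using assms
proof (induction M)
  case 0
  show ?case
    by (simp add: trig_poly_def dirichlet_def max_absorb1)
next
  case (Suc M)
  let ?z = "cis (2 * pi * x)"
  have split: "max 0 (real (Suc M) - real_of_int \<bar>k\<bar>) =
      max 0 (real M - real_of_int \<bar>k\<bar>) + (if k \<in> {- int M..int M} then 1 else 0)" for k
  proof (cases "\<bar>k\<bar> \<le> int M")
    case True
    then have "real_of_int \<bar>k\<bar> \<le> real M"
      by linarith
    then show ?thesis
      using True by (auto simp: max_def abs_le_iff)
  next
    case False
    then have "real_of_int \<bar>k\<bar> \<ge> real M + 1"
      by linarith
    then show ?thesis
      using False by (auto simp: max_def abs_le_iff)
  qed
  have "trig_poly (\<lambda>k. of_real (max 0 (real (Suc M) - real_of_int \<bar>k\<bar>))) {- int L..int L} x =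
      trig_poly (\<lambda>k. of_real (max 0 (real M - real_of_int \<bar>k\<bar>))) {- int L..int L} x +
      (\<Sum>k\<in>{- int L..int L}. if k \<in> {- int M..int M} then cis (2 * pi * of_int k * x) else 0)"
    unfolding trig_poly_def split sum.distrib[symmetric]
    by (intro sum.cong) (auto simp: distrib_right)
  also have "(\<Sum>k\<in>{- int L..int L}. if k \<in> {- int M..int M} then cis (2 * pi * of_int k * x) else 0) =
      trig_poly (\<lambda>_. 1) {- int M..int M} x"
  proof -
    have "{- int L..int L} \<inter> {- int M..int M} = {- int M..int M}"
      using Suc.prems by auto
    then show ?thesis
      by (simp only: trig_poly_def sum.inter_restrict[symmetric] finite_atLeastAtMost_int mult_1)
  qed
  also have "trig_poly (\<lambda>k. of_real (max 0 (real M - real_of_int \<bar>k\<bar>))) {- int L..int L} x =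
      dirichlet M x * cnj (dirichlet M x)"
    using Suc by (simp add: complex_norm_square[symmetric])
  also have "dirichlet M x * cnj (dirichlet M x) + trig_poly (\<lambda>_. 1) {- int M..int M} x =
      dirichlet (Suc M) x * cnj (dirichlet (Suc M) x)"
  proof -
    have "?z ^ M * cnj (?z ^ M) = (?z * cnj ?z) ^ M"
      by (simp add: power_mult_distrib)
    then have "?z ^ M * cnj (?z ^ M) = 1"
      by (simp add: cis_cnj cis_mult)
    then show ?thesis
      unfolding dirichlet_symmetric by (simp add: dirichlet_def algebra_simps)
  qed
  finally show ?case
    by (simp only: complex_norm_square)
qed

lemma has_integral_trig_poly:
  assumes "finite A" "0 \<in> A"
  shows "((\<lambda>s. trig_poly c A (u + s)) has_integral c 0) {0..1}"
proof -
  have "((\<lambda>s. c k * cis (2 * pi * of_int k * (u + s))) has_integral (if k = 0 then c k else 0)) {0..1}" for k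
  proof (cases "k = 0")
    case True
    then show ?thesis
      using has_integral_const_real[of "c 0" 0 1] by simp
  next
    case False
    let ?F = "\<lambda>s. c k / (2 * of_real pi * \<i> * of_int k) * cis (2 * pi * of_int k * (u + s))"
    have "((\<lambda>s. c k * cis (2 * pi * of_int k * (u + s))) has_integral ?F 1 - ?F 0) {0..1}"
    proof (rule fundamental_theorem_of_calculus)
      fix s :: real
      show "(?F has_vector_derivative c k * cis (2 * pi * of_int k * (u + s))) (at s within {0..1})"
        unfolding has_vector_derivative_def using False
        by (auto intro!: derivative_eq_intros simp: scaleR_conv_of_real field_simps)
    qed simp
    moreover have "?F 1 - ?F 0 = 0"
    proof -
      have "cis (2 * pi * of_int k * (u + 1)) = cis (2 * pi * of_int k * u) * cis (2 * pi * of_int k)"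
        by (simp only: cis_mult distrib_left mult_1_right)
      moreover have "cis (2 * pi * of_int k) = 1"
        by (rule cis_multiple_2pi) simp
      ultimately show ?thesis
        by simp
    qed
    ultimately show ?thesis
      using False by (simp only: if_False)
  qed
  then have "((\<lambda>s. trig_poly c A (u + s)) has_integral (\<Sum>k\<in>A. if k = 0 then c k else 0)) {0..1}"
    unfolding trig_poly_def by (intro has_integral_sum assms)
  then show ?thesis
    using assms by simp
qed

text \<open>Parseval: over any period the integral is the coefficient of the Fejer sum at frequency
  0.\<close>

lemma nn_integral_dirichlet:
  "(\<integral>\<^sup>+s. ennreal (indicator {0..1} s * (norm (dirichlet M (u + s)))\<^sup>2) \<partial>lborel) = real M"
proof -
  have "((\<lambda>s. trig_poly (\<lambda>k. of_real (max 0 (real M - real_of_int \<bar>k\<bar>))) {- int M..int M} (u + s))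
      has_integral of_real (max 0 (real M - real_of_int \<bar>0\<bar>))) {0..1}"
    by (rule has_integral_trig_poly) auto
  then have "((\<lambda>s. complex_of_real ((norm (dirichlet M (u + s)))\<^sup>2)) has_integral of_real (real M)) {0..1}"
    by (simp only: trig_poly_fejer[OF order_refl]) simp
  from has_integral_Re[OF this]
  have "((\<lambda>s. (norm (dirichlet M (u + s)))\<^sup>2) has_integral real M) {0..1}"
    by simp
  then have "((\<lambda>s. indicator {0..1} s * (norm (dirichlet M (u + s)))\<^sup>2) has_integral real M) UNIV"
    unfolding has_integral_restrict_UNIV[of "{0..1}", symmetric]
    by (rule has_integral_eq[rotated]) (simp add: indicator_def)
  moreover have "(\<lambda>s. indicator {0..1} s * (norm (dirichlet M (u + s)))\<^sup>2) \<in> borel_measurable borel"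
    by measurable
  ultimately show ?thesis
    by (intro nn_integral_has_integral_lborel) auto
qed

text \<open>Peetre's inequality: translation costs the weight only a constant factor.\<close>

lemma inverse_1_plus_square_shift:
  "inverse (1 + x\<^sup>2) \<le> (2 + 2 * a\<^sup>2) * inverse (1 + (x + a)\<^sup>2)" for x a :: real
proof -
  have "0 \<le> (x - a)\<^sup>2 + 2 * a\<^sup>2 * x\<^sup>2 + 1"
    by simp
  then have "1 + (x + a)\<^sup>2 \<le> (2 + 2 * a\<^sup>2) * (1 + x\<^sup>2)"
    by (simp add: power2_eq_square algebra_simps)
  moreover have "1 + x\<^sup>2 > 0" "1 + (x + a)\<^sup>2 > 0"
    by (simp_all add: add_pos_nonneg)
  ultimately show ?thesis
    by (simp add: field_simps)
qed

text \<open>Averaging over translates by \<open>s \<in> [0, 1]\<close> replaces the periodisation of the weight.\<close>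

lemma nn_integral_dirichlet_weighted:
  "(\<integral>\<^sup>+x. ennreal ((norm (dirichlet M x))\<^sup>2 * inverse (1 + x\<^sup>2)) \<partial>lborel) \<le>
    ennreal (4 * real M * (LINT x::real|lborel. inverse (1 + x\<^sup>2)))"
proof -
  let ?F = "\<lambda>x. (norm (dirichlet M x))\<^sup>2"
  let ?q = "\<lambda>x::real. inverse (1 + x\<^sup>2)"
  have q: "?q x \<ge> 0" for x
    by (simp add: add_nonneg_nonneg)
  have "(\<integral>\<^sup>+x. ennreal (?F x * ?q x) \<partial>lborel) =
      (\<integral>\<^sup>+s. (\<integral>\<^sup>+x. ennreal (?F x * ?q x) \<partial>lborel) * indicator {0..1::real} s \<partial>lborel)"
    by (subst nn_integral_cmult_indicator) auto
  also have "\<dots> \<le> (\<integral>\<^sup>+s. (\<integral>\<^sup>+u. ennreal (4 * ?q u) * ennreal (indicator {0..1} s * ?F (u + s)) \<partial>lborel) \<partial>lborel)"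
  proof (rule nn_integral_mono)
    fix s :: real
    have "(\<integral>\<^sup>+x. ennreal (?F x * ?q x) \<partial>lborel) \<le>
        (\<integral>\<^sup>+u. ennreal (4 * ?q u) * ennreal (?F (u + s)) \<partial>lborel)" if "s \<in> {0..1}"
    proof -
      have s2: "s\<^sup>2 \<le> 1"
        using that by (simp add: power_le_one_iff abs_le_iff)
      have "(\<integral>\<^sup>+x. ennreal (?F x * ?q x) \<partial>lborel) = (\<integral>\<^sup>+u. ennreal (?F (s + u) * ?q (s + u)) \<partial>lborel)"
        using nn_integral_real_affine[of "\<lambda>x. ennreal (?F x * ?q x)" 1 s] by simp
      also have "\<dots> \<le> (\<integral>\<^sup>+u. ennreal (4 * ?q u) * ennreal (?F (u + s)) \<partial>lborel)"
      proof (rule nn_integral_mono)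
        fix u
        have "?q (s + u) \<le> (2 + 2 * s\<^sup>2) * ?q u"
          using inverse_1_plus_square_shift[of "s + u" "- s"] by simp
        \<comment> \<open>The shift is at most 1, so the factor \<open>2 + 2 * s\<^sup>2\<close> is
          at most 4.\<close>
        also have "\<dots> \<le> 4 * ?q u"
          using s2 q by (intro mult_right_mono) auto
        finally have "?F (s + u) * ?q (s + u) \<le> 4 * ?q u * ?F (u + s)"
          by (subst mult.commute, subst add.commute) (intro mult_right_mono; simp add: add.commute)
        then show "ennreal (?F (s + u) * ?q (s + u)) \<le> ennreal (4 * ?q u) * ennreal (?F (u + s))"
          using q by (simp add: ennreal_mult[symmetric] del: inverse_nonnegative_iff_nonnegative)
      qed
      finally show ?thesis .
    qed
    then show "(\<integral>\<^sup>+x. ennreal (?F x * ?q x) \<partial>lborel) * indicator {0..1} s \<le>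
        (\<integral>\<^sup>+u. ennreal (4 * ?q u) * ennreal (indicator {0..1} s * ?F (u + s)) \<partial>lborel)"
      by (cases "s \<in> {0..1}") auto
  qed
  \<comment> \<open>After the exchange the inner integral runs over a full period and equals
    \<open>M\<close> for every \<open>u\<close>.\<close>
  also have "\<dots> = (\<integral>\<^sup>+u. (\<integral>\<^sup>+s. ennreal (4 * ?q u) * ennreal (indicator {0..1} s * ?F (u + s)) \<partial>lborel) \<partial>lborel)"
    by (rule lborel_pair.Fubini') measurable
  also have "\<dots> = (\<integral>\<^sup>+u. ennreal (4 * ?q u) * ennreal (real M) \<partial>lborel)"
    by (subst nn_integral_cmult) (auto simp: nn_integral_dirichlet)
  also have "\<dots> = (\<integral>\<^sup>+u. ennreal (4 * real M * ?q u) \<partial>lborel)"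
    using q by (intro nn_integral_cong) (simp add: ennreal_mult[symmetric] mult_ac)
  also have "\<dots> = ennreal (LINT u|lborel. 4 * real M * ?q u)"
    using integrable_inverse_1_plus_square_lborel q by (intro nn_integral_eq_integral) auto
  finally show ?thesis
    by simp
qed

section \<open>Rudin--Shapiro polynomials\<close>

lemma trig_poly_shift:
  "trig_poly (\<lambda>k. c (k - m)) ((\<lambda>k. k + m) ` A) x = cis (2 * pi * of_int m * x) * trig_poly c A x"
  unfolding trig_poly_def
  by (subst sum.reindex) (auto simp: inj_on_def sum_distrib_left cis_mult[symmetric] algebra_simps intro!: sum.cong)

text \<open>The pair (R, Q) of length L = 2^n is replaced by R + z^L Q and R - z^L Q, with z the
  basic character. The coefficients stay signs, and the parallelogram law doubles the sum of
  squares.\<close>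

lemma rudin_shapiro:
  "\<exists>r q :: int \<Rightarrow> complex. (\<forall>k. r k \<in> {1, -1}) \<and> (\<forall>k. q k \<in> {1, -1}) \<and>
    (\<forall>x. (norm (trig_poly r {0..<2 ^ n} x))\<^sup>2 + (norm (trig_poly q {0..<2 ^ n} x))\<^sup>2 = 2 * 2 ^ n)"
proof (induction n)
  case 0
  show ?case
  proof (intro exI[of _ "\<lambda>_. 1"])
    have "{0..<2 ^ 0} = {0::int}"
      by auto
    then show "(\<forall>k::int. 1 \<in> {1, - 1 :: complex}) \<and> (\<forall>k::int. 1 \<in> {1, - 1 :: complex}) \<and>
        (\<forall>x. (norm (trig_poly (\<lambda>_. 1) {0..<2 ^ 0} x))\<^sup>2 + (norm (trig_poly (\<lambda>_. 1) {0..<2 ^ 0} x))\<^sup>2 = 2 * 2 ^ 0)"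
      by (simp add: trig_poly_def)
  qed
next
  case (Suc n)
  then obtain r q :: "int \<Rightarrow> complex" where rq: "\<And>k. r k \<in> {1, -1}" "\<And>k. q k \<in> {1, -1}"
    "\<And>x. (norm (trig_poly r {0..<2 ^ n} x))\<^sup>2 + (norm (trig_poly q {0..<2 ^ n} x))\<^sup>2 = 2 * 2 ^ n"
    by blast
  define cat where "cat s k = (if k < 2 ^ n then r k else s * q (k - 2 ^ n))" for s k
  have cat: "trig_poly (cat s) {0..<2 ^ Suc n} x =
      trig_poly r {0..<2 ^ n} x + s * (cis (2 * pi * of_int (2 ^ n) * x) * trig_poly q {0..<2 ^ n} x)" for s x
  proof -
    have shift: "(\<lambda>k. k + 2 ^ n) ` {0..<2 ^ n} = {2 ^ n..<(2 ^ Suc n :: int)}"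
      by (simp add: image_add_int_atLeastLessThan)
    have "{0..<2 ^ Suc n} = {0..<(2 ^ n :: int)} \<union> {2 ^ n..<2 ^ Suc n}"
      by auto
    then have "trig_poly (cat s) {0..<2 ^ Suc n} x =
        trig_poly (cat s) {0..<2 ^ n} x + trig_poly (cat s) {2 ^ n..<2 ^ Suc n} x"
      by (simp add: trig_poly_Un ivl_disj_int_two(3) del: power_Suc)
    also have "trig_poly (cat s) {0..<2 ^ n} x = trig_poly r {0..<2 ^ n} x"
      unfolding trig_poly_def by (intro sum.cong) (auto simp: cat_def)
    also have "trig_poly (cat s) {2 ^ n..<2 ^ Suc n} x =
        trig_poly (\<lambda>k. s * q (k - 2 ^ n)) {2 ^ n..<2 ^ Suc n} x"
      unfolding trig_poly_def by (intro sum.cong) (auto simp: cat_def)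
    finally show ?thesis
      using trig_poly_shift[of q "2 ^ n" "{0..<2 ^ n}" x] unfolding shift by (simp only: trig_poly_scale)
  qed
  have par: "(norm (a + b))\<^sup>2 + (norm (a - b))\<^sup>2 = 2 * ((norm a)\<^sup>2 + (norm b)\<^sup>2)" for a b :: complex
    unfolding cmod_power2 by (simp add: power2_eq_square algebra_simps)
  have "(norm (trig_poly (cat 1) {0..<2 ^ Suc n} x))\<^sup>2 + (norm (trig_poly (cat (-1)) {0..<2 ^ Suc n} x))\<^sup>2 =
      2 * 2 ^ Suc n" for x
    unfolding cat using par[of "trig_poly r {0..<2 ^ n} x"
        "cis (2 * pi * of_int (2 ^ n) * x) * trig_poly q {0..<2 ^ n} x"] rq(3)[of x]
    by (simp add: norm_mult)
  moreover have "cat s k \<in> {1, -1}" if "s \<in> {1, -1}" for s k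
    using rq(1)[of k] rq(2)[of "k - 2 ^ n"] that by (auto simp: cat_def)
  ultimately show ?case
    by (intro exI[of _ "cat 1"] exI[of _ "cat (-1)"]) auto
qed

section \<open>Subsums of trigonometric polynomials in weighted \<open>L\<^sup>p\<close>\<close>

lemma eventually_le_powr:
  fixes a C B :: real
  assumes "a > 0" "C > 0"
  shows "\<forall>\<^sub>F n in sequentially. B \<le> C * (2 ^ n) powr a"
proof -
  have "(2::real) powr a > 1"
    using assms by simp
  then obtain N where N: "B / C < (2 powr a) ^ N"
    using real_arch_pow by blast
  have "B \<le> C * (2 ^ n) powr a" if "n \<ge> N" for n
  proof -
    have "(2 powr a) ^ N \<le> (2 powr a) ^ n"
      using \<open>2 powr a > 1\<close> that by (intro power_increasing) auto
    also have "(2 powr a) ^ n = (2 ^ n) powr a"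
      by (simp add: powr_powr powr_realpow[symmetric] mult.commute)
    finally have "B / C \<le> (2 ^ n) powr a"
      using N by linarith
    then show ?thesis
      using assms(2) by (simp add: pos_divide_le_eq mult.commute)
  qed
  then show ?thesis
    using eventually_sequentially by blast
qed

text \<open>To be used for a translate of \<open>h\<close>: the integral of \<open>chi\<close> may
  be 0, so \<open>h\<close> itself may vanish at 0, where the kernels concentrate.\<close>

locale decaying_weight =
  fixes w :: "real \<Rightarrow> complex" and C :: real
  assumes continuous_w: "continuous_on UNIV w"
    and decay: "\<And>x. norm (w x) \<le> C * inverse (1 + x\<^sup>2)"
    and w_0: "w 0 \<noteq> 0"
begin

abbreviation W :: "real \<Rightarrow> (int \<Rightarrow> complex) \<Rightarrow> int set \<Rightarrow> real" where
  "W p c A \<equiv> weighted_pow p w c A"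

lemma borel_measurable_w [measurable]: "w \<in> borel_measurable borel"
  by (rule borel_measurable_continuous_onI[OF continuous_w])

lemma C_nonneg: "C \<ge> 0"
  using order_trans[OF norm_ge_zero decay[of 0]] by simp

lemma norm_w_le: "norm (w x) \<le> C"
proof -
  have "C * inverse (1 + x\<^sup>2) \<le> C * 1"
    using C_nonneg by (intro mult_left_mono) (auto simp: inverse_le_1_iff)
  with decay[of x] show ?thesis
    by simp
qed

lemma trig_poly_w_Lp: "p \<ge> 1 \<Longrightarrow> (\<lambda>x. trig_poly c A x * w x) \<in> Lp_space p"
  by (rule trig_poly_times_Lp[OF _ borel_measurable_w decay])

lemma integrable_trig_poly_w: "p \<ge> 1 \<Longrightarrow> integrable lborel (\<lambda>x. norm (trig_poly c A x * w x) powr p)"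
  by (intro Lp_space_integrable trig_poly_w_Lp)

lemma w_near_0:
  obtains \<delta> where "\<delta> > 0" "\<delta> < 1" "\<And>x. \<bar>x\<bar> \<le> \<delta> \<Longrightarrow> norm (w 0) / 2 \<le> norm (w x)"
proof -
  have "isCont w 0"
    using continuous_w by (simp add: continuous_on_eq_continuous_at)
  then obtain d where d: "d > 0" "\<And>x. dist x 0 < d \<Longrightarrow> dist (w x) (w 0) < norm (w 0) / 2"
    using w_0 by (metis continuous_at_eps_delta half_gt_zero_iff zero_less_norm_iff)
  show ?thesis
  proof (rule that[of "min (d / 2) (1 / 2)"])
    fix x :: real assume "\<bar>x\<bar> \<le> min (d / 2) (1 / 2)"
    then have "norm (w x - w 0) < norm (w 0) / 2"
      using d by (simp add: dist_norm)
    then show "norm (w 0) / 2 \<le> norm (w x)"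
      using norm_triangle_sub[of "w 0" "w x"] by (simp add: norm_minus_commute)
  qed (use d in auto)
qed

lemma W_ge:
  assumes p: "p \<ge> 1" and "a \<le> b" "m \<ge> 0"
    and m: "\<And>x. x \<in> {a..b} \<Longrightarrow> m \<le> norm (trig_poly c A x * w x)"
  shows "(b - a) * m powr p \<le> W p c A"
proof -
  have "(b - a) * m powr p = (LINT x|lborel. indicator {a..b} x * m powr p)"
    using \<open>a \<le> b\<close> by simp
  also have "\<dots> \<le> W p c A"
    unfolding weighted_pow_def
  proof (rule integral_mono)
    show "indicator {a..b} x * m powr p \<le> norm (trig_poly c A x * w x) powr p" for x
      using m[of x] p \<open>m \<ge> 0\<close> by (cases "x \<in> {a..b}") (auto intro!: powr_mono2)
    show "integrable lborel (\<lambda>x. indicator {a..b} x * m powr p)"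
      using \<open>a \<le> b\<close> by (intro integrable_mult_left integrable_real_indicator) (auto simp: emeasure_lborel_Icc_eq)
  qed (rule integrable_trig_poly_w[OF p])
  finally show ?thesis .
qed

lemma W_one_pos:
  assumes "p \<ge> 1"
  shows "W p (\<lambda>_. 1) {0} > 0"
proof -
  obtain \<delta> where \<delta>: "\<delta> > 0" "\<And>x. \<bar>x\<bar> \<le> \<delta> \<Longrightarrow> norm (w 0) / 2 \<le> norm (w x)"
    using w_near_0 by metis
  have "0 < (\<delta> - (-\<delta>)) * (norm (w 0) / 2) powr p"
    using \<delta> w_0 by simp
  also have "\<dots> \<le> W p (\<lambda>_. 1) {0}"
    using \<delta> by (intro W_ge assms) (auto simp: trig_poly_def abs_le_iff)
  finally show ?thesis .
qed

lemma dirichlet_integral_le: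
  fixes M :: nat
  defines "K \<equiv> 4 * C * (LINT x::real|lborel. inverse (1 + x\<^sup>2))"
  shows "integrable lborel (\<lambda>x. (norm (dirichlet M x))\<^sup>2 * norm (w x))"
    and "(LINT x|lborel. (norm (dirichlet M x))\<^sup>2 * norm (w x)) \<le> K * real M"
proof -
  let ?q = "\<lambda>x::real. inverse (1 + x\<^sup>2)"
  have D: "(norm (dirichlet M x))\<^sup>2 \<le> (real M)\<^sup>2" for x
    by (intro power_mono norm_dirichlet_le) simp
  show int: "integrable lborel (\<lambda>x. (norm (dirichlet M x))\<^sup>2 * norm (w x))"
  proof (rule integrable_decay)
    show "norm ((norm (dirichlet M x))\<^sup>2 * norm (w x)) \<le> ((real M)\<^sup>2 * C) * ?q x" for x
      using mult_mono[OF D[of x] decay[of x]] by (simp add: mult.assoc)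
  qed measurable
  have "ennreal (LINT x|lborel. (norm (dirichlet M x))\<^sup>2 * norm (w x)) =
      (\<integral>\<^sup>+x. ennreal ((norm (dirichlet M x))\<^sup>2 * norm (w x)) \<partial>lborel)"
    by (intro nn_integral_eq_integral[symmetric] int) simp
  also have "\<dots> \<le> (\<integral>\<^sup>+x. ennreal C * ennreal ((norm (dirichlet M x))\<^sup>2 * ?q x) \<partial>lborel)"
  proof (rule nn_integral_mono)
    fix x
    have "(norm (dirichlet M x))\<^sup>2 * norm (w x) \<le> C * ((norm (dirichlet M x))\<^sup>2 * ?q x)"
      using mult_left_mono[OF decay[of x], of "(norm (dirichlet M x))\<^sup>2"] by (simp add: mult_ac)
    then show "ennreal ((norm (dirichlet M x))\<^sup>2 * norm (w x)) \<le>
        ennreal C * ennreal ((norm (dirichlet M x))\<^sup>2 * ?q x)"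
      using C_nonneg by (simp add: ennreal_mult[symmetric] add_nonneg_nonneg ennreal_leI)
  qed
  also have "\<dots> = ennreal C * (\<integral>\<^sup>+x. ennreal ((norm (dirichlet M x))\<^sup>2 * ?q x) \<partial>lborel)"
    by (rule nn_integral_cmult) measurable
  also have "\<dots> \<le> ennreal C * ennreal (4 * real M * (LINT x|lborel. ?q x))"
    by (intro mult_left_mono nn_integral_dirichlet_weighted) simp
  also have "\<dots> = ennreal (K * real M)"
    using C_nonneg by (simp add: K_def ennreal_mult[symmetric] add_nonneg_nonneg mult_ac)
  finally show "(LINT x|lborel. (norm (dirichlet M x))\<^sup>2 * norm (w x)) \<le> K * real M"
    using C_nonneg by (subst (asm) ennreal_le_iff) (simp_all add: K_def add_nonneg_nonneg)
qed

text \<open>The signs split \<open>S\<close> into two parts, and \<open>d\<close> is the difference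
  of the two subsums of \<open>c\<close>; the larger one qualifies. One factor
  \<open>2 powr p\<close> comes from the difference, the other 2 from taking the larger
  part.\<close>

lemma sign_split:
  assumes p: "p \<ge> 1" and S: "finite S"
    and r: "\<And>k. r k \<in> {1, -1}" and d: "\<And>k. k \<in> S \<Longrightarrow> d k = r k * c k"
  obtains A where "W p d S \<le> 2 * 2 powr p * W p c (S \<inter> A)"
proof -
  define P where "P = {k. r k = 1}"
  have eq: "trig_poly d S x = trig_poly c (S \<inter> P) x - trig_poly c (S \<inter> - P) x" for x
  proof -
    have "trig_poly d S x = trig_poly d (S \<inter> P) x + trig_poly d (S \<inter> - P) x"
      using trig_poly_Un[of "S \<inter> P" "S \<inter> - P" d x] S by (simp add: Int_Un_distrib[symmetric] disjoint_iff)
    also have "trig_poly d (S \<inter> P) x = trig_poly c (S \<inter> P) x"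
      unfolding trig_poly_def by (intro sum.cong) (auto simp: d P_def)
    also have "trig_poly d (S \<inter> - P) x = - trig_poly c (S \<inter> - P) x"
    proof -
      have "d k = - c k" if "k \<in> S \<inter> - P" for k
        using r[of k] d[of k] that by (auto simp: P_def)
      then show ?thesis
        unfolding trig_poly_def sum_negf[symmetric] by (intro sum.cong) auto
    qed
    finally show ?thesis
      by simp
  qed
  have "W p d S \<le> 2 powr p * (W p c (S \<inter> P) + W p c (S \<inter> - P))"
    unfolding weighted_pow_def eq left_diff_distrib
    using p by (intro integral_powr_diff_le trig_poly_w_Lp) auto
  also have "\<dots> \<le> 2 powr p * (2 * max (W p c (S \<inter> P)) (W p c (S \<inter> - P)))"
    by (intro mult_left_mono) auto
  finally have le: "W p d S \<le> 2 * 2 powr p * max (W p c (S \<inter> P)) (W p c (S \<inter> - P))"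
    by simp
  show ?thesis
  proof (cases "W p c (S \<inter> P) \<le> W p c (S \<inter> - P)")
    case True
    with le that[of "- P"] show ?thesis
      by (simp add: max_absorb2)
  next
    case False
    with le that[of P] show ?thesis
      by (simp add: max_absorb1)
  qed
qed

text \<open>Only exponents matter: \<open>0 < \<beta>\<close> brings the subsum above 1, and
  \<open>\<alpha> < \<beta>\<close> beats any ratio \<open>K\<close>. Lengths are powers of 2
  because Rudin-Shapiro polynomials are built by doubling.\<close>

lemma hump_of_growth:
  assumes "\<alpha> < \<beta>" "0 < \<beta>" "0 < C2"
    and growth: "\<forall>\<^sub>F n in sequentially. \<exists>b S A. finite S \<and> (\<forall>k. norm (b k) \<le> 1) \<and>
      W p b S \<le> C1 * (2 ^ n) powr \<alpha> \<and> C2 * (2 ^ n) powr \<beta> \<le> W p b (S \<inter> A)"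
  shows "\<exists>b S A. finite S \<and> (\<forall>k. norm (b k) \<le> 1) \<and> 1 \<le> W p b (S \<inter> A) \<and> K * W p b S \<le> W p b (S \<inter> A)"
proof -
  have "\<forall>\<^sub>F n in sequentially. 1 \<le> C2 * (2 ^ n) powr \<beta>"
    and "\<forall>\<^sub>F n in sequentially. \<bar>K\<bar> * C1 \<le> C2 * (2 ^ n) powr (\<beta> - \<alpha>)"
    by (intro eventually_le_powr; use assms in simp)+
  with growth have "\<forall>\<^sub>F n in sequentially. \<exists>b S A. finite S \<and> (\<forall>k. norm (b k) \<le> 1) \<and>
      1 \<le> W p b (S \<inter> A) \<and> K * W p b S \<le> W p b (S \<inter> A)"
  proof eventually_elim
    case (elim n)
    then obtain b S A where b: "finite S" "\<forall>k. norm (b k) \<le> 1"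
      "W p b S \<le> C1 * (2 ^ n) powr \<alpha>" "C2 * (2 ^ n) powr \<beta> \<le> W p b (S \<inter> A)"
      by blast
    have "K * W p b S \<le> \<bar>K\<bar> * W p b S"
      by (intro mult_right_mono weighted_pow_nonneg) auto
    also have "\<dots> \<le> \<bar>K\<bar> * (C1 * (2 ^ n) powr \<alpha>)"
      by (intro mult_left_mono b) auto
    also have "\<dots> \<le> (C2 * (2 ^ n) powr (\<beta> - \<alpha>)) * (2 ^ n) powr \<alpha>"
      unfolding mult.assoc[symmetric] using elim by (intro mult_right_mono) auto
    also have "\<dots> = C2 * (2 ^ n) powr \<beta>"
      by (simp add: mult.assoc powr_add[symmetric])
    finally show ?case
      using b elim by (metis order_trans)
  qed
  then show ?thesis
    by (simp add: eventually_sequentially) blast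
qed

text \<open>The factor \<open>W p (\<lambda>_. 1) {0}\<close> is the integral of the p-th power of
  the modulus of \<open>w\<close>.\<close>

lemma W_le_of_norm_le:
  assumes p: "p \<ge> 1" and B: "\<And>x. norm (trig_poly c A x) \<le> B"
  shows "W p c A \<le> B powr p * W p (\<lambda>_. 1) {0}"
proof -
  have "W p c A \<le> (LINT x|lborel. B powr p * norm (trig_poly (\<lambda>_. 1) {0} x * w x) powr p)"
    unfolding weighted_pow_def
  proof (rule integral_mono)
    show "norm (trig_poly c A x * w x) powr p \<le> B powr p * norm (trig_poly (\<lambda>_. 1) {0} x * w x) powr p" for x
      using p B[of x] order_trans[OF norm_ge_zero B]
      by (simp add: norm_mult powr_mult trig_poly_def[of "\<lambda>_. 1" "{0}"] mult_right_mono powr_mono2)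
  qed (use p in \<open>auto intro!: integrable_trig_poly_w\<close>)
  then show ?thesis
    by (simp add: weighted_pow_def)
qed

text \<open>On this interval every phase is at most pi / 3 in modulus, so each term has real part at
  least 1/2.\<close>

lemma norm_dirichlet_near_0:
  assumes N: "N > 0" and x: "\<bar>x\<bar> \<le> 1 / (6 * of_int N)"
  shows "of_int N / 2 \<le> norm (trig_poly (\<lambda>_. 1) {0..<N} x)"
proof -
  have "1 / 2 \<le> cos (2 * pi * of_int k * x)" if "k \<in> {0..<N}" for k
  proof -
    have "\<bar>2 * pi * of_int k * x\<bar> = 2 * pi * (of_int k * \<bar>x\<bar>)"
      using that by (simp add: abs_mult)
    also have "\<dots> \<le> 2 * pi * (of_int N * (1 / (6 * of_int N)))"
      using that x by (intro mult_left_mono mult_mono) auto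
    also have "\<dots> = pi / 3"
      using N by simp
    finally have "cos (pi / 3) \<le> cos \<bar>2 * pi * of_int k * x\<bar>"
      by (intro cos_monotone_0_pi_le) auto
    then show ?thesis
      by (simp add: cos_60)
  qed
  then have "(\<Sum>k\<in>{0..<N}. 1 / 2) \<le> (\<Sum>k\<in>{0..<N}. cos (2 * pi * of_int k * x))"
    by (intro sum_mono)
  also have "\<dots> = Re (trig_poly (\<lambda>_. 1) {0..<N} x)"
    by (simp add: trig_poly_def)
  also have "\<dots> \<le> norm (trig_poly (\<lambda>_. 1) {0..<N} x)"
    by (rule complex_Re_le_cmod)
  finally show ?thesis
    using N by simp
qed

lemma hump_above_2:
  assumes p: "p > 2"
  shows "\<exists>b S A. finite S \<and> (\<forall>k. norm (b k) \<le> 1) \<and> 1 \<le> W p b (S \<inter> A) \<and> K * W p b S \<le> W p b (S \<inter> A)"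
proof (rule hump_of_growth)
  obtain \<delta> where \<delta>: "\<delta> > 0" "\<And>x. \<bar>x\<bar> \<le> \<delta> \<Longrightarrow> norm (w 0) / 2 \<le> norm (w x)"
    using w_near_0 by metis
  \<comment> \<open>One factor 1/2 comes from the height of the peak, the other from the variation
    of \<open>w\<close> near 0.\<close>
  define \<eta> where "\<eta> = norm (w 0) / 4"
  have "\<eta> > 0"
    using w_0 by (simp add: \<eta>_def)
  let ?C2 = "\<eta> powr p / 3 / (2 * 2 powr p)"
  let ?C1 = "2 powr (p / 2) * W p (\<lambda>_. 1) {0}"
  show "p / 2 < p - 1" "0 < p - 1" "0 < ?C2"
    using p \<open>\<eta> > 0\<close> by auto
  \<comment> \<open>Makes the peak narrow enough to lie where \<open>w\<close> is bounded
    below.\<close>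
  have "\<forall>\<^sub>F n in sequentially. 1 / (6 * \<delta>) \<le> 1 * (2 ^ n) powr 1"
    by (rule eventually_le_powr) auto
  then show "\<forall>\<^sub>F n in sequentially. \<exists>b S A. finite S \<and> (\<forall>k. norm (b k) \<le> 1) \<and>
      W p b S \<le> ?C1 * (2 ^ n) powr (p / 2) \<and> ?C2 * (2 ^ n) powr (p - 1) \<le> W p b (S \<inter> A)"
  proof eventually_elim
    case (elim n)
    define N :: real where "N = 2 ^ n"
    have N: "N > 0" "1 / (6 * N) \<le> \<delta>" "of_int (2 ^ n) = N"
      using elim \<delta>(1) by (auto simp: N_def field_simps)
    obtain r q :: "int \<Rightarrow> complex" where r: "\<And>k. r k \<in> {1, -1}"
      and rq: "\<And>x. (norm (trig_poly r {0..<2 ^ n} x))\<^sup>2 + (norm (trig_poly q {0..<2 ^ n} x))\<^sup>2 = 2 * 2 ^ n"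
      using rudin_shapiro[of n] by blast
    let ?S = "{0..<2 ^ n} :: int set"
    have "norm (trig_poly r ?S x) \<le> sqrt (2 * N)" for x
      using rq[of x] zero_le_power2[of "norm (trig_poly q ?S x)"] unfolding N_def by (intro real_le_rsqrt) linarith
    then have "W p r ?S \<le> sqrt (2 * N) powr p * W p (\<lambda>_. 1) {0}"
      using p by (intro W_le_of_norm_le) auto
    also have "sqrt (2 * N) powr p = 2 powr (p / 2) * N powr (p / 2)"
      using N(1) by (simp add: powr_half_sqrt[symmetric] powr_powr powr_mult)
    finally have small: "W p r ?S \<le> ?C1 * N powr (p / 2)"
      by (simp add: mult_ac)
    have "\<eta> * N \<le> norm (trig_poly (\<lambda>_. 1) ?S x * w x)" if "x \<in> {- (1 / (6 * N))..1 / (6 * N)}" for x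
    proof -
      have "\<bar>x\<bar> \<le> 1 / (6 * N)"
        using that by (simp add: abs_le_iff)
      then have "N / 2 * (norm (w 0) / 2) \<le> norm (trig_poly (\<lambda>_. 1) ?S x) * norm (w x)"
        using norm_dirichlet_near_0[of "2 ^ n" x] N \<delta>(2)[of x] by (intro mult_mono) auto
      then show ?thesis
        by (simp add: \<eta>_def norm_mult mult.commute)
    qed
    then have "(1 / (6 * N) - (- (1 / (6 * N)))) * (\<eta> * N) powr p \<le> W p (\<lambda>_. 1) ?S"
      using p N \<open>\<eta> > 0\<close> by (intro W_ge) auto
    moreover have "(1 / (6 * N) - (- (1 / (6 * N)))) * (\<eta> * N) powr p = \<eta> powr p / 3 * N powr (p - 1)"
      using N \<open>\<eta> > 0\<close> by (simp add: powr_mult powr_diff field_simps)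
    \<comment> \<open>Signs are their own inverses, so the Dirichlet kernel is \<open>r\<close> with
      its signs changed by \<open>r\<close>, and \<open>sign_split\<close> yields a subsum of
      \<open>r\<close>.\<close>
    moreover have "1 = r k * r k" for k
      using r[of k] by auto
    then obtain A where "W p (\<lambda>_. 1) ?S \<le> 2 * 2 powr p * W p r (?S \<inter> A)"
      using p r sign_split[of p ?S r "\<lambda>_. 1" r] by auto
    ultimately have "?C2 * N powr (p - 1) \<le> W p r (?S \<inter> A)"
      by (simp add: field_simps)
    moreover have "norm (r k) \<le> 1" for k
      using r[of k] by auto
    ultimately show ?case
      using small unfolding N_def by (intro exI[of _ r] exI[of _ ?S] exI[of _ A]) auto
  qed
qed

text \<open>Difference of two triangles: a trapezoid with value 1 up to modulus \<open>N\<close>,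
  falling linearly to 0 at \<open>2 * N\<close>.\<close>

definition vallee_poussin :: "nat \<Rightarrow> int \<Rightarrow> complex" where
  "vallee_poussin N k =
    of_real ((max 0 (real (2 * N) - real_of_int \<bar>k\<bar>) - max 0 (real N - real_of_int \<bar>k\<bar>)) / real N)"

lemma vallee_poussin_1: "N > 0 \<Longrightarrow> \<bar>k\<bar> \<le> int N \<Longrightarrow> vallee_poussin N k = 1"
proof -
  assume N: "N > 0" "\<bar>k\<bar> \<le> int N"
  then have "real_of_int \<bar>k\<bar> \<le> real N"
    by linarith
  with N show ?thesis
    by (simp add: vallee_poussin_def max_absorb2 del: of_int_abs)
qed

lemma norm_vallee_poussin_le: "norm (vallee_poussin N k) \<le> 1"
proof (cases "N = 0")
  case False
  define t where "t = real_of_int \<bar>k\<bar>"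
  have "t \<ge> 0"
    by (simp add: t_def)
  then have "\<bar>max 0 (real (2 * N) - t) - max 0 (real N - t)\<bar> \<le> real N"
    by (auto simp: max_def)
  with False show ?thesis
    unfolding vallee_poussin_def t_def[symmetric] norm_of_real abs_divide by (simp add: divide_le_eq)
qed (simp add: vallee_poussin_def)

lemma trig_poly_vallee_poussin:
  "trig_poly (vallee_poussin N) {- int (2 * N)..int (2 * N)} x =
    of_real (((norm (dirichlet (2 * N) x))\<^sup>2 - (norm (dirichlet N x))\<^sup>2) / real N)"
proof -
  have "trig_poly (vallee_poussin N) {- int (2 * N)..int (2 * N)} x =
      (trig_poly (\<lambda>k. of_real (max 0 (real (2 * N) - real_of_int \<bar>k\<bar>))) {- int (2 * N)..int (2 * N)} x -
      trig_poly (\<lambda>k. of_real (max 0 (real N - real_of_int \<bar>k\<bar>))) {- int (2 * N)..int (2 * N)} x) / of_nat N"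
    unfolding trig_poly_def sum_subtractf[symmetric] sum_divide_distrib
    by (intro sum.cong) (auto simp: vallee_poussin_def diff_divide_distrib left_diff_distrib)
  then show ?thesis
    by (simp only: trig_poly_fejer[OF order_refl] trig_poly_fejer[of N "2 * N"]) simp
qed

text \<open>Interpolation between L^1 and the supremum: of the p-th power, \<open>p - 1\<close>
  factors are bounded by \<open>5 * N * C\<close> (5 = 4 + 1, from the squared heights of the two
  kernels), and the last is integrated, giving \<open>3 * K\<close> (3 = 2 + 1).\<close>

lemma W_vallee_poussin_le:
  assumes p: "p \<ge> 1" and N: "N > 0"
  defines "K \<equiv> 4 * C * (LINT x::real|lborel. inverse (1 + x\<^sup>2))"
  shows "W p (vallee_poussin N) {- int (2 * N)..int (2 * N)} \<le> (5 * C) powr (p - 1) * (3 * K) * real N powr (p - 1)"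
proof -
  let ?V = "trig_poly (vallee_poussin N) {- int (2 * N)..int (2 * N)}"
  let ?F = "\<lambda>M x. (norm (dirichlet M x))\<^sup>2"
  have F: "?F M x \<le> (real M)\<^sup>2" for M x
    by (intro power_mono norm_dirichlet_le) simp
  have V: "norm (?V x) \<le> (?F (2 * N) x + ?F N x) / real N" for x
    unfolding trig_poly_vallee_poussin norm_of_real abs_divide
    by (intro divide_mono) (use N in \<open>auto simp: abs_le_iff\<close>)
  have V': "norm (?V x) \<le> 5 * real N" for x
  proof -
    have "norm (?V x) \<le> ((real (2 * N))\<^sup>2 + (real N)\<^sup>2) / real N"
      by (intro order_trans[OF V] divide_right_mono add_mono F) auto
    also have "\<dots> = 5 * real N"
      using N by (simp add: power2_eq_square field_simps)
    finally show ?thesis .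
  qed
  have "W p (vallee_poussin N) {- int (2 * N)..int (2 * N)} \<le>
      (LINT x|lborel. (5 * real N * C) powr (p - 1) / real N * (?F (2 * N) x * norm (w x) + ?F N x * norm (w x)))"
    unfolding weighted_pow_def
  proof (rule integral_mono)
    show "norm (?V x * w x) powr p \<le>
        (5 * real N * C) powr (p - 1) / real N * (?F (2 * N) x * norm (w x) + ?F N x * norm (w x))" for x
    proof -
      have "norm (?V x * w x) powr p = norm (?V x * w x) powr (p - 1) * norm (?V x * w x)"
        using powr_add[of "norm (?V x * w x)" "p - 1" 1] by simp
      also have "\<dots> \<le> (5 * real N * C) powr (p - 1) * ((?F (2 * N) x + ?F N x) / real N * norm (w x))"
        unfolding norm_mult using p
        by (intro mult_mono powr_mono2 V V' norm_w_le order_refl) auto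
      finally show ?thesis
        by (simp add: field_simps)
    qed
  qed (use p in \<open>auto intro!: integrable_trig_poly_w dirichlet_integral_le(1)
      Bochner_Integration.integrable_add\<close>)
  also have "\<dots> = (5 * real N * C) powr (p - 1) / real N *
      ((LINT x|lborel. ?F (2 * N) x * norm (w x)) + (LINT x|lborel. ?F N x * norm (w x)))"
    by (simp add: dirichlet_integral_le(1))
  also have "\<dots> \<le> (5 * real N * C) powr (p - 1) / real N * (K * real (2 * N) + K * real N)"
    unfolding K_def by (intro mult_left_mono add_mono dirichlet_integral_le(2)) auto
  also have "\<dots> = (5 * C) powr (p - 1) * (3 * K) * real N powr (p - 1)"
    using N C_nonneg by (simp add: powr_mult field_simps)
  finally show ?thesis .
qed

text \<open>At every point at least one of the squared moduli of \<open>r\<close> and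
  \<open>q\<close> is at least N, as they add up to 2 N. Hence one of the two has p-th power norm of
  order N^(p/2), and undoing its signs gives a large subsum of the Dirichlet kernel.\<close>

lemma hump_below_2:
  assumes p: "1 \<le> p" "p < 2"
  shows "\<exists>b S A. finite S \<and> (\<forall>k. norm (b k) \<le> 1) \<and> 1 \<le> W p b (S \<inter> A) \<and> K * W p b S \<le> W p b (S \<inter> A)"
proof (rule hump_of_growth)
  let ?I = "W p (\<lambda>_. 1) {0}"
  let ?C2 = "?I / 2 / (2 * 2 powr p)"
  let ?C1 = "(5 * C) powr (p - 1) * (3 * (4 * C * (LINT x::real|lborel. inverse (1 + x\<^sup>2))))"
  show "p - 1 < p / 2" "0 < p / 2" "0 < ?C2"
    using p W_one_pos[of p] by auto
  show "\<forall>\<^sub>F n in sequentially. \<exists>b S A. finite S \<and> (\<forall>k. norm (b k) \<le> 1) \<and>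
      W p b S \<le> ?C1 * (2 ^ n) powr (p - 1) \<and> ?C2 * (2 ^ n) powr (p / 2) \<le> W p b (S \<inter> A)"
  proof (rule always_eventually, rule allI)
    fix n :: nat
    let ?S = "{0..<2 ^ n} :: int set" and ?T = "{- int (2 * 2 ^ n)..int (2 * 2 ^ n)}"
    define N :: real where "N = 2 ^ n"
    have N: "N > 0"
      by (simp add: N_def)
    obtain r q :: "int \<Rightarrow> complex" where r: "\<And>k. r k \<in> {1, -1}" and q: "\<And>k. q k \<in> {1, -1}"
      and rq: "\<And>x. (norm (trig_poly r ?S x))\<^sup>2 + (norm (trig_poly q ?S x))\<^sup>2 = 2 * 2 ^ n"
      using rudin_shapiro[of n] by blast
    have "N powr (p / 2) * ?I = (LINT x|lborel. N powr (p / 2) * norm (trig_poly (\<lambda>_. 1) {0} x * w x) powr p)"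
      by (simp add: weighted_pow_def)
    also have "\<dots> \<le> (LINT x|lborel. norm (trig_poly r ?S x * w x) powr p + norm (trig_poly q ?S x * w x) powr p)"
    proof (rule integral_mono)
      fix x
      have *: "N powr (p / 2) \<le> norm z powr p" if "N \<le> (norm z)\<^sup>2" for z :: complex
      proof -
        have "N powr (p / 2) \<le> ((norm z)\<^sup>2) powr (p / 2)"
          using N p that by (intro powr_mono2) auto
        also have "\<dots> = norm z powr p"
          by (cases "z = 0") (simp_all add: powr_powr flip: powr_numeral)
        finally show ?thesis .
      qed
      have "N \<le> (norm (trig_poly r ?S x))\<^sup>2 \<or> N \<le> (norm (trig_poly q ?S x))\<^sup>2"
        using rq[of x] by (auto simp: N_def)
      then have "N powr (p / 2) \<le> norm (trig_poly r ?S x) powr p + norm (trig_poly q ?S x) powr p"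
        using *[of "trig_poly r ?S x"] *[of "trig_poly q ?S x"] by (smt (verit) powr_ge_zero)
      from mult_right_mono[OF this, of "norm (w x) powr p"]
      show "N powr (p / 2) * norm (trig_poly (\<lambda>_. 1) {0} x * w x) powr p \<le>
          norm (trig_poly r ?S x * w x) powr p + norm (trig_poly q ?S x * w x) powr p"
        by (simp add: trig_poly_def[of "\<lambda>_. 1" "{0}"] norm_mult powr_mult distrib_right)
    qed (use p in \<open>auto intro!: integrable_trig_poly_w Bochner_Integration.integrable_add\<close>)
    also have "\<dots> = W p r ?S + W p q ?S"
      using p by (simp add: weighted_pow_def integrable_trig_poly_w)
    finally have "N powr (p / 2) * ?I / 2 \<le> W p r ?S \<or> N powr (p / 2) * ?I / 2 \<le> W p q ?S"
      by linarith
    then obtain s where s: "\<And>k. s k \<in> {1, -1}" "N powr (p / 2) * ?I / 2 \<le> W p s ?S"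
      using r q by blast
    obtain A where A: "W p s ?S \<le> 2 * 2 powr p * W p (\<lambda>_. 1) (?S \<inter> A)"
      by (rule sign_split[of p ?S s s "\<lambda>_. 1"]) (use p s(1) in auto)
    have T: "?T \<inter> (?S \<inter> A) = ?S \<inter> A"
      by auto
    \<comment> \<open>The frequencies in \<open>?S\<close> lie on the plateau of the trapezoid, so
      this is also a subsum of the kernel.\<close>
    have "W p (\<lambda>_. 1) (?S \<inter> A) = W p (vallee_poussin (2 ^ n)) (?S \<inter> A)"
      by (intro weighted_pow_cong vallee_poussin_1[symmetric]) auto
    then have "?C2 * (2 ^ n) powr (p / 2) \<le> W p (vallee_poussin (2 ^ n)) (?T \<inter> (?S \<inter> A))"
      unfolding T using A s(2) by (simp add: N_def field_simps)
    moreover have "W p (vallee_poussin (2 ^ n)) ?T \<le> ?C1 * (2 ^ n) powr (p - 1)"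
      using W_vallee_poussin_le[of p "2 ^ n"] p by simp
    ultimately show "\<exists>b S A. finite S \<and> (\<forall>k. norm (b k) \<le> 1) \<and>
        W p b S \<le> ?C1 * (2 ^ n) powr (p - 1) \<and> ?C2 * (2 ^ n) powr (p / 2) \<le> W p b (S \<inter> A)"
      using norm_vallee_poussin_le by (metis finite_atLeastAtMost_int)
  qed
qed

end

section \<open>Arithmetic-geometric sums and the one-sided Fejer kernel\<close>

lemma sum_of_nat_mult_power:
  fixes z :: complex
  shows "(z - 1)\<^sup>2 * (\<Sum>i<M. of_nat (Suc i) * z ^ i) = of_nat M * z ^ M * (z - 1) - (z ^ M - 1)"
proof (induction M)
  case (Suc M)
  have "(z - 1)\<^sup>2 * (\<Sum>i<Suc M. of_nat (Suc i) * z ^ i) =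
      of_nat M * z ^ M * (z - 1) - (z ^ M - 1) + (z - 1)\<^sup>2 * (of_nat (Suc M) * z ^ M)"
    using Suc by (simp add: distrib_left)
  then show ?case
    by (simp add: power2_eq_square algebra_simps)
qed simp

text \<open>In the closed form the term with factor \<open>M\<close> has modulus at least 4 and the
  remainder at most 2, so at least half of the former survives.\<close>

lemma norm_sum_of_nat_mult_power_ge:
  fixes z :: complex
  assumes z: "norm z = 1" "z \<noteq> 1" and M: "real M * norm (z - 1) \<ge> 4"
  shows "real M / (2 * norm (z - 1)) \<le> norm (\<Sum>i<M. of_nat (Suc i) * z ^ i)"
proof -
  let ?S = "\<Sum>i<M. of_nat (Suc i) * z ^ i"
  have d: "norm (z - 1) > 0"
    using z by simp
  have "norm (of_nat M * z ^ M * (z - 1)) - norm (z ^ M - 1) \<le> norm ((z - 1)\<^sup>2 * ?S)"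
    unfolding sum_of_nat_mult_power by (rule norm_triangle_ineq2)
  moreover have "norm (z ^ M - 1) \<le> 2"
    using norm_triangle_ineq4[of "z ^ M" 1] z by (simp add: norm_power)
  ultimately have "real M * norm (z - 1) - 2 \<le> (norm (z - 1))\<^sup>2 * norm ?S"
    using z by (simp add: norm_mult norm_power)
  then have "real M * norm (z - 1) / 2 \<le> (norm (z - 1))\<^sup>2 * norm ?S"
    using M by linarith
  then show ?thesis
    using d by (simp add: field_simps power2_eq_square)
qed

context decaying_weight
begin

text \<open>The Fejer kernel is bounded in \<open>L\<^sup>1\<close>, while its part of nonpositive frequency behaves like
  \<open>1 / x\<close> near \<open>0\<close>.\<close>

lemma hump_1:
  "\<exists>b S. finite S \<and> (\<forall>k. norm (b k) \<le> 1) \<and> 1 \<le> W 1 b (S \<inter> {..0}) \<and> K * W 1 b S \<le> W 1 b (S \<inter> {..0})"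
proof -
  define K0 where "K0 = 4 * C * (LINT x::real|lborel. inverse (1 + x\<^sup>2))"
  define L where "L = max 1 (\<bar>K\<bar> * K0)"
  obtain \<delta> where \<delta>: "\<delta> > 0" "\<delta> < 1" "\<And>x. \<bar>x\<bar> \<le> \<delta> \<Longrightarrow> norm (w 0) / 2 \<le> norm (w x)"
    using w_near_0 by metis
  \<comment> \<open>Product of 1 / (4 pi), from the lower bound 1 / (4 pi x) for the polynomial, and
    \<open>norm (w 0) / 2\<close>.\<close>
  define \<eta> where "\<eta> = norm (w 0) / (8 * pi)"
  have \<eta>: "\<eta> > 0"
    using w_0 by (simp add: \<eta>_def)
  \<comment> \<open>Solves \<open>\<eta> * (ln \<delta> - ln \<epsilon>) = L\<close>, so that
    integrating \<open>\<eta> / x\<close> from \<open>\<epsilon>\<close> to \<open>\<delta>\<close>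
    gives exactly the required size.\<close>
  define \<epsilon> where "\<epsilon> = \<delta> * exp (- (L / \<eta>))"
  have "L / \<eta> > 0"
    using \<eta> by (simp add: L_def less_max_iff_disj)
  then have \<epsilon>: "0 < \<epsilon>" "\<epsilon> < \<delta>"
    using \<delta> by (simp_all add: \<epsilon>_def)
  have z1: "cis (2 * pi * x) \<noteq> 1" if "x \<in> {\<epsilon>..\<delta>}" for x
  proof
    assume "cis (2 * pi * x) = 1"
    then have "cos (2 * pi * x) = 1"
      by (metis cis.sel(1) one_complex.sel(1))
    then obtain n :: int where "2 * pi * x = of_int n * 2 * pi"
      by (auto simp: cos_one_2pi_int)
    then have "x = of_int n"
      by simp
    with that \<epsilon> \<delta> have "0 < n" "n < 1"
      by auto
    then show False
      by simp
  qed
  \<comment> \<open>The minimum of this distance is attained and positive, so a single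
    \<open>M\<close> satisfies the size condition of the lower bound at all points of the
    interval.\<close>
  have "continuous_on {\<epsilon>..\<delta>} (\<lambda>x. norm (cis (2 * pi * x) - 1))"
    by (intro continuous_intros)
  moreover have "{\<epsilon>..\<delta>} \<noteq> {}"
    using \<epsilon> by simp
  ultimately obtain x0 where x0: "x0 \<in> {\<epsilon>..\<delta>}"
    "\<And>x. x \<in> {\<epsilon>..\<delta>} \<Longrightarrow> norm (cis (2 * pi * x0) - 1) \<le> norm (cis (2 * pi * x) - 1)"
    using continuous_attains_inf[OF compact_Icc] by metis
  define \<mu> where "\<mu> = norm (cis (2 * pi * x0) - 1)"
  have "\<mu> > 0"
    using z1[OF x0(1)] by (simp add: \<mu>_def)
  obtain M :: nat where "4 / \<mu> < real M"
    using reals_Archimedean2 by blast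
  then have M: "real M * \<mu> \<ge> 4" "M > 0"
    using \<open>\<mu> > 0\<close> by (auto simp: field_simps intro: gr0I)
  define b :: "int \<Rightarrow> complex" where "b k = of_real (1 / real M) * of_real (max 0 (real M - real_of_int \<bar>k\<bar>))" for k
  let ?S = "{- int M..int M}"
  have b: "norm (b k) \<le> 1" for k
  proof -
    have "\<bar>max 0 (real M - real_of_int \<bar>k\<bar>)\<bar> \<le> real M"
      by (simp add: max_def)
    then show ?thesis
      unfolding b_def norm_mult norm_of_real using M(2) by (simp add: divide_le_eq)
  qed
  have "trig_poly b ?S x = of_real ((norm (dirichlet M x))\<^sup>2 / real M)" for x
    unfolding b_def trig_poly_scale trig_poly_fejer[OF order_refl] by simp
  then have "W 1 b ?S = (LINT x|lborel. (norm (dirichlet M x))\<^sup>2 * norm (w x)) / real M"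
    by (simp add: weighted_pow_def norm_mult norm_divide norm_power)
  also have "\<dots> \<le> K0"
    using dirichlet_integral_le(2)[of M] M(2) by (simp add: K0_def divide_le_eq)
  finally have small: "W 1 b ?S \<le> K0" .
  \<comment> \<open>The triangle vanishes at \<open>- int M\<close>; the other frequencies are
    \<open>i + 1 - M\<close> with coefficient \<open>(i + 1) / M\<close>, and a unimodular factor
    shifts them to \<open>i\<close>.\<close>
  have low: "norm (trig_poly b (?S \<inter> {..0}) x) = norm (\<Sum>i<M. of_nat (Suc i) * cis (2 * pi * x) ^ i) / real M" for x
  proof -
    have "trig_poly b (?S \<inter> {..0}) x = (\<Sum>k\<in>(\<lambda>i. int i + (1 - int M)) ` {..<M}. b k * cis (2 * pi * of_int k * x))"
      unfolding trig_poly_def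
    proof (rule sum.mono_neutral_right)
      show "(\<lambda>i. int i + (1 - int M)) ` {..<M} \<subseteq> ?S \<inter> {..0}"
        by auto
      show "\<forall>k\<in>?S \<inter> {..0} - (\<lambda>i. int i + (1 - int M)) ` {..<M}. b k * cis (2 * pi * of_int k * x) = 0"
      proof
        fix k assume k: "k \<in> ?S \<inter> {..0} - (\<lambda>i. int i + (1 - int M)) ` {..<M}"
        have "k = - int M"
        proof (rule ccontr)
          assume "k \<noteq> - int M"
          with k have "k = int (nat (k + int M - 1)) + (1 - int M)" "nat (k + int M - 1) < M"
            by auto
          with k show False
            by blast
        qed
        then show "b k * cis (2 * pi * of_int k * x) = 0"
          by (simp add: b_def)
      qed
    qed simp
    also have "\<dots> = (\<Sum>i<M. b (int i + (1 - int M)) * cis (2 * pi * of_int (int i + (1 - int M)) * x))"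
      by (subst sum.reindex) (auto simp: inj_on_def)
    also have "\<dots> = (\<Sum>i<M. (cis (2 * pi * of_int (1 - int M) * x) / of_nat M) * (of_nat (Suc i) * cis (2 * pi * x) ^ i))"
    proof (rule sum.cong)
      fix i assume i: "i \<in> {..<M}"
      then have "real_of_int \<bar>int i + (1 - int M)\<bar> = real M - real (Suc i)"
        by simp
      then have "b (int i + (1 - int M)) = of_nat (Suc i) / of_nat M"
        unfolding b_def by (simp add: max_absorb2)
      moreover have "cis (2 * pi * of_int (int i + (1 - int M)) * x) =
          cis (2 * pi * of_int (1 - int M) * x) * cis (2 * pi * x) ^ i"
        unfolding cis_of_nat_mult[symmetric] cis_mult by (rule arg_cong[where f = cis]) (simp add: algebra_simps)
      ultimately show "b (int i + (1 - int M)) * cis (2 * pi * of_int (int i + (1 - int M)) * x) =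
          (cis (2 * pi * of_int (1 - int M) * x) / of_nat M) * (of_nat (Suc i) * cis (2 * pi * x) ^ i)"
        by simp
    qed simp
    also have "\<dots> = (cis (2 * pi * of_int (1 - int M) * x) / of_nat M) * (\<Sum>i<M. of_nat (Suc i) * cis (2 * pi * x) ^ i)"
      by (rule sum_distrib_left[symmetric])
    finally show ?thesis
      by (simp add: norm_mult norm_divide)
  qed
  have large: "\<eta> / x \<le> norm (trig_poly b (?S \<inter> {..0}) x * w x)" if "x \<in> {\<epsilon>..\<delta>}" for x
  proof -
    let ?z = "cis (2 * pi * x)"
    have "x > 0"
      using that \<epsilon> by auto
    have "norm (?z - 1) \<le> 2 * pi * x"
      using norm_cis_diff_le[of "2 * pi * x" 0] \<open>x > 0\<close> by simp
    have "4 \<le> real M * norm (?z - 1)"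
      using M(1) x0(2)[OF that] by (smt (verit) \<mu>_def mult_left_mono of_nat_0_le_iff)
    from norm_sum_of_nat_mult_power_ge[OF _ z1[OF that] this]
    have "1 / (2 * norm (?z - 1)) \<le> norm (trig_poly b (?S \<inter> {..0}) x)"
      unfolding low using M(2) by (simp add: field_simps)
    moreover have "1 / (4 * pi * x) \<le> 1 / (2 * norm (?z - 1))"
      using z1[OF that] \<open>norm (?z - 1) \<le> 2 * pi * x\<close> by (intro divide_left_mono) (auto simp: \<open>x > 0\<close>)
    ultimately have "1 / (4 * pi * x) * (norm (w 0) / 2) \<le> norm (trig_poly b (?S \<inter> {..0}) x) * norm (w x)"
      using that \<epsilon> \<open>x > 0\<close> by (intro mult_mono \<delta>(3)) auto
    then show ?thesis
      by (simp add: \<eta>_def norm_mult mult_ac)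
  qed
  have "L = \<eta> * ln \<delta> - \<eta> * ln \<epsilon>"
    using \<delta> \<eta> by (simp add: \<epsilon>_def ln_mult algebra_simps)
  also have "((\<lambda>x. \<eta> / x) has_integral (\<eta> * ln \<delta> - \<eta> * ln \<epsilon>)) {\<epsilon>..\<delta>}"
  proof (rule fundamental_theorem_of_calculus)
    fix x assume "x \<in> {\<epsilon>..\<delta>}"
    then have "x > 0"
      using \<epsilon> by auto
    then show "((\<lambda>x. \<eta> * ln x) has_vector_derivative \<eta> / x) (at x within {\<epsilon>..\<delta>})"
      by (auto intro!: derivative_eq_intros simp flip: has_real_derivative_iff_has_vector_derivative)
  qed (use \<epsilon> in simp)
  then have "\<eta> * ln \<delta> - \<eta> * ln \<epsilon> = integral {\<epsilon>..\<delta>} (\<lambda>x. \<eta> / x)"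
    by (simp add: integral_unique)
  also have int: "set_integrable lborel {\<epsilon>..\<delta>} (\<lambda>x. \<eta> / x)"
    using \<epsilon> by (intro borel_integrable_atLeastAtMost' continuous_intros) auto
  have "integral {\<epsilon>..\<delta>} (\<lambda>x. \<eta> / x) = (LINT x|lborel. indicator {\<epsilon>..\<delta>} x *\<^sub>R (\<eta> / x))"
    using set_borel_integral_eq_integral(2)[OF int] by (simp add: set_lebesgue_integral_def)
  also have "\<dots> \<le> W 1 b (?S \<inter> {..0})"
    unfolding weighted_pow_def
  proof (rule integral_mono)
    show "indicator {\<epsilon>..\<delta>} x *\<^sub>R (\<eta> / x) \<le> norm (trig_poly b (?S \<inter> {..0}) x * w x) powr 1" for x
      using large[of x] by (cases "x \<in> {\<epsilon>..\<delta>}") auto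
    show "integrable lborel (\<lambda>x. indicator {\<epsilon>..\<delta>} x *\<^sub>R (\<eta> / x))"
      using int by (simp add: set_integrable_def)
  qed (rule integrable_trig_poly_w, simp)
  finally have big: "L \<le> W 1 b (?S \<inter> {..0})" .
  have "K * W 1 b ?S \<le> \<bar>K\<bar> * W 1 b ?S"
    by (intro mult_right_mono weighted_pow_nonneg) auto
  also have "\<dots> \<le> \<bar>K\<bar> * K0"
    by (intro mult_left_mono small) auto
  finally have "K * W 1 b ?S \<le> L"
    by (simp add: L_def)
  moreover have "1 \<le> L"
    by (simp add: L_def)
  ultimately show ?thesis
    using big b by (intro exI[of _ b] exI[of _ ?S]) auto
qed

end

section \<open>Failure of convergence\<close>

context unit_test_function
begin

definition x0 :: real where "x0 = (SOME x. h x \<noteq> 0)"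

lemma decaying_weight_h: "\<exists>C. decaying_weight (\<lambda>x. h (x + x0)) C"
proof -
  let ?C = "schwartz_seminorm 0 0 h + schwartz_seminorm 2 0 h"
  have "norm (h (x + x0)) \<le> ?C * (2 + 2 * x0\<^sup>2) * inverse (1 + x\<^sup>2)" for x
  proof -
    have "norm (h (x + x0)) \<le> ?C * inverse (1 + (x + x0)\<^sup>2)"
      by (rule schwartz_decay[OF h_schwartz])
    also have "\<dots> \<le> ?C * ((2 + 2 * x0\<^sup>2) * inverse (1 + x\<^sup>2))"
      using inverse_1_plus_square_shift[of "x + x0" "- x0"] schwartz_seminorm_nonneg[OF h_schwartz]
      by (intro mult_left_mono) auto
    finally show ?thesis
      by (simp add: mult.assoc)
  qed
  moreover have "h x0 \<noteq> 0"
    unfolding x0_def using h_nonzero by (rule someI_ex)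
  moreover have "continuous_on UNIV (\<lambda>x. h (x + x0))"
    by (rule continuous_on_compose2[OF continuous_on_h[of UNIV]]) (auto intro: continuous_intros)
  ultimately show ?thesis
    by (auto simp: decaying_weight_def)
qed

text \<open>Modulation moves the point \<open>0\<close>, where the kernels concentrate, to \<open>x0\<close>; translation of the
  coefficients does not change the absolute value of a trigonometric polynomial.\<close>

lemma wnorm_modulate:
  "wnorm p (\<lambda>k. b (k - s) * cis (- (2 * pi * of_int k * x0))) ((\<lambda>k. k + s) ` B) =
    weighted_pow p (\<lambda>x. h (x + x0)) b B"
proof -
  let ?d = "\<lambda>k. b (k - s) * cis (- (2 * pi * of_int k * x0))"
  have "trig_poly ?d A x = trig_poly (\<lambda>k. b (k - s)) A (x - x0)" for A x
    unfolding trig_poly_def by (intro sum.cong) (simp_all add: mult.assoc cis_mult algebra_simps)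
  then have "norm (trig_poly ?d ((\<lambda>k. k + s) ` B) x) = norm (trig_poly b B (x - x0))" for x
    by (simp add: trig_poly_shift norm_mult)
  then have "wnorm p ?d ((\<lambda>k. k + s) ` B) = (LINT x|lborel. norm (trig_poly b B (x - x0) * h x) powr p)"
    by (simp add: weighted_pow_def norm_mult)
  also have "\<dots> = (LINT x|lborel. norm (trig_poly b B x * h (x + x0)) powr p)"
    using lborel_integral_real_affine[of 1 "\<lambda>x. norm (trig_poly b B (x - x0) * h x) powr p" x0]
    by (simp add: add.commute)
  finally show ?thesis
    by (simp add: weighted_pow_def)
qed

lemma hump_modulate:
  fixes m :: int and S :: "int set"
  assumes "finite S" "\<And>k. norm (b k) \<le> 1"
    and "1 \<le> weighted_pow p (\<lambda>x. h (x + x0)) b (S \<inter> A)"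
    and "K * weighted_pow p (\<lambda>x. h (x + x0)) b S \<le> weighted_pow p (\<lambda>x. h (x + x0)) b (S \<inter> A)"
  shows "\<exists>b' S' s. finite S' \<and> S' \<subseteq> {m<..} \<and> (\<forall>k. norm (b' k) \<le> 1) \<and>
    1 \<le> wnorm p b' (S' \<inter> (\<lambda>k. k + s) ` A) \<and> K * wnorm p b' S' \<le> wnorm p b' (S' \<inter> (\<lambda>k. k + s) ` A)"
proof -
  \<comment> \<open>Moves even the lowest frequency past \<open>m\<close>; inserting 0 covers an
    empty \<open>S\<close>. The cut \<open>A\<close> is moved along.\<close>
  define s where "s = m + 1 - Min (insert 0 S)"
  define d where "d = (\<lambda>k. b (k - s) * cis (- (2 * pi * of_int k * x0)))"
  have "Min (insert 0 S) \<le> k" if "k \<in> S" for k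
    using that assms(1) by (intro Min_le) auto
  then have sub: "(\<lambda>k. k + s) ` S \<subseteq> {m<..}"
    by (force simp: s_def)
  have "(\<lambda>k. k + s) ` S \<inter> (\<lambda>k. k + s) ` A = (\<lambda>k. k + s) ` (S \<inter> A)"
    by (rule image_Int[symmetric]) (simp add: inj_on_def)
  with assms show ?thesis
    using sub wnorm_modulate[of p b s] unfolding d_def[symmetric]
    by (intro exI[of _ d] exI[of _ "(\<lambda>k. k + s) ` S"] exI[of _ s]) (auto simp: d_def norm_mult)
qed

lemma not_unconditionally_convergent:
  assumes p: "1 \<le> p" "p \<noteq> 2"
  shows "\<exists>c\<in>discrete_FL p chi. \<not> unconditionally_convergent_FL p chi c"
proof -
  obtain C where "decaying_weight (\<lambda>x. h (x + x0)) C"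
    using decaying_weight_h by blast
  then interpret decaying_weight "\<lambda>x. h (x + x0)" C .
  have hump: "\<exists>b S A. finite S \<and> S \<subseteq> {m<..} \<and> A \<in> UNIV \<and> (\<forall>k. norm (b k) \<le> 1) \<and>
      1 \<le> wnorm p b (S \<inter> A) \<and> K * wnorm p b S \<le> wnorm p b (S \<inter> A)" for m K
  proof -
    obtain b S A where "finite S" "\<And>k. norm (b k) \<le> 1" "1 \<le> W p b (S \<inter> A)" "K * W p b S \<le> W p b (S \<inter> A)"
      using hump_above_2[of p K] hump_below_2[of p K] p by (metis linorder_neqE_linordered_idom)
    from hump_modulate[OF this, of m] show ?thesis
      by blast
  qed
  obtain c where c: "c \<in> discrete_FL p chi"
    "\<And>n. \<exists>m M. \<exists>A\<in>UNIV. n \<le> m \<and> m \<le> M \<and> 1 \<le> wnorm p c ({m<..M} \<inter> A)"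
    using gliding_hump[OF p(1) hump] by metis
  have "\<not> unconditionally_convergent_FL p chi c"
  proof
    assume "unconditionally_convergent_FL p chi c"
    then obtain A0 where A0: "finite A0" "\<And>B. finite B \<Longrightarrow> A0 \<inter> B = {} \<Longrightarrow> wnorm p c B < 1"
      using unconditionally_convergent_imp_small[OF p(1) _ zero_less_one] by metis
    \<comment> \<open>A block lying entirely beyond \<open>A0\<close> contradicts the smallness of
      all sums disjoint from \<open>A0\<close>.\<close>
    obtain m M A where mM: "Max (insert 0 A0) \<le> m" "1 \<le> wnorm p c ({m<..M} \<inter> A)"
      using c(2)[of "Max (insert 0 A0)"] by blast
    have "k \<le> m" if "k \<in> A0" for k
      using that A0(1) mM(1) by (meson Max_ge finite_insert insertI2 order_trans)
    then have "A0 \<inter> ({m<..M} \<inter> A) = {}"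
      by force
    then show False
      using A0(2)[of "{m<..M} \<inter> A"] mM(2) by simp
  qed
  with c(1) show ?thesis
    by blast
qed

text \<open>As \<open>c\<close> vanishes at nonpositive frequencies, a symmetric partial sum is a
  one-sided one. The part of a block below a cut is then a difference of two symmetric partial sums,
  which is why cuts by half-lines are demanded.\<close>

lemma not_symmetrically_convergent:
  "\<exists>c\<in>discrete_FL 1 chi. \<not> symmetrically_convergent_FL 1 chi c"
proof -
  obtain C where "decaying_weight (\<lambda>x. h (x + x0)) C"
    using decaying_weight_h by blast
  then interpret decaying_weight "\<lambda>x. h (x + x0)" C .
  have hump: "\<exists>b S A. finite S \<and> S \<subseteq> {m<..} \<and> A \<in> range atMost \<and> (\<forall>k. norm (b k) \<le> 1) \<and>
      1 \<le> wnorm 1 b (S \<inter> A) \<and> K * wnorm 1 b S \<le> wnorm 1 b (S \<inter> A)" for m :: int and K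
  proof -
    obtain b S where "finite S" "\<And>k. norm (b k) \<le> 1" "1 \<le> W 1 b (S \<inter> {..0})" "K * W 1 b S \<le> W 1 b (S \<inter> {..0})"
      using hump_1[of K] by blast
    from hump_modulate[OF this, of m] obtain b' S' s where *: "finite S'" "S' \<subseteq> {m<..}" "\<forall>k. norm (b' k) \<le> 1"
      "1 \<le> wnorm 1 b' (S' \<inter> (\<lambda>k. k + s) ` {..0})" "K * wnorm 1 b' S' \<le> wnorm 1 b' (S' \<inter> (\<lambda>k. k + s) ` {..0})"
      by auto
    have "(\<lambda>k. k + s) ` {..0} \<in> range atMost"
    proof -
      have "x \<in> (\<lambda>k. k + s) ` {..0}" if "x \<le> s" for x
        using that by (intro image_eqI[of _ _ "x - s"]) auto
      then have "(\<lambda>k. k + s) ` {..0} = {..s}"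
        by auto
      then show ?thesis
        by simp
    qed
    with * show ?thesis
      by (intro exI[of _ b'] exI[of _ S'] exI[of _ "(\<lambda>k. k + s) ` {..0}"] conjI)
  qed
  obtain c where c: "c \<in> discrete_FL 1 chi" "\<And>k. k \<le> 0 \<Longrightarrow> c k = 0"
    "\<And>n. \<exists>m M. \<exists>A\<in>range atMost. n \<le> m \<and> m \<le> M \<and> 1 \<le> wnorm 1 c ({m<..M} \<inter> A)"
    using gliding_hump[OF order_refl hump] by metis
  have "\<not> symmetrically_convergent_FL 1 chi c"
  proof
    assume "symmetrically_convergent_FL 1 chi c"
    then obtain N where N: "\<And>m n. N \<le> m \<Longrightarrow> m \<le> n \<Longrightarrow> wnorm 1 c ({- int n..int n} - {- int m..int m}) < 1"
      using symmetrically_convergent_imp_small[OF order_refl _ zero_less_one] by metis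
    obtain m M a where mM: "int N \<le> m" "m \<le> M" "1 \<le> wnorm 1 c ({m<..M} \<inter> {..a})"
      using c(3)[of "int N"] by blast
    \<comment> \<open>The cut block ends at \<open>min M a\<close>; the maximum with
      \<open>m\<close> covers a cut below the block.\<close>
    define n where "n = max m (min M a)"
    have "trig_poly c ({- int (nat n)..int (nat n)} - {- int (nat m)..int (nat m)}) x = trig_poly c ({m<..M} \<inter> {..a}) x" for x
      unfolding trig_poly_def
    proof (rule sum.mono_neutral_right)
      show "{m<..M} \<inter> {..a} \<subseteq> {- int (nat n)..int (nat n)} - {- int (nat m)..int (nat m)}"
        using mM(1) by (auto simp: n_def)
      show "\<forall>k\<in>{- int (nat n)..int (nat n)} - {- int (nat m)..int (nat m)} - {m<..M} \<inter> {..a}.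
          c k * cis (2 * pi * of_int k * x) = 0"
        using mM(1,2) c(2) by (auto simp: n_def max_def min_def split: if_splits)
    qed simp
    then have "wnorm 1 c ({- int (nat n)..int (nat n)} - {- int (nat m)..int (nat m)}) =
        wnorm 1 c ({m<..M} \<inter> {..a})"
      by (simp add: weighted_pow_def)
    moreover have "N \<le> nat m" "nat m \<le> nat n"
      using mM(1) by (auto simp: n_def)
    ultimately show False
      using N[of "nat m" "nat n"] mM(3) by simp
  qed
  with c(1) show ?thesis
    by blast
qed

end

theorem proposition5p17:
  fixes chi :: "real \<Rightarrow> complex"
  assumes "chi \<in> test_functions {-1/2<..<1/2}" and "chi \<noteq> (\<lambda>_. 0)"
  shows "(\<forall>p::real. 1 \<le> p \<and> p \<noteq> 2 \<longrightarrow>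
            (\<exists>c\<in>discrete_FL p chi. \<not> unconditionally_convergent_FL p chi c)) \<and>
         (\<exists>c\<in>discrete_FL 1 chi. \<not> symmetrically_convergent_FL 1 chi c)"
proof -
  interpret unit_test_function chi
    by unfold_locales (use assms in auto)
  show ?thesis
    using not_unconditionally_convergent not_symmetrically_convergent by blast
qed

end
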